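(* Let $(\mu,\nu)\in\mathcal{M}_+^2$, with components $(\mu_k^\pm,\nu_k^\pm)_{k\in\mathcal{K}^\pm}$, $\mu^=,\nu^=$ and sets $A_k^+,A_k^-,A^=$ as defined in the context. Put $$\mathfrak{P}=\prod_{k\in\mathcal{K}^+}\mathfrak{C}(\mu_k^+,\nu_k^+)\times\prod_{k\in\mathcal{K}^-}\mathfrak{C}(\mu_k^-,\nu_k^-)\times\mathfrak{C}(\mu^=,\nu^=).$$ 1. For all $k\in\mathcal{K}^+$ (resp. $k\in\mathcal{K}^-$), $\mu_k^+\leq_{\mathrm F}\nu_k^+$ (resp. $\nu_k^-\leq_{\mathrm F}\mu_k^-$). Moreover, $\mu^==\nu^=$. 2. The map $\varphi:\mathfrak{P}\to\mathfrak{C}(\mu,\nu)$ defined by $$\varphi\big((\pi_k^+)_{k\in\mathcal{K}^+},(\pi_k^-)_{k\in\mathcal{K}^-},\pi^=\big)=\sum_{k\in\mathcal{K}^+}\pi_k^++\sum_{k\in\mathcal{K}^-}\pi_k^-+\pi^=$$ is (well defined and) a bijection. Furthermore, its inverse $\varphi^{-1}:\mathfrak{C}(\mu,\nu)\to\mathfrak{P}$ is given by $$\varphi^{-1}(\pi)=\Big(\big(\pi|_{A_k^+}\big)_{k\in\mathcal{K}^+},\big(\pi|_{A_k^-}\big)_{k\in\mathcal{K}^-},\pi|_{A^=}\Big).$$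
   Context: Notation. $\mathcal{M}_+(E)$ is the set of finite positive Borel measures on $E$; $\mathcal{M}_+^2=\{(\mu,\nu)\in\mathcal{M}_+(\mathbb{R})^2:\mu(\mathbb{R})=\nu(\mathbb{R})>0\}$. $\gamma|_A$ is the restriction of $\gamma$ to $A$; $\gamma(x)=\gamma(\{x\})$; $F_\gamma^+(t)=\gamma((-\infty,t])$, $F_\gamma^-(t)=\gamma((-\infty,t))$; $\{F_\mu^+>F_\nu^+\}=\{x: F_\mu^+(x)>F_\nu^+(x)\}$, etc. $\mathrm{Marg}(\gamma_1,\gamma_2)$ is the set of $\pi\in\mathcal{M}_+(\mathbb{R}^2)$ with marginals $\gamma_1,\gamma_2$. $\mathrm D=\{(x,x):x\in\mathbb{R}\}$. A set $\Gamma\subset\mathbb{R}^2$ is cyclically monotone if for all $n\ge1$ and $(x_1,y_1),\dots,(x_n,y_n)\in\Gamma$, $\sum_{i=1}^n|y_i-x_i|\le\sum_{i=1}^n|y_{i+1}-x_i|$ ($y_{n+1}=y_1$); a measure is cyclically monotone if it is concentrated on a cyclically monotone set. $\mathfrak{C}(\gamma_1,\gamma_2)$ is the set of cyclically monotone measures in $\mathrm{Marg}(\gamma_1,\gamma_2)$. Order $\leq_{\mathrm F}$. $\gamma_1\leq_{\mathrm{st}}\gamma_2$ means $\gamma_1(\mathbb{R})=\gamma_2(\mathbb{R})$ and $F_{\gamma_1}^+\geq F_{\gamma_2}^+$. With $T_\pm(\gamma_1,\gamma_2)=\{t: F_{\gamma_1}^\pm(t)>0\text{ and }F_{\gamma_2}^\pm(t)<\gamma_2(\mathbb{R})\}$,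 $\gamma_1\leq_{\mathrm F}\gamma_2$ means $\gamma_1\leq_{\mathrm{st}}\gamma_2$, $T_+(\gamma_1,\gamma_2)\subset\{F_{\gamma_1}^+>F_{\gamma_2}^+\}$ and $T_-(\gamma_1,\gamma_2)\subset\{F_{\gamma_1}^->F_{\gamma_2}^-\}$. Components of the real line. $E^+=\{F_\mu^+>F_\nu^+\}\cap\{F_\mu^->F_\nu^-\}$, $E^-=\{F_\mu^+<F_\nu^+\}\cap\{F_\mu^-<F_\nu^-\}$ (both open), $E^==\mathbb{R}\setminus(E^+\cup E^-)$. Let $(]a_k^+,b_k^+[)_{k\in\mathcal{K}^+}$ and $(]a_k^-,b_k^-[)_{k\in\mathcal{K}^-}$ be the countable families of connected components of $E^+$ and $E^-$ (endpoints may be infinite). $B$ is the set of all finite endpoints $a_k^\pm,b_k^\pm$. Components of the marginals (terms at infinite endpoints are zero). For $k\in\mathcal{K}^+$: $\mu_k^+=(F_\mu^+(a_k^+)-F_\nu^+(a_k^+))\delta_{a_k^+}+\mu|_{]a_k^+,b_k^+[}$ and $\nu_k^+=\nu|_{]a_k^+,b_k^+[}+(F_\mu^-(b_k^+)-F_\nu^-(b_k^+))\delta_{b_k^+}$. For $k\in\mathcal{K}^-$: $\mu_k^-=\mu|_{]a_k^-,b_k^-[}+(F_\nu^-(b_k^-)-F_\mu^-(b_k^-))\delta_{b_k^-}$ and $\nu_k^-=(F_\nu^+(a_k^-)-F_\mu^+(a_k^-))\delta_{a_k^-}+\nu|_{]a_k^-,b_k^-[}$. With $\mu^\pm=\sum_{k\in\mathcal{K}^\pm}\mu_k^\pm$,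 $\nu^\pm=\sum_{k\in\mathcal{K}^\pm}\nu_k^\pm$: $\mu^==\mu|_{B^c\cap E^=}+\sum_{x\in B}(\mu(x)-\mu^+(x)-\mu^-(x))\delta_x$ and $\nu^==\nu|_{B^c\cap E^=}+\sum_{x\in B}(\nu(x)-\nu^+(x)-\nu^-(x))\delta_x$. Sets. $A_k^+=[a_k^+,b_k^+[\,\times\,]a_k^+,b_k^+]$ for $k\in\mathcal{K}^+$; $A_k^-=\,]a_k^-,b_k^-]\times[a_k^-,b_k^-[$ for $k\in\mathcal{K}^-$ (an infinite endpoint is always excluded from the interval); $A^==[(B^c\cap E^=)\times\mathbb{R}]\cup[\mathrm D\cap(B\times\mathbb{R})]$. *)

theory Defs
  imports "HOL-Probability.Probability"
begin

section \<open>Measures\<close>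

definition fin_borel :: "'a::topological_space measure set"
  where "fin_borel = {\<gamma>. sets \<gamma> = sets borel \<and> finite_measure \<gamma>}"

definition same_mass_pairs :: "(real measure \<times> real measure) set"
  where "same_mass_pairs =
    {(\<mu>, \<nu>). \<mu> \<in> fin_borel \<and> \<nu> \<in> fin_borel \<and>
      emeasure \<mu> UNIV = emeasure \<nu> UNIV \<and> emeasure \<nu> UNIV > 0}"

text \<open>The restriction of \<open>\<gamma>\<close> to \<open>A\<close>, kept as a measure on the whole space
  (\<open>restrict_space\<close> would shrink the underlying space to \<open>A\<close>).\<close>

definition mrestr :: "'a::topological_space measure \<Rightarrow> 'a set \<Rightarrow> 'a measure"
  where "mrestr \<gamma> A = density \<gamma> (indicator A)"

text \<open>Setwise sums of families of Borel measures, over arbitrary index sets. The lemmas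
  \<open>emeasure_madd\<close> and \<open>emeasure_msum\<close> below show that the set functions are indeed measures,
  so that the \<open>measure_of\<close> construction does not degenerate.\<close>

definition madd :: "'a::topological_space measure \<Rightarrow> 'a measure \<Rightarrow> 'a measure"  (infixl "\<oplus>\<^sub>m" 65)
  where "M \<oplus>\<^sub>m N = measure_of UNIV (sets borel) (\<lambda>A. emeasure M A + emeasure N A)"

definition msum :: "'i set \<Rightarrow> ('i \<Rightarrow> 'a::topological_space measure) \<Rightarrow> 'a measure"
  where "msum I f =
    measure_of UNIV (sets borel) (\<lambda>A. \<integral>\<^sup>+ i. emeasure (f i) A \<partial>count_space I)"

lemma sets_msum [simp]: "sets (msum I f) = sets borel"
  unfolding msum_def by (metis sets.sets_measure_of_eq space_borel)

lemma sets_madd [simp]: "sets (M \<oplus>\<^sub>m N) = sets borel"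
  unfolding madd_def by (metis sets.sets_measure_of_eq space_borel)

lemma emeasure_msum:
  fixes f :: "'i \<Rightarrow> 'a::topological_space measure"
  assumes "\<And>i. i \<in> I \<Longrightarrow> sets (f i) = sets borel" and "A \<in> sets borel"
  shows "emeasure (msum I f) A = (\<integral>\<^sup>+ i. emeasure (f i) A \<partial>count_space I)"
  unfolding msum_def
proof (rule emeasure_measure_of_sigma)
  show "sigma_algebra (UNIV :: 'a set) (sets borel)"
    by (metis sets.sigma_algebra_axioms space_borel)
  show "positive (sets borel) (\<lambda>A. \<integral>\<^sup>+ i. emeasure (f i) A \<partial>count_space I)"
    by (simp add: positive_def)
  show "countably_additive (sets borel) (\<lambda>A. \<integral>\<^sup>+ i. emeasure (f i) A \<partial>count_space I)"
  proof (rule countably_additiveI)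
    fix S :: "nat \<Rightarrow> 'a set"
    assume S: "range S \<subseteq> sets borel" "disjoint_family S"
    have "(\<Sum>n. \<integral>\<^sup>+ i. emeasure (f i) (S n) \<partial>count_space I) =
          (\<integral>\<^sup>+ i. (\<Sum>n. emeasure (f i) (S n)) \<partial>count_space I)"
      by (rule nn_integral_suminf [symmetric]) simp
    also have "\<dots> = (\<integral>\<^sup>+ i. emeasure (f i) (\<Union> (range S)) \<partial>count_space I)"
      using S assms(1) by (intro nn_integral_cong suminf_emeasure) auto
    finally show "(\<Sum>n. \<integral>\<^sup>+ i. emeasure (f i) (S n) \<partial>count_space I) =
          (\<integral>\<^sup>+ i. emeasure (f i) (\<Union> (range S)) \<partial>count_space I)" .
  qed
qed (fact assms(2))

lemma emeasure_madd:
  fixes M N :: "'a::topological_space measure"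
  assumes "sets M = sets borel" "sets N = sets borel" "A \<in> sets borel"
  shows "emeasure (M \<oplus>\<^sub>m N) A = emeasure M A + emeasure N A"
  unfolding madd_def
proof (rule emeasure_measure_of_sigma)
  show "sigma_algebra (UNIV :: 'a set) (sets borel)"
    by (metis sets.sigma_algebra_axioms space_borel)
  show "positive (sets borel) (\<lambda>A. emeasure M A + emeasure N A)"
    by (simp add: positive_def)
  show "countably_additive (sets borel) (\<lambda>A. emeasure M A + emeasure N A)"
  proof (rule countably_additiveI)
    fix S :: "nat \<Rightarrow> 'a set"
    assume S: "range S \<subseteq> sets borel" "disjoint_family S"
    show "(\<Sum>n. emeasure M (S n) + emeasure N (S n)) =
          emeasure M (\<Union> (range S)) + emeasure N (\<Union> (range S))"
      using S assms(1,2) suminf_emeasure[of S M] suminf_emeasure[of S N]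
      by (subst suminf_add [symmetric]) auto
  qed
qed (fact assms(3))

text \<open>\<open>F\<^sup>+\<close> is the library's \<open>cdf\<close>; here is its left-continuous companion \<open>F\<^sup>-\<close>.\<close>

definition cdf_left :: "real measure \<Rightarrow> real \<Rightarrow> real"
  where "cdf_left \<gamma> t = measure \<gamma> {..<t}"

section \<open>Transport plans and cyclical monotonicity\<close>

definition Marg :: "real measure \<Rightarrow> real measure \<Rightarrow> (real \<times> real) measure set"
  where "Marg \<gamma>\<^sub>1 \<gamma>\<^sub>2 = {\<pi> \<in> fin_borel. distr \<pi> borel fst = \<gamma>\<^sub>1 \<and> distr \<pi> borel snd = \<gamma>\<^sub>2}"

definition cyclically_monotone :: "(real \<times> real) set \<Rightarrow> bool"
  where "cyclically_monotone \<Gamma> \<longleftrightarrow>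
    (\<forall>n\<ge>1. \<forall>x y :: nat \<Rightarrow> real. (\<forall>i<n. (x i, y i) \<in> \<Gamma>) \<longrightarrow>
      (\<Sum>i<n. \<bar>y i - x i\<bar>) \<le> (\<Sum>i<n. \<bar>y (Suc i mod n) - x i\<bar>))"

definition cyclically_monotone_measure :: "(real \<times> real) measure \<Rightarrow> bool"
  where "cyclically_monotone_measure \<pi> \<longleftrightarrow>
    (\<exists>\<Gamma>. cyclically_monotone \<Gamma> \<and> (AE p in \<pi>. p \<in> \<Gamma>))"

definition CMarg :: "real measure \<Rightarrow> real measure \<Rightarrow> (real \<times> real) measure set"
  where "CMarg \<gamma>\<^sub>1 \<gamma>\<^sub>2 = {\<pi> \<in> Marg \<gamma>\<^sub>1 \<gamma>\<^sub>2. cyclically_monotone_measure \<pi>}"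

section \<open>The orders\<close>

definition st_le :: "real measure \<Rightarrow> real measure \<Rightarrow> bool"  (infix "\<le>\<^sub>s\<^sub>t" 50)
  where "\<gamma>\<^sub>1 \<le>\<^sub>s\<^sub>t \<gamma>\<^sub>2 \<longleftrightarrow>
    emeasure \<gamma>\<^sub>1 UNIV = emeasure \<gamma>\<^sub>2 UNIV \<and> (\<forall>t. cdf \<gamma>\<^sub>1 t \<ge> cdf \<gamma>\<^sub>2 t)"

definition T_plus :: "real measure \<Rightarrow> real measure \<Rightarrow> real set"
  where "T_plus \<gamma>\<^sub>1 \<gamma>\<^sub>2 = {t. cdf \<gamma>\<^sub>1 t > 0 \<and> cdf \<gamma>\<^sub>2 t < measure \<gamma>\<^sub>2 UNIV}"

definition T_minus :: "real measure \<Rightarrow> real measure \<Rightarrow> real set"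
  where "T_minus \<gamma>\<^sub>1 \<gamma>\<^sub>2 = {t. cdf_left \<gamma>\<^sub>1 t > 0 \<and> cdf_left \<gamma>\<^sub>2 t < measure \<gamma>\<^sub>2 UNIV}"

definition F_le :: "real measure \<Rightarrow> real measure \<Rightarrow> bool"  (infix "\<le>\<^sub>F" 50)
  where "\<gamma>\<^sub>1 \<le>\<^sub>F \<gamma>\<^sub>2 \<longleftrightarrow> \<gamma>\<^sub>1 \<le>\<^sub>s\<^sub>t \<gamma>\<^sub>2 \<and>
    T_plus \<gamma>\<^sub>1 \<gamma>\<^sub>2 \<subseteq> {t. cdf \<gamma>\<^sub>1 t > cdf \<gamma>\<^sub>2 t} \<and>
    T_minus \<gamma>\<^sub>1 \<gamma>\<^sub>2 \<subseteq> {t. cdf_left \<gamma>\<^sub>1 t > cdf_left \<gamma>\<^sub>2 t}"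

section \<open>Components of the real line\<close>

definition E_plus :: "real measure \<Rightarrow> real measure \<Rightarrow> real set"
  where "E_plus \<mu> \<nu> = {x. cdf \<mu> x > cdf \<nu> x} \<inter> {x. cdf_left \<mu> x > cdf_left \<nu> x}"

definition E_minus :: "real measure \<Rightarrow> real measure \<Rightarrow> real set"
  where "E_minus \<mu> \<nu> = {x. cdf \<mu> x < cdf \<nu> x} \<inter> {x. cdf_left \<mu> x < cdf_left \<nu> x}"

definition E_eq :: "real measure \<Rightarrow> real measure \<Rightarrow> real set"
  where "E_eq \<mu> \<nu> = UNIV - (E_plus \<mu> \<nu> \<union> E_minus \<mu> \<nu>)"

text \<open>The families of components are indexed by the components themselves: the index sets are
  \<open>K_plus\<close> and \<open>K_minus\<close>, and an index \<open>C\<close> is the open interval with endpoints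
  \<open>lend C\<close> and \<open>rend C\<close> in the extended reals.\<close>

definition K_plus :: "real measure \<Rightarrow> real measure \<Rightarrow> real set set"
  where "K_plus \<mu> \<nu> = components (E_plus \<mu> \<nu>)"

definition K_minus :: "real measure \<Rightarrow> real measure \<Rightarrow> real set set"
  where "K_minus \<mu> \<nu> = components (E_minus \<mu> \<nu>)"

definition lend :: "real set \<Rightarrow> ereal"
  where "lend C = (INF x\<in>C. ereal x)"

definition rend :: "real set \<Rightarrow> ereal"
  where "rend C = (SUP x\<in>C. ereal x)"

definition Bset :: "real measure \<Rightarrow> real measure \<Rightarrow> real set"
  where "Bset \<mu> \<nu> =
    {x. \<exists>C \<in> K_plus \<mu> \<nu> \<union> K_minus \<mu> \<nu>. ereal x = lend C \<or> ereal x = rend C}"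

section \<open>Components of the marginals\<close>

text \<open>The weights below are real numbers, and \<open>ennreal\<close> would turn a negative one into \<open>0\<close>.
  For finite Borel measures this never happens. At an endpoint of a component the weight is a
  one-sided limit of differences having the right sign on the component. In \<open>mu_eq\<close>, let \<open>x\<close> be
  in \<open>B\<close>; as \<open>x\<close> lies neither in \<open>E\<^sup>+\<close> nor in \<open>E\<^sup>-\<close>, it carries mass of \<open>\<mu>\<^sup>+\<close> only as a left
  endpoint of a component of \<open>E\<^sup>+\<close>, and mass of \<open>\<mu>\<^sup>-\<close> only as a right endpoint of a component of
  \<open>E\<^sup>-\<close>, and these masses add up to at most \<open>\<mu> {x}\<close>; similarly for \<open>nu_eq\<close>.\<close>

definition point_mass :: "real \<Rightarrow> real \<Rightarrow> real measure"
  where "point_mass w x = scale_measure (ennreal w) (return borel x)"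

definition end_mass :: "(real \<Rightarrow> real) \<Rightarrow> ereal \<Rightarrow> real measure"
  where "end_mass w e =
    (if \<bar>e\<bar> = \<infinity> then null_measure borel else point_mass (w (real_of_ereal e)) (real_of_ereal e))"

definition mu_plus_comp :: "real measure \<Rightarrow> real measure \<Rightarrow> real set \<Rightarrow> real measure"
  where "mu_plus_comp \<mu> \<nu> C = end_mass (\<lambda>a. cdf \<mu> a - cdf \<nu> a) (lend C) \<oplus>\<^sub>m mrestr \<mu> C"

definition nu_plus_comp :: "real measure \<Rightarrow> real measure \<Rightarrow> real set \<Rightarrow> real measure"
  where "nu_plus_comp \<mu> \<nu> C = mrestr \<nu> C \<oplus>\<^sub>m end_mass (\<lambda>b. cdf_left \<mu> b - cdf_left \<nu> b) (rend C)"

definition mu_minus_comp :: "real measure \<Rightarrow> real measure \<Rightarrow> real set \<Rightarrow> real measure"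
  where "mu_minus_comp \<mu> \<nu> C = mrestr \<mu> C \<oplus>\<^sub>m end_mass (\<lambda>b. cdf_left \<nu> b - cdf_left \<mu> b) (rend C)"

definition nu_minus_comp :: "real measure \<Rightarrow> real measure \<Rightarrow> real set \<Rightarrow> real measure"
  where "nu_minus_comp \<mu> \<nu> C = end_mass (\<lambda>a. cdf \<nu> a - cdf \<mu> a) (lend C) \<oplus>\<^sub>m mrestr \<nu> C"

definition mu_plus :: "real measure \<Rightarrow> real measure \<Rightarrow> real measure"
  where "mu_plus \<mu> \<nu> = msum (K_plus \<mu> \<nu>) (mu_plus_comp \<mu> \<nu>)"

definition nu_plus :: "real measure \<Rightarrow> real measure \<Rightarrow> real measure"
  where "nu_plus \<mu> \<nu> = msum (K_plus \<mu> \<nu>) (nu_plus_comp \<mu> \<nu>)"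

definition mu_minus :: "real measure \<Rightarrow> real measure \<Rightarrow> real measure"
  where "mu_minus \<mu> \<nu> = msum (K_minus \<mu> \<nu>) (mu_minus_comp \<mu> \<nu>)"

definition nu_minus :: "real measure \<Rightarrow> real measure \<Rightarrow> real measure"
  where "nu_minus \<mu> \<nu> = msum (K_minus \<mu> \<nu>) (nu_minus_comp \<mu> \<nu>)"

definition mu_eq :: "real measure \<Rightarrow> real measure \<Rightarrow> real measure"
  where "mu_eq \<mu> \<nu> = mrestr \<mu> (- Bset \<mu> \<nu> \<inter> E_eq \<mu> \<nu>) \<oplus>\<^sub>m
    msum (Bset \<mu> \<nu>)
      (\<lambda>x. point_mass (measure \<mu> {x} - measure (mu_plus \<mu> \<nu>) {x} - measure (mu_minus \<mu> \<nu>) {x}) x)"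

definition nu_eq :: "real measure \<Rightarrow> real measure \<Rightarrow> real measure"
  where "nu_eq \<mu> \<nu> = mrestr \<nu> (- Bset \<mu> \<nu> \<inter> E_eq \<mu> \<nu>) \<oplus>\<^sub>m
    msum (Bset \<mu> \<nu>)
      (\<lambda>x. point_mass (measure \<nu> {x} - measure (nu_plus \<mu> \<nu>) {x} - measure (nu_minus \<mu> \<nu>) {x}) x)"

section \<open>The decomposition of cyclically monotone plans\<close>

definition A_plus :: "real set \<Rightarrow> (real \<times> real) set"
  where "A_plus C = {x. lend C \<le> ereal x \<and> ereal x < rend C} \<times>
                    {y. lend C < ereal y \<and> ereal y \<le> rend C}"

definition A_minus :: "real set \<Rightarrow> (real \<times> real) set"
  where "A_minus C = {x. lend C < ereal x \<and> ereal x \<le> rend C} \<times>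
                     {y. lend C \<le> ereal y \<and> ereal y < rend C}"

definition A_eq :: "real measure \<Rightarrow> real measure \<Rightarrow> (real \<times> real) set"
  where "A_eq \<mu> \<nu> = ((- Bset \<mu> \<nu> \<inter> E_eq \<mu> \<nu>) \<times> UNIV) \<union> (Id \<inter> (Bset \<mu> \<nu> \<times> UNIV))"

type_synonym plan = "(real \<times> real) measure"

definition plan_families ::
    "real measure \<Rightarrow> real measure \<Rightarrow> ((real set \<Rightarrow> plan) \<times> (real set \<Rightarrow> plan) \<times> plan) set"
  where "plan_families \<mu> \<nu> =
    (\<Pi>\<^sub>E C\<in>K_plus \<mu> \<nu>. CMarg (mu_plus_comp \<mu> \<nu> C) (nu_plus_comp \<mu> \<nu> C)) \<times>
    (\<Pi>\<^sub>E C\<in>K_minus \<mu> \<nu>. CMarg (mu_minus_comp \<mu> \<nu> C) (nu_minus_comp \<mu> \<nu> C)) \<times>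
    CMarg (mu_eq \<mu> \<nu>) (nu_eq \<mu> \<nu>)"

definition glue ::
    "real measure \<Rightarrow> real measure \<Rightarrow> (real set \<Rightarrow> plan) \<times> (real set \<Rightarrow> plan) \<times> plan \<Rightarrow> plan"
  where "glue \<mu> \<nu> = (\<lambda>(\<pi>\<^sub>p, \<pi>\<^sub>m, \<pi>\<^sub>e). msum (K_plus \<mu> \<nu>) \<pi>\<^sub>p \<oplus>\<^sub>m msum (K_minus \<mu> \<nu>) \<pi>\<^sub>m \<oplus>\<^sub>m \<pi>\<^sub>e)"

end

theory Submission
  imports Defs
begin

text \<open>A plan \<open>\<pi>\<close> is cyclically monotone iff, for every \<open>t\<close>, it does not move mass across \<open>t\<close> in both
  directions. Since \<open>F\<^sub>\<mu>(t) - F\<^sub>\<nu>(t)\<close> is the mass that \<open>\<pi>\<close> moves upwards across \<open>t\<close> minus the mass it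
  moves downwards, the marginals decide which of the two vanishes: almost every segment from \<open>x\<close> up
  (down) to \<open>y\<close> lies in a single component of \<open>E\<^sup>+\<close> (of \<open>E\<^sup>-\<close>), up to its endpoints. So \<open>\<pi>\<close> is the sum of
  its restrictions to the disjoint sets \<open>A\<^sub>k\<^sup>+\<close>, \<open>A\<^sub>k\<^sup>-\<close> and \<open>A\<^sup>=\<close>, whose marginals can be computed.
  Conversely, a sum of plans for the components still moves mass upwards across \<open>t\<close> only if
  \<open>F\<^sub>\<mu>(t) > F\<^sub>\<nu>(t)\<close>. Exchanging \<open>\<mu>\<close> and \<open>\<nu>\<close> turns the negative components into positive ones.\<close>

section \<open>Components of open subsets of the line\<close>

text \<open>Being null is a statement about one threshold \<open>t\<close> at a time, while
  monotonicity of a set and confinement to a component concern all \<open>t\<close> at once. Both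
  therefore pass to countably many thresholds: rational ones for monotonicity, a countable dense
  subset of the complement of E^+ for confinement. At a point outside E^+ perhaps only one of the
  two strict inequalities fails, so the crossing masses are computed for F^+ and for F^-. The
  weights at the endpoints have the same origin: almost no upward segment has the left endpoint a of
  a positive component in its interior, so the mass crossing a upwards starts exactly at a, and it
  amounts to F_\<mu>(a) - F_\<nu>(a). The equality of \<mu>^= and \<nu>^= is delicate because the
  set where the distribution functions agree may contain no interval; complements of compact sets
  and inner regularity deal with it. The marginals of the restriction to A^= are not computed
  directly: once those of the other pieces are known, they follow by cancelling finite
  measures.\<close>

lemma component_eq_interval:
  assumes "open U" "C \<in> components U"
  shows "C = {x. lend C < ereal x \<and> ereal x < rend C}"
proof (intro set_eqI iffI)
  fix x assume x: "x \<in> C"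
  have "open C" using assms open_components by blast
  then obtain e where e: "e > 0" "ball x e \<subseteq> C"
    using x openE by blast
  have m: "x - e/2 \<in> C" "x + e/2 \<in> C"
    using e by (auto intro!: subsetD[OF e(2)] simp: dist_real_def)
  have "lend C \<le> ereal (x - e/2)" "ereal (x + e/2) \<le> rend C"
    unfolding lend_def rend_def using m by (auto intro!: INF_lower SUP_upper)
  moreover have "ereal (x - e/2) < ereal x" "ereal x < ereal (x + e/2)" using e by auto
  ultimately show "x \<in> {x. lend C < ereal x \<and> ereal x < rend C}"
    using le_less_trans less_le_trans by blast
next
  fix x assume "x \<in> {x. lend C < ereal x \<and> ereal x < rend C}"
  then obtain y z where "y \<in> C" "y < x" "z \<in> C" "x < z"
    unfolding lend_def rend_def by (auto simp: INF_less_iff less_SUP_iff)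
  moreover have "connected C" using assms(2) in_components_connected by blast
  ultimately show "x \<in> C" by (meson connected_contains_Icc atLeastAtMost_iff less_imp_le subsetD)
qed

lemma mem_component_iff:
  assumes "open U" "C \<in> components U"
  shows "x \<in> C \<longleftrightarrow> lend C < ereal x \<and> ereal x < rend C"
  using component_eq_interval[OF assms] by blast

lemma lend_less_rend:
  assumes "open U" "C \<in> components U"
  shows "lend C < rend C"
  using in_components_nonempty[OF assms(2)] mem_component_iff[OF assms] by fastforce

text \<open>If an endpoint lay in \<open>U\<close>, a ball around it inside \<open>U\<close> would
  meet \<open>C\<close>; by maximality \<open>C\<close> would contain the ball and thus its own
  endpoint.\<close>

lemma component_end_notin:
  assumes "open U" "C \<in> components U" "ereal a = lend C \<or> ereal a = rend C"
  shows "a \<notin> U"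
proof
  assume "a \<in> U"
  then obtain e where e: "e > 0" "ball a e \<subseteq> U"
    using assms(1) openE by blast
  have "a \<notin> C" using assms(3) mem_component_iff[OF assms(1,2), of a] by auto
  have "\<exists>y\<in>C. y \<in> ball a e"
    using assms(3)
  proof
    assume a: "ereal a = lend C"
    have "lend C < ereal (a + e)" using e(1) by (simp add: a[symmetric])
    then obtain y where "y \<in> C" "y < a + e" unfolding lend_def by (auto simp: INF_less_iff)
    moreover have "a < y" using mem_component_iff[OF assms(1,2), of y] \<open>y \<in> C\<close> by (simp add: a[symmetric])
    ultimately show ?thesis by (auto simp: dist_real_def intro!: bexI[of _ y])
  next
    assume a: "ereal a = rend C"
    have "ereal (a - e) < rend C" using e(1) by (simp add: a[symmetric])
    then obtain y where "y \<in> C" "a - e < y" unfolding rend_def by (auto simp: less_SUP_iff)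
    moreover have "y < a" using mem_component_iff[OF assms(1,2), of y] \<open>y \<in> C\<close> by (simp add: a[symmetric])
    ultimately show ?thesis by (auto simp: dist_real_def intro!: bexI[of _ y])
  qed
  then have "ball a e \<subseteq> C"
    using components_maximal[OF assms(2) connected_ball e(2)] by blast
  with \<open>a \<notin> C\<close> e(1) show False by (meson centre_in_ball subsetD)
qed

text \<open>Only the open segment has to lie in \<open>U\<close>, so \<open>x\<close> and
  \<open>y\<close> may themselves be endpoints of the component; hence the weak bounds.\<close>

lemma segment_in_component:
  fixes x y :: real
  assumes "open U" "x < y" "{x<..<y} \<subseteq> U"
  obtains C where "C \<in> components U" "lend C \<le> ereal x" "ereal y \<le> rend C"
proof -
  obtain C where C: "C \<in> components U" "{x<..<y} \<subseteq> C"
    using exists_component_superset[of "{x<..<y}" U] assms dense[OF assms(2)] by fastforce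
  have "lend C \<le> ereal x"
  proof (rule ccontr)
    assume "\<not> ?thesis"
    then have "ereal x < min (lend C) (ereal y)" using assms(2) by auto
    then obtain z where "ereal x < ereal z" "ereal z < min (lend C) (ereal y)"
      by (meson ereal_dense2)
    then show False using C mem_component_iff[OF assms(1) C(1), of z] by auto
  qed
  moreover have "ereal y \<le> rend C"
  proof (rule ccontr)
    assume "\<not> ?thesis"
    then have "max (rend C) (ereal x) < ereal y" using assms(2) by auto
    then obtain z where "max (rend C) (ereal x) < ereal z" "ereal z < ereal y"
      by (meson ereal_dense2)
    then show False using C mem_component_iff[OF assms(1) C(1), of z] by auto
  qed
  ultimately show thesis using that C(1) by blast
qed

lemma countable_components_real:
  fixes U :: "real set"
  assumes "open U"
  shows "countable (components U)"
  by (rule countable_disjoint_open_subsets)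
    (use assms open_components in \<open>auto simp: pairwise_def disjnt_def components_nonoverlap\<close>)

text \<open>Two nonempty open intervals without a common point lie side by side. With two open sets
  \<open>U\<close> and \<open>V\<close> this also compares a component of E^+ with one of
  E^-.\<close>

lemma disjoint_components_ends:
  assumes "open U" "C \<in> components U" "open V" "C' \<in> components V" "C \<inter> C' = {}"
  shows "rend C \<le> lend C' \<or> rend C' \<le> lend C"
proof (rule ccontr)
  assume "\<not> ?thesis"
  then have "max (lend C) (lend C') < min (rend C) (rend C')"
    using lend_less_rend[OF assms(1,2)] lend_less_rend[OF assms(3,4)] by auto
  then obtain z where "max (lend C) (lend C') < ereal z" "ereal z < min (rend C) (rend C')"
    by (meson ereal_dense2)
  then have "z \<in> C \<inter> C'"
    using mem_component_iff[OF assms(1,2)] mem_component_iff[OF assms(3,4)] by auto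
  with assms(5) show False by auto
qed

section \<open>Distribution functions at extended real arguments\<close>

text \<open>Extending \<open>F\<^sup>+\<close> and \<open>F\<^sup>-\<close> to \<open>\<plusminus>\<infinity>\<close> makes \<open>F\<^sub>\<mu> - F\<^sub>\<nu>\<close> vanish there, so infinite endpoints of
  components need no separate treatment.\<close>

definition ecdf :: "real measure \<Rightarrow> ereal \<Rightarrow> real"
  where "ecdf \<gamma> e = measure \<gamma> {x. ereal x \<le> e}"

definition ecdf_left :: "real measure \<Rightarrow> ereal \<Rightarrow> real"
  where "ecdf_left \<gamma> e = measure \<gamma> {x. ereal x < e}"

lemma ecdf_ereal [simp]: "ecdf \<gamma> (ereal t) = cdf \<gamma> t"
  by (simp add: ecdf_def cdf_def atMost_def)

lemma ecdf_left_ereal [simp]: "ecdf_left \<gamma> (ereal t) = cdf_left \<gamma> t"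
  by (simp add: ecdf_left_def cdf_left_def lessThan_def)

lemma ecdf_infty [simp]: "ecdf \<gamma> \<infinity> = measure \<gamma> UNIV" "ecdf \<gamma> (-\<infinity>) = 0"
  by (simp_all add: ecdf_def)

lemma ecdf_left_infty [simp]: "ecdf_left \<gamma> \<infinity> = measure \<gamma> UNIV" "ecdf_left \<gamma> (-\<infinity>) = 0"
  by (simp_all add: ecdf_left_def)

lemma borel_ereal_intervals [measurable]:
  "{x. ereal x \<le> e} \<in> sets borel" "{x. ereal x < e} \<in> sets borel"
  "{x. e \<le> ereal x} \<in> sets borel" "{x. e < ereal x} \<in> sets borel"
  by measurable

lemma fin_borelD:
  assumes "\<gamma> \<in> fin_borel"
  shows "sets \<gamma> = sets borel" "space \<gamma> = UNIV" "finite_measure \<gamma>"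
  using assms sets_eq_imp_space_eq[of \<gamma> borel] by (auto simp: fin_borel_def)

lemma fin_borel_finite_borel_measure:
  "\<gamma> \<in> fin_borel \<Longrightarrow> finite_borel_measure \<gamma>"
  by (simp add: fin_borel_def finite_borel_measure_def finite_borel_measure_axioms_def)

text \<open>For finite \<open>a = b\<close> the right-hand side would be minus the mass of the atom
  at \<open>a\<close>, hence the strict inequality.\<close>

lemma measure_open_interval:
  assumes "\<gamma> \<in> fin_borel" "a < b"
  shows "measure \<gamma> {x. a < ereal x \<and> ereal x < b} = ecdf_left \<gamma> b - ecdf \<gamma> a"
proof -
  interpret finite_measure \<gamma> using fin_borelD[OF assms(1)] by simp
  have "{x. a < ereal x \<and> ereal x < b} = {x. ereal x < b} - {x. ereal x \<le> a}" by auto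
  moreover have "measure \<gamma> ({x. ereal x < b} - {x. ereal x \<le> a}) = ecdf_left \<gamma> b - ecdf \<gamma> a"
    unfolding ecdf_def ecdf_left_def using assms(2)
    by (intro finite_measure_Diff) (auto simp: fin_borelD(1)[OF assms(1)])
  ultimately show ?thesis by simp
qed

lemma measure_left_open_interval:
  assumes "\<gamma> \<in> fin_borel" "a \<le> b"
  shows "measure \<gamma> {x. a < ereal x \<and> ereal x \<le> b} = ecdf \<gamma> b - ecdf \<gamma> a"
proof -
  interpret finite_measure \<gamma> using fin_borelD[OF assms(1)] by simp
  have "{x. a < ereal x \<and> ereal x \<le> b} = {x. ereal x \<le> b} - {x. ereal x \<le> a}" by auto
  moreover have "measure \<gamma> ({x. ereal x \<le> b} - {x. ereal x \<le> a}) = ecdf \<gamma> b - ecdf \<gamma> a"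
    unfolding ecdf_def using assms(2)
    by (intro finite_measure_Diff) (auto simp: fin_borelD(1)[OF assms(1)] intro: order_trans)
  ultimately show ?thesis by simp
qed

lemma measure_singleton_eq:
  assumes "\<gamma> \<in> fin_borel"
  shows "measure \<gamma> {x} = cdf \<gamma> x - cdf_left \<gamma> x"
proof -
  interpret finite_measure \<gamma> using fin_borelD[OF assms(1)] by simp
  have "{x} = {..x} - {..<x}" by auto
  moreover have "measure \<gamma> ({..x} - {..<x}) = cdf \<gamma> x - cdf_left \<gamma> x"
    unfolding cdf_def cdf_left_def
    by (intro finite_measure_Diff) (auto simp: fin_borelD(1)[OF assms(1)])
  ultimately show ?thesis by simp
qed

lemma cdf_left_le_cdf:
  assumes "\<gamma> \<in> fin_borel" "s \<le> t"
  shows "cdf_left \<gamma> s \<le> cdf \<gamma> t"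
proof -
  interpret finite_measure \<gamma> using fin_borelD[OF assms(1)] by simp
  show ?thesis unfolding cdf_left_def cdf_def
    by (rule finite_measure_mono) (use assms in \<open>auto simp: fin_borelD(1)[OF assms(1)]\<close>)
qed

lemma cdf_le_cdf_left:
  assumes "\<gamma> \<in> fin_borel" "s < t"
  shows "cdf \<gamma> s \<le> cdf_left \<gamma> t"
proof -
  interpret finite_measure \<gamma> using fin_borelD[OF assms(1)] by simp
  show ?thesis unfolding cdf_left_def cdf_def
    by (rule finite_measure_mono) (use assms in \<open>auto simp: fin_borelD(1)[OF assms(1)]\<close>)
qed

lemma cdf_mono:
  assumes "\<gamma> \<in> fin_borel" "s \<le> t"
  shows "cdf \<gamma> s \<le> cdf \<gamma> t"
  using finite_borel_measure.cdf_nondecreasing fin_borel_finite_borel_measure assms by blast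

text \<open>Right continuity keeps \<open>cdf \<nu>\<close> below the number
  \<open>cdf \<mu> x\<close> just after \<open>x\<close>, while \<open>cdf \<mu>\<close> and its
  left limits stay above it. One strict inequality at \<open>x\<close> thus gives both to its
  right.\<close>

lemma cdf_gt_right_nbhd:
  assumes "\<mu> \<in> fin_borel" "\<nu> \<in> fin_borel" "cdf \<mu> x > cdf \<nu> x"
  obtains z where "x < z" "\<And>t. x < t \<Longrightarrow> t < z \<Longrightarrow> cdf \<mu> t > cdf \<nu> t \<and> cdf_left \<mu> t > cdf_left \<nu> t"
proof -
  have "continuous (at_right x) (cdf \<nu>)"
    using finite_borel_measure.cdf_is_right_cont fin_borel_finite_borel_measure assms by blast
  then have "(cdf \<nu> \<longlongrightarrow> cdf \<nu> x) (at_right x)" by (simp add: continuous_within)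
  then have "eventually (\<lambda>t. cdf \<nu> t < cdf \<mu> x) (at_right x)"
    using assms(3) by (rule order_tendstoD)
  then obtain z where z: "x < z" "\<And>t. x < t \<Longrightarrow> t < z \<Longrightarrow> cdf \<nu> t < cdf \<mu> x"
    by (auto simp: eventually_at_right_field)
  show thesis
  proof (rule that[OF z(1)])
    fix t assume t: "x < t" "t < z"
    then show "cdf \<mu> t > cdf \<nu> t \<and> cdf_left \<mu> t > cdf_left \<nu> t"
      using z(2)[OF t] cdf_mono[OF assms(1), of x t] cdf_le_cdf_left[OF assms(1), of x t]
        cdf_left_le_cdf[OF assms(2), of t t] by auto
  qed
qed

lemma cdf_gt_left_nbhd:
  assumes "\<mu> \<in> fin_borel" "\<nu> \<in> fin_borel" "cdf_left \<mu> x > cdf_left \<nu> x"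
  obtains z where "z < x" "\<And>t. z < t \<Longrightarrow> t < x \<Longrightarrow> cdf \<mu> t > cdf \<nu> t \<and> cdf_left \<mu> t > cdf_left \<nu> t"
proof -
  have "(cdf \<mu> \<longlongrightarrow> cdf_left \<mu> x) (at_left x)"
    unfolding cdf_left_def
    using finite_borel_measure.cdf_at_left fin_borel_finite_borel_measure assms by blast
  then have "eventually (\<lambda>t. cdf \<mu> t > cdf_left \<nu> x) (at_left x)"
    using assms(3) by (rule order_tendstoD)
  then obtain z where z: "z < x" "\<And>t. z < t \<Longrightarrow> t < x \<Longrightarrow> cdf \<mu> t > cdf_left \<nu> x"
    by (auto simp: eventually_at_left_field)
  show thesis
  proof (rule that[OF z(1)])
    fix t assume t: "z < t" "t < x"
    \<comment> \<open>The bound obtained so far concerns \<open>cdf \<mu>\<close>; it reaches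
      \<open>cdf_left \<mu> t\<close> through a point \<open>s < t\<close>, since
      \<open>cdf \<mu> s \<le> cdf_left \<mu> t\<close>.\<close>
    define s where "s = (z + t) / 2"
    have s: "z < s" "s < t" using t by (auto simp: s_def)
    show "cdf \<mu> t > cdf \<nu> t \<and> cdf_left \<mu> t > cdf_left \<nu> t"
      using z(2)[OF t] z(2)[of s] s t cdf_le_cdf_left[OF assms(2), of t x] cdf_le_cdf_left[OF assms(1), of s t]
        cdf_left_le_cdf[OF assms(2), of t t] by auto
  qed
qed

section \<open>Cyclical monotonicity as absence of crossings\<close>

text \<open>The threshold itself counts as lying below in \<open>upcross\<close> and
  \<open>downcross\<close>, and as lying above in the \<open>_left\<close> versions, so that they
  match \<open>cdf\<close> and \<open>cdf_left\<close>.\<close>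

definition upcross :: "real \<Rightarrow> (real \<times> real) set"
  where "upcross t = {p. fst p \<le> t \<and> t < snd p}"

definition downcross :: "real \<Rightarrow> (real \<times> real) set"
  where "downcross t = {p. snd p \<le> t \<and> t < fst p}"

definition upcross_left :: "real \<Rightarrow> (real \<times> real) set"
  where "upcross_left t = {p. fst p < t \<and> t \<le> snd p}"

definition downcross_left :: "real \<Rightarrow> (real \<times> real) set"
  where "downcross_left t = {p. snd p < t \<and> t \<le> fst p}"

lemma cross_borel [measurable]:
  "upcross t \<in> sets borel" "downcross t \<in> sets borel"
  "upcross_left t \<in> sets borel" "downcross_left t \<in> sets borel"
  unfolding upcross_def downcross_def upcross_left_def downcross_left_def
  by (measurable; simp add: borel_prod[symmetric])+

lemma cyclically_monotone_pair:
  assumes "cyclically_monotone \<Gamma>" "p \<in> \<Gamma>" "q \<in> \<Gamma>"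
  shows "\<bar>snd p - fst p\<bar> + \<bar>snd q - fst q\<bar> \<le> \<bar>snd q - fst p\<bar> + \<bar>snd p - fst q\<bar>"
proof -
  define x where "x = (\<lambda>i::nat. if i = 0 then fst p else fst q)"
  define y where "y = (\<lambda>i::nat. if i = 0 then snd p else snd q)"
  have "\<forall>i<2. (x i, y i) \<in> \<Gamma>" using assms(2,3) by (auto simp: x_def y_def)
  then have "(\<Sum>i<2. \<bar>y i - x i\<bar>) \<le> (\<Sum>i<2. \<bar>y (Suc i mod 2) - x i\<bar>)"
    using assms(1)[unfolded cyclically_monotone_def, rule_format, of 2] by auto
  then show ?thesis by (simp add: numeral_2_eq_2 x_def y_def)
qed

text \<open>Let two pairs cross \<open>t\<close> in opposite directions. Exchanging their targets
  keeps each source on the side of its new target and shortens the total length by twice the gap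
  between the two lower and the two upper points, which is positive.\<close>

lemma cyclically_monotone_no_crossing:
  assumes "cyclically_monotone \<Gamma>"
  shows "\<Gamma> \<inter> upcross t = {} \<or> \<Gamma> \<inter> downcross t = {}"
    and "\<Gamma> \<inter> upcross_left t = {} \<or> \<Gamma> \<inter> downcross_left t = {}"
proof -
  show "\<Gamma> \<inter> upcross t = {} \<or> \<Gamma> \<inter> downcross t = {}"
  proof (rule ccontr)
    assume "\<not> ?thesis"
    then obtain p q where "p \<in> \<Gamma>" "q \<in> \<Gamma>" "p \<in> upcross t" "q \<in> downcross t" by blast
    then show False using cyclically_monotone_pair[OF assms, of p q]
      by (auto simp: upcross_def downcross_def)
  qed
  show "\<Gamma> \<inter> upcross_left t = {} \<or> \<Gamma> \<inter> downcross_left t = {}"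
  proof (rule ccontr)
    assume "\<not> ?thesis"
    then obtain p q where "p \<in> \<Gamma>" "q \<in> \<Gamma>" "p \<in> upcross_left t" "q \<in> downcross_left t" by blast
    then show False using cyclically_monotone_pair[OF assms, of p q]
      by (auto simp: upcross_left_def downcross_left_def)
  qed
qed

lemma has_bochner_integral_abs_diff:
  "has_bochner_integral lborel (\<lambda>t. \<bar>indicator {a..} t - indicator {b..} t :: real\<bar>) \<bar>b - a\<bar>"
proof -
  have "(\<lambda>t. \<bar>indicator {a..} t - indicator {b..} t :: real\<bar>) = indicator {min a b..<max a b}"
    by (auto simp: fun_eq_iff indicator_def)
  moreover have "measure lborel {min a b..<max a b} = \<bar>b - a\<bar>" by (auto simp: min_def max_def)
  moreover have "has_bochner_integral lborel (indicator {min a b..<max a b} :: real \<Rightarrow> real)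
      (measure lborel {min a b..<max a b})"
    by (rule has_bochner_integral_real_indicator) (auto simp: emeasure_lborel_Ico)
  ultimately show ?thesis by simp
qed

text \<open>With \<open>|y - x| = \<integral> |1\<^bsub>x \<le> t\<^esub> - 1\<^bsub>y \<le> t\<^esub>| dt\<close>, the absence of crossings at \<open>t\<close> says that all the
  differences have the same sign, and the inequality holds pointwise in \<open>t\<close>.\<close>

lemma cyclically_monotone_if_no_crossing:
  assumes "\<And>t. \<Gamma> \<inter> upcross t = {} \<or> \<Gamma> \<inter> downcross t = {}"
  shows "cyclically_monotone \<Gamma>"
  unfolding cyclically_monotone_def
proof (intro allI impI)
  fix n :: nat and x y :: "nat \<Rightarrow> real"
  assume n: "1 \<le> n" and xy: "\<forall>i<n. (x i, y i) \<in> \<Gamma>"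
  define \<sigma> where "\<sigma> = (\<lambda>i. Suc i mod n)"
  define f where "f = (\<lambda>i t. indicator {x i..} t :: real)"
  define g where "g = (\<lambda>i t. indicator {y i..} t :: real)"
  have "inj_on \<sigma> {..<n}"
  proof (rule inj_onI)
    fix i j assume "i \<in> {..<n}" "j \<in> {..<n}" "\<sigma> i = \<sigma> j"
    then show "i = j" unfolding \<sigma>_def by (auto simp: mod_Suc split: if_splits)
  qed
  moreover have "\<sigma> ` {..<n} \<subseteq> {..<n}" using n by (auto simp: \<sigma>_def)
  ultimately have im: "\<sigma> ` {..<n} = {..<n}" by (simp add: endo_inj_surj)
  have le: "(\<Sum>i<n. \<bar>f i t - g i t\<bar>) \<le> (\<Sum>i<n. \<bar>f i t - g (\<sigma> i) t\<bar>)" for t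
  proof -
    have "(\<forall>i<n. f i t \<le> g i t) \<or> (\<forall>i<n. g i t \<le> f i t)"
    proof (rule ccontr)
      assume "\<not> ?thesis"
      then obtain i j where ij: "i < n" "j < n" "f i t > g i t" "f j t < g j t"
        by (auto simp: not_le)
      then have "(x i, y i) \<in> upcross t" "(x j, y j) \<in> downcross t"
        by (auto simp: f_def g_def upcross_def downcross_def indicator_def split: if_splits)
      then show False using assms[of t] xy ij by blast
    qed
    then have "(\<Sum>i<n. \<bar>f i t - g i t\<bar>) = \<bar>\<Sum>i<n. f i t - g i t\<bar>"
    proof
      assume a: "\<forall>i<n. f i t \<le> g i t"
      then have "(\<Sum>i<n. \<bar>f i t - g i t\<bar>) = - (\<Sum>i<n. f i t - g i t)"
        unfolding sum_negf[symmetric] by (intro sum.cong) auto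
      moreover have "(\<Sum>i<n. f i t - g i t) \<le> 0" using a by (intro sum_nonpos) auto
      ultimately show ?thesis by simp
    next
      assume a: "\<forall>i<n. g i t \<le> f i t"
      then have "(\<Sum>i<n. \<bar>f i t - g i t\<bar>) = (\<Sum>i<n. f i t - g i t)"
        by (intro sum.cong) auto
      moreover have "(\<Sum>i<n. f i t - g i t) \<ge> 0" using a by (intro sum_nonneg) auto
      ultimately show ?thesis by simp
    qed
    \<comment> \<open>\<open>\<sigma>\<close> permutes the indices, so the sum without absolute
      values does not depend on how the targets are matched; the triangle inequality does the
      rest.\<close>
    also have "(\<Sum>i<n. f i t - g i t) = (\<Sum>i<n. f i t - g (\<sigma> i) t)"
      using sum.reindex[OF \<open>inj_on \<sigma> {..<n}\<close>, of "\<lambda>i. g i t"]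
      by (simp add: sum_subtractf im)
    also have "\<bar>\<dots>\<bar> \<le> (\<Sum>i<n. \<bar>f i t - g (\<sigma> i) t\<bar>)" by (rule sum_abs)
    finally show ?thesis .
  qed
  have int: "has_bochner_integral lborel (\<lambda>t. \<Sum>i<n. \<bar>f i t - g (\<tau> i) t\<bar>) (\<Sum>i<n. \<bar>y (\<tau> i) - x i\<bar>)" for \<tau>
    unfolding f_def g_def by (intro has_bochner_integral_sum has_bochner_integral_abs_diff)
  have "(\<integral>t. (\<Sum>i<n. \<bar>f i t - g i t\<bar>) \<partial>lborel) \<le> (\<integral>t. (\<Sum>i<n. \<bar>f i t - g (\<sigma> i) t\<bar>) \<partial>lborel)"
    using int[of "\<lambda>i. i"] int[of \<sigma>] le
    by (intro integral_mono) (auto simp: has_bochner_integral_iff)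
  then show "(\<Sum>i<n. \<bar>y i - x i\<bar>) \<le> (\<Sum>i<n. \<bar>y (Suc i mod n) - x i\<bar>)"
    using int[of "\<lambda>i. i"] int[of \<sigma>] by (simp add: has_bochner_integral_iff \<sigma>_def)
qed

lemma AE_notin_iff_null:
  assumes "sets \<pi> = sets borel" "N \<in> sets borel"
  shows "(AE p in \<pi>. p \<notin> N) \<longleftrightarrow> emeasure \<pi> N = 0"
proof (rule AE_iff_measurable)
  show "N \<in> sets \<pi>" using assms by simp
  show "{x \<in> space \<pi>. \<not> x \<notin> N} = N" using sets_eq_imp_space_eq[OF assms(1)] by auto
qed

text \<open>The set \<open>\<Gamma>\<close> may fail to be measurable, but it misses one of the two
  crossing sets, and these are Borel.\<close>

lemma cyclically_monotone_measureD:
  assumes "\<pi> \<in> fin_borel" "cyclically_monotone_measure \<pi>"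
  shows "emeasure \<pi> (upcross t) = 0 \<or> emeasure \<pi> (downcross t) = 0"
    and "emeasure \<pi> (upcross_left t) = 0 \<or> emeasure \<pi> (downcross_left t) = 0"
proof -
  obtain \<Gamma> where \<Gamma>: "cyclically_monotone \<Gamma>" "AE p in \<pi>. p \<in> \<Gamma>"
    using assms(2) by (auto simp: cyclically_monotone_measure_def)
  have null: "emeasure \<pi> N = 0" if "\<Gamma> \<inter> N = {}" "N \<in> sets borel" for N
  proof -
    have "AE p in \<pi>. p \<notin> N" using \<Gamma>(2) by eventually_elim (use that in auto)
    then show ?thesis using AE_notin_iff_null[OF fin_borelD(1)[OF assms(1)] that(2)] by simp
  qed
  show "emeasure \<pi> (upcross t) = 0 \<or> emeasure \<pi> (downcross t) = 0"
    using cyclically_monotone_no_crossing(1)[OF \<Gamma>(1), of t] null by auto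
  show "emeasure \<pi> (upcross_left t) = 0 \<or> emeasure \<pi> (downcross_left t) = 0"
    using cyclically_monotone_no_crossing(2)[OF \<Gamma>(1), of t] null by auto
qed

lemma cyclically_monotone_measureI:
  assumes "sets \<pi> = sets borel"
    and "\<And>t. emeasure \<pi> (upcross t) = 0 \<or> emeasure \<pi> (downcross t) = 0"
  shows "cyclically_monotone_measure \<pi>"
proof -
  \<comment> \<open>All null crossing sets at rational thresholds are removed; being countably many,
    they leave a set of full measure.\<close>
  define \<Gamma> where "\<Gamma> = {p. \<forall>t\<in>\<rat>. (emeasure \<pi> (upcross t) = 0 \<longrightarrow> p \<notin> upcross t) \<and>
    (emeasure \<pi> (downcross t) = 0 \<longrightarrow> p \<notin> downcross t)}"
  have "AE p in \<pi>. p \<in> \<Gamma>"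
    unfolding \<Gamma>_def mem_Collect_eq
    by (intro AE_ball_countable' AE_conjI) (auto simp: AE_notin_iff_null[OF assms(1)] countable_rat)
  moreover have "cyclically_monotone \<Gamma>"
  proof (rule cyclically_monotone_if_no_crossing, rule ccontr)
    fix t assume "\<not> (\<Gamma> \<inter> upcross t = {} \<or> \<Gamma> \<inter> downcross t = {})"
    then obtain p q where pq: "p \<in> \<Gamma>" "q \<in> \<Gamma>" "p \<in> upcross t" "q \<in> downcross t" by blast
    \<comment> \<open>The upper ends of both pairs lie strictly above \<open>t\<close>, which leaves
      room to raise the threshold to a rational \<open>r\<close>. At \<open>r\<close> one of the two
      crossing sets is null and was removed.\<close>
    then have "t < min (snd p) (fst q)" by (auto simp: upcross_def downcross_def)
    then obtain r where r: "r \<in> \<rat>" "t < r" "r < min (snd p) (fst q)"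
      using Rats_dense_in_real by blast
    then have "p \<in> upcross r" "q \<in> downcross r"
      using pq(3,4) by (auto simp: upcross_def downcross_def)
    then show False using assms(2)[of r] pq(1,2) r(1) by (auto simp: \<Gamma>_def)
  qed
  ultimately show ?thesis unfolding cyclically_monotone_measure_def by blast
qed

section \<open>Cyclically monotone transport plans\<close>

lemma measurable_fst_snd_borel [measurable]:
  "fst \<in> borel_measurable (borel :: (real \<times> real) measure)"
  "snd \<in> borel_measurable (borel :: (real \<times> real) measure)"
  by (simp_all add: borel_prod[symmetric])

lemma MargD:
  assumes "\<pi> \<in> Marg \<mu> \<nu>"
  shows "\<pi> \<in> fin_borel" "\<mu> \<in> fin_borel" "\<nu> \<in> fin_borel"
    and "X \<in> sets borel \<Longrightarrow> emeasure \<mu> X = emeasure \<pi> (fst -` X)"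
    and "X \<in> sets borel \<Longrightarrow> emeasure \<nu> X = emeasure \<pi> (snd -` X)"
proof -
  have m: "distr \<pi> borel fst = \<mu>" "distr \<pi> borel snd = \<nu>"
    using assms by (auto simp: Marg_def)
  show f: "\<pi> \<in> fin_borel" using assms by (auto simp: Marg_def)
  have meas: "fst \<in> measurable \<pi> borel" "snd \<in> measurable \<pi> borel"
    using fin_borelD[OF f] measurable_fst_snd_borel by (auto cong: measurable_cong_sets)
  show "\<mu> \<in> fin_borel" "\<nu> \<in> fin_borel"
    using m finite_measure.finite_measure_distr[OF fin_borelD(3)[OF f]] meas
    by (auto simp: fin_borel_def)
  show "X \<in> sets borel \<Longrightarrow> emeasure \<mu> X = emeasure \<pi> (fst -` X)"
       "X \<in> sets borel \<Longrightarrow> emeasure \<nu> X = emeasure \<pi> (snd -` X)"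
    using emeasure_distr[OF meas(1)] emeasure_distr[OF meas(2)] m fin_borelD[OF f] by auto
qed

text \<open>The events \<open>fst p \<le> t\<close> and \<open>snd p \<le> t\<close> have a quadrant
  in common, which cancels; each exceeds it by exactly one crossing set.\<close>

lemma cdf_diff_crossings:
  assumes "\<pi> \<in> Marg \<mu> \<nu>"
  shows "cdf \<mu> t - cdf \<nu> t = measure \<pi> (upcross t) - measure \<pi> (downcross t)"
    and "cdf_left \<mu> t - cdf_left \<nu> t = measure \<pi> (upcross_left t) - measure \<pi> (downcross_left t)"
proof -
  note sets = fin_borelD(1)[OF MargD(1)[OF assms]]
  interpret finite_measure \<pi> using fin_borelD[OF MargD(1)[OF assms]] by simp
  note vm = measurable_sets_borel[OF measurable_fst_snd_borel(1)]
    measurable_sets_borel[OF measurable_fst_snd_borel(2)]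
  define S where "S = fst -` {..t} \<inter> snd -` {..t}"
  have "S \<in> sets borel" unfolding S_def by (intro sets.Int vm) auto
  have "measure \<mu> {..t} = measure \<pi> (fst -` {..t})" "measure \<nu> {..t} = measure \<pi> (snd -` {..t})"
    by (simp_all add: measure_def MargD[OF assms])
  moreover have "fst -` {..t} = S \<union> upcross t" "snd -` {..t} = S \<union> downcross t"
    "S \<inter> upcross t = {}" "S \<inter> downcross t = {}"
    by (auto simp: S_def upcross_def downcross_def)
  ultimately show "cdf \<mu> t - cdf \<nu> t = measure \<pi> (upcross t) - measure \<pi> (downcross t)"
    using \<open>S \<in> sets borel\<close> by (simp add: cdf_def finite_measure_Union sets)
  define S' where "S' = fst -` {..<t} \<inter> snd -` {..<t}"
  have "S' \<in> sets borel" unfolding S'_def by (intro sets.Int vm) auto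
  have "measure \<mu> {..<t} = measure \<pi> (fst -` {..<t})" "measure \<nu> {..<t} = measure \<pi> (snd -` {..<t})"
    by (simp_all add: measure_def MargD[OF assms])
  moreover have "fst -` {..<t} = S' \<union> upcross_left t" "snd -` {..<t} = S' \<union> downcross_left t"
    "S' \<inter> upcross_left t = {}" "S' \<inter> downcross_left t = {}"
    by (auto simp: S'_def upcross_left_def downcross_left_def)
  ultimately show "cdf_left \<mu> t - cdf_left \<nu> t = measure \<pi> (upcross_left t) - measure \<pi> (downcross_left t)"
    using \<open>S' \<in> sets borel\<close> by (simp add: cdf_left_def finite_measure_Union sets)
qed

text \<open>The net flow across \<open>t\<close> is known and one of the two flows vanishes, so each
  flow is a positive part. \<open>ennreal\<close> produces it by sending negative numbers to
  0.\<close>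

lemma CMarg_crossings:
  assumes "\<pi> \<in> CMarg \<mu> \<nu>"
  shows "emeasure \<pi> (upcross t) = ennreal (cdf \<mu> t - cdf \<nu> t)"
    and "emeasure \<pi> (downcross t) = ennreal (cdf \<nu> t - cdf \<mu> t)"
    and "emeasure \<pi> (upcross_left t) = ennreal (cdf_left \<mu> t - cdf_left \<nu> t)"
    and "emeasure \<pi> (downcross_left t) = ennreal (cdf_left \<nu> t - cdf_left \<mu> t)"
proof -
  have pi: "\<pi> \<in> Marg \<mu> \<nu>" "\<pi> \<in> fin_borel" "cyclically_monotone_measure \<pi>"
    using assms MargD(1) by (auto simp: CMarg_def)
  interpret finite_measure \<pi> using fin_borelD[OF pi(2)] by simp
  note * = cdf_diff_crossings[OF pi(1), of t] cyclically_monotone_measureD[OF pi(2,3), of t]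
  have neg: "cdf \<nu> t - cdf \<mu> t = - (cdf \<mu> t - cdf \<nu> t)"
    "cdf_left \<nu> t - cdf_left \<mu> t = - (cdf_left \<mu> t - cdf_left \<nu> t)" by auto
  show "emeasure \<pi> (upcross t) = ennreal (cdf \<mu> t - cdf \<nu> t)"
    and "emeasure \<pi> (downcross t) = ennreal (cdf \<nu> t - cdf \<mu> t)"
    using *(1,3) unfolding neg by (auto simp: emeasure_eq_measure ennreal_neg)
  show "emeasure \<pi> (upcross_left t) = ennreal (cdf_left \<mu> t - cdf_left \<nu> t)"
    and "emeasure \<pi> (downcross_left t) = ennreal (cdf_left \<nu> t - cdf_left \<mu> t)"
    using *(2,4) unfolding neg by (auto simp: emeasure_eq_measure ennreal_neg)
qed

lemma swap_borel [measurable]: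
  "(prod.swap :: real \<times> real \<Rightarrow> _) \<in> borel_measurable borel"
  by (intro borel_measurable_continuous_onI continuous_on_swap)

text \<open>Transposition exchanges upward and downward crossings, and the crossing criterion is
  symmetric in the two.\<close>

lemma CMarg_swap:
  assumes "\<pi> \<in> CMarg \<mu> \<nu>"
  shows "distr \<pi> borel prod.swap \<in> CMarg \<nu> \<mu>"
proof -
  have pi: "\<pi> \<in> Marg \<mu> \<nu>" "\<pi> \<in> fin_borel" "cyclically_monotone_measure \<pi>"
    using assms MargD(1) by (auto simp: CMarg_def)
  have m: "prod.swap \<in> measurable \<pi> borel"
    using swap_borel fin_borelD[OF pi(2)] by (auto cong: measurable_cong_sets)
  have d: "emeasure (distr \<pi> borel prod.swap) X = emeasure \<pi> (prod.swap -` X)" if "X \<in> sets borel" for X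
    using emeasure_distr[OF m that] fin_borelD[OF pi(2)] by simp
  have "distr \<pi> borel prod.swap \<in> fin_borel"
    using finite_measure.finite_measure_distr[OF fin_borelD(3)[OF pi(2)] m] by (auto simp: fin_borel_def)
  moreover have "distr (distr \<pi> borel prod.swap) borel fst = \<nu>" "distr (distr \<pi> borel prod.swap) borel snd = \<mu>"
    using pi(1) m by (auto simp: distr_distr Marg_def o_def)
  moreover have "cyclically_monotone_measure (distr \<pi> borel prod.swap)"
  proof (rule cyclically_monotone_measureI)
    fix t
    have "prod.swap -` upcross t = downcross t" "prod.swap -` downcross t = upcross t"
      by (auto simp: upcross_def downcross_def)
    then show "emeasure (distr \<pi> borel prod.swap) (upcross t) = 0 \<or>
        emeasure (distr \<pi> borel prod.swap) (downcross t) = 0"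
      using cyclically_monotone_measureD(1)[OF pi(2,3), of t] by (auto simp: d)
  qed simp
  ultimately show ?thesis by (auto simp: CMarg_def Marg_def)
qed

section \<open>Components of a pair of measures\<close>

lemma sets_mrestr [simp]: "sets (mrestr \<gamma> A) = sets \<gamma>"
  by (simp add: mrestr_def)

lemma emeasure_mrestr:
  assumes "A \<in> sets \<gamma>" "X \<in> sets \<gamma>"
  shows "emeasure (mrestr \<gamma> A) X = emeasure \<gamma> (A \<inter> X)"
proof -
  have "emeasure (mrestr \<gamma> A) X = (\<integral>\<^sup>+x. indicator A x * indicator X x \<partial>\<gamma>)"
    unfolding mrestr_def using assms by (intro emeasure_density) auto
  also have "\<dots> = (\<integral>\<^sup>+x. indicator (A \<inter> X) x \<partial>\<gamma>)"
    by (intro nn_integral_cong) (auto simp: indicator_def)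
  finally show ?thesis using assms by simp
qed

lemma emeasure_point_mass:
  "X \<in> sets borel \<Longrightarrow> emeasure (point_mass w x) X = ennreal w * indicator X x"
  by (simp add: point_mass_def)

lemma sets_point_mass [simp]: "sets (point_mass w x) = sets borel"
  by (simp add: point_mass_def)

lemma sets_end_mass [simp]: "sets (end_mass w e) = sets borel"
  by (simp add: end_mass_def)

section \<open>Exchanging the two measures\<close>

lemma E_minus_swap: "E_minus \<mu> \<nu> = E_plus \<nu> \<mu>"
  by (auto simp: E_minus_def E_plus_def)

lemma E_eq_swap: "E_eq \<nu> \<mu> = E_eq \<mu> \<nu>"
  by (auto simp: E_eq_def E_minus_swap)

lemma K_minus_swap: "K_minus \<mu> \<nu> = K_plus \<nu> \<mu>"
  by (simp add: K_minus_def K_plus_def E_minus_swap)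

lemma Bset_swap: "Bset \<nu> \<mu> = Bset \<mu> \<nu>"
  unfolding Bset_def K_minus_swap by blast

lemma mu_minus_comp_swap: "mu_minus_comp \<mu> \<nu> = nu_plus_comp \<nu> \<mu>"
  by (simp add: fun_eq_iff mu_minus_comp_def nu_plus_comp_def)

lemma nu_minus_comp_swap: "nu_minus_comp \<mu> \<nu> = mu_plus_comp \<nu> \<mu>"
  by (simp add: fun_eq_iff nu_minus_comp_def mu_plus_comp_def)

lemma mu_minus_swap: "mu_minus \<mu> \<nu> = nu_plus \<nu> \<mu>"
  by (simp add: mu_minus_def nu_plus_def K_minus_swap mu_minus_comp_swap)

lemma nu_minus_swap: "nu_minus \<mu> \<nu> = mu_plus \<nu> \<mu>"
  by (simp add: nu_minus_def mu_plus_def K_minus_swap nu_minus_comp_swap)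

lemma nu_eq_swap: "nu_eq \<mu> \<nu> = mu_eq \<nu> \<mu>"
proof -
  have *: "a - b - c = a - c - b" for a b c :: real by simp
  show ?thesis
    unfolding nu_eq_def mu_eq_def Bset_swap[of \<mu> \<nu>] E_eq_swap[of \<mu> \<nu>] mu_minus_swap nu_minus_swap
    by (subst *) (rule refl)
qed

lemma sets_comp [simp]:
  "sets (mu_plus_comp \<mu> \<nu> C) = sets borel" "sets (nu_plus_comp \<mu> \<nu> C) = sets borel"
  "sets (mu_plus \<mu> \<nu>) = sets borel" "sets (nu_plus \<mu> \<nu>) = sets borel"
  "sets (mu_minus \<mu> \<nu>) = sets borel" "sets (mu_eq \<mu> \<nu>) = sets borel"
  by (simp_all add: mu_plus_comp_def nu_plus_comp_def mu_plus_def nu_plus_def mu_minus_def mu_eq_def)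

locale mass_pair =
  fixes \<mu> \<nu> :: "real measure"
  assumes pair: "(\<mu>, \<nu>) \<in> same_mass_pairs"
begin

lemma swap_pair: "(\<nu>, \<mu>) \<in> same_mass_pairs"
  using pair by (auto simp: same_mass_pairs_def)

end

text \<open>Facts of the locale become available under the prefix \<open>swap\<close> only after its context has been
  closed, hence the repeated reopening below.\<close>

sublocale mass_pair \<subseteq> swap: mass_pair \<nu> \<mu>
  by unfold_locales (rule swap_pair)

context mass_pair
begin

lemma fin_mu: "\<mu> \<in> fin_borel"
  using pair by (simp add: same_mass_pairs_def)

sublocale M: finite_measure \<mu>
  using fin_mu by (rule fin_borelD)

lemma sets_mu [simp]: "sets \<mu> = sets borel"
  using fin_mu by (rule fin_borelD)

lemma space_mu [simp]: "space \<mu> = UNIV"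
  using fin_mu by (rule fin_borelD)

lemma total_mass: "emeasure \<mu> UNIV = emeasure \<nu> UNIV" "measure \<mu> UNIV = measure \<nu> UNIV"
  using pair by (auto simp: same_mass_pairs_def measure_def)

end

section \<open>Topology of the positive set and its components\<close>

context mass_pair
begin

text \<open>The strict inequality for \<open>cdf\<close> supplies a neighbourhood to the right of
  \<open>x\<close>, the one for \<open>cdf_left\<close> a neighbourhood to the left.\<close>

lemma open_E_plus: "open (E_plus \<mu> \<nu>)"
proof (subst open_subopen, rule ballI)
  fix x assume "x \<in> E_plus \<mu> \<nu>"
  then have x: "cdf \<mu> x > cdf \<nu> x" "cdf_left \<mu> x > cdf_left \<nu> x" by (auto simp: E_plus_def)
  obtain z where z: "x < z" "\<And>t. x < t \<Longrightarrow> t < z \<Longrightarrow> cdf \<mu> t > cdf \<nu> t \<and> cdf_left \<mu> t > cdf_left \<nu> t"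
    using cdf_gt_right_nbhd[OF fin_mu swap.fin_mu x(1)] by metis
  obtain y where y: "y < x" "\<And>t. y < t \<Longrightarrow> t < x \<Longrightarrow> cdf \<mu> t > cdf \<nu> t \<and> cdf_left \<mu> t > cdf_left \<nu> t"
    using cdf_gt_left_nbhd[OF fin_mu swap.fin_mu x(2)] by metis
  have "t \<in> E_plus \<mu> \<nu>" if "y < t" "t < z" for t
    using that x y(2)[of t] z(2)[of t] by (cases t x rule: linorder_cases) (auto simp: E_plus_def)
  then show "\<exists>T. open T \<and> x \<in> T \<and> T \<subseteq> E_plus \<mu> \<nu>"
    using y(1) z(1) by (intro exI[of _ "{y<..<z}"]) auto
qed

lemma countable_K_plus: "countable (K_plus \<mu> \<nu>)"
  unfolding K_plus_def by (rule countable_components_real[OF open_E_plus])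

lemma mem_K_plus_iff:
  "C \<in> K_plus \<mu> \<nu> \<Longrightarrow> x \<in> C \<longleftrightarrow> lend C < ereal x \<and> ereal x < rend C"
  unfolding K_plus_def by (rule mem_component_iff[OF open_E_plus])

lemma lend_less_rend_K: "C \<in> K_plus \<mu> \<nu> \<Longrightarrow> lend C < rend C"
  unfolding K_plus_def by (rule lend_less_rend[OF open_E_plus])

lemma K_plus_subset: "C \<in> K_plus \<mu> \<nu> \<Longrightarrow> C \<subseteq> E_plus \<mu> \<nu>"
  unfolding K_plus_def by (rule in_components_subset)

lemma Union_K_plus: "\<Union>(K_plus \<mu> \<nu>) = E_plus \<mu> \<nu>"
  unfolding K_plus_def by (rule Union_components)

lemma K_plus_borel [measurable]: "C \<in> K_plus \<mu> \<nu> \<Longrightarrow> C \<in> sets borel"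
  by (metis K_plus_def borel_open open_E_plus open_components)

lemma disjoint_K_plus: "disjoint_family_on (\<lambda>C. C) (K_plus \<mu> \<nu>)"
  unfolding K_plus_def disjoint_family_on_def by (auto simp: components_nonoverlap)

lemma E_plus_Int: "E_plus \<mu> \<nu> \<inter> E_plus \<nu> \<mu> = {}"
  by (auto simp: E_plus_def)

lemma E_eq_iff: "x \<in> E_eq \<mu> \<nu> \<longleftrightarrow> x \<notin> E_plus \<mu> \<nu> \<and> x \<notin> E_plus \<nu> \<mu>"
  by (simp add: E_eq_def E_minus_swap)

end

section \<open>Signs of the differences at the endpoints of components\<close>

context mass_pair
begin

text \<open>A reversed strict inequality at the left endpoint would persist to its right, hence at
  points of \<open>C\<close>, where the opposite holds. At an infinite endpoint both sides are
  equal.\<close>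

lemma cdf_lend_ge:
  assumes "C \<in> K_plus \<mu> \<nu>"
  shows "ecdf \<nu> (lend C) \<le> ecdf \<mu> (lend C)"
proof (cases "lend C")
  case (real a)
  show ?thesis
  proof (rule ccontr)
    assume "\<not> ?thesis"
    then have "cdf \<nu> a > cdf \<mu> a" using real by auto
    then obtain z where z: "a < z" "\<And>t. a < t \<Longrightarrow> t < z \<Longrightarrow> cdf \<nu> t > cdf \<mu> t"
      using cdf_gt_right_nbhd[OF swap.fin_mu fin_mu] by metis
    have "lend C < min (rend C) (ereal z)"
      using lend_less_rend_K[OF assms] z(1) real by simp
    then obtain t where "lend C < ereal t" "ereal t < min (rend C) (ereal z)"
      by (meson ereal_dense2)
    then show False
      using mem_K_plus_iff[OF assms, of t] K_plus_subset[OF assms] z(2)[of t] real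
      by (auto simp: E_plus_def)
  qed
qed (auto simp: total_mass)

lemma cdf_left_rend_ge:
  assumes "C \<in> K_plus \<mu> \<nu>"
  shows "ecdf_left \<nu> (rend C) \<le> ecdf_left \<mu> (rend C)"
proof (cases "rend C")
  case (real b)
  show ?thesis
  proof (rule ccontr)
    assume "\<not> ?thesis"
    then have "cdf_left \<nu> b > cdf_left \<mu> b" using real by auto
    then obtain z where z: "z < b" "\<And>t. z < t \<Longrightarrow> t < b \<Longrightarrow> cdf \<nu> t > cdf \<mu> t"
      using cdf_gt_left_nbhd[OF swap.fin_mu fin_mu] by metis
    have "max (lend C) (ereal z) < rend C"
      using lend_less_rend_K[OF assms] z(1) real by simp
    then obtain t where "max (lend C) (ereal z) < ereal t" "ereal t < rend C"
      by (meson ereal_dense2)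
    then show False
      using mem_K_plus_iff[OF assms, of t] K_plus_subset[OF assms] z(2)[of t] real
      by (auto simp: E_plus_def)
  qed
qed (auto simp: total_mass)

text \<open>E^+ is excluded because its components do not contain their endpoints. E^- is excluded
  by one weak inequality: for \<open>cdf\<close> at a left endpoint, for \<open>cdf_left\<close> at
  a right one.\<close>

lemma K_plus_end_E_eq:
  assumes "C \<in> K_plus \<mu> \<nu>" "ereal x = lend C \<or> ereal x = rend C"
  shows "x \<in> E_eq \<mu> \<nu>"
proof -
  have "x \<notin> E_plus \<mu> \<nu>"
    using component_end_notin[OF open_E_plus, of C x] assms by (simp add: K_plus_def)
  moreover have "cdf \<nu> x \<le> cdf \<mu> x \<or> cdf_left \<nu> x \<le> cdf_left \<mu> x"
    using assms(2) cdf_lend_ge[OF assms(1)] cdf_left_rend_ge[OF assms(1)] by (metis ecdf_ereal ecdf_left_ereal)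
  ultimately show ?thesis by (auto simp: E_eq_iff E_plus_def)
qed

end

context mass_pair
begin

text \<open>The strict inequality at \<open>x\<close> puts an interval to the right of
  \<open>x\<close> into \<open>E_plus\<close>. The component around it cannot extend below
  \<open>x\<close>, because \<open>x\<close> itself is not in \<open>E_plus\<close>.\<close>

lemma lend_eq_if_cdf_gt:
  assumes "x \<in> E_eq \<mu> \<nu>" "cdf \<mu> x > cdf \<nu> x"
  obtains C where "C \<in> K_plus \<mu> \<nu>" "lend C = ereal x"
proof -
  obtain z where z: "x < z" "\<And>t. x < t \<Longrightarrow> t < z \<Longrightarrow> cdf \<mu> t > cdf \<nu> t \<and> cdf_left \<mu> t > cdf_left \<nu> t"
    using cdf_gt_right_nbhd[OF fin_mu swap.fin_mu assms(2)] by metis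
  then have "{x<..<z} \<subseteq> E_plus \<mu> \<nu>" by (auto simp: E_plus_def)
  from segment_in_component[OF open_E_plus z(1) this]
  obtain C where C: "C \<in> K_plus \<mu> \<nu>" "lend C \<le> ereal x" "ereal z \<le> rend C"
    by (metis K_plus_def)
  have "ereal x < rend C" using C(3) z(1) less_le_trans[of "ereal x" "ereal z"] by simp
  moreover have "x \<notin> C" using assms(1) K_plus_subset[OF C(1)] by (auto simp: E_eq_iff)
  ultimately have "lend C = ereal x" using C(2) mem_K_plus_iff[OF C(1), of x] by auto
  with C(1) show thesis by (rule that)
qed

lemma rend_eq_if_cdf_left_gt:
  assumes "x \<in> E_eq \<mu> \<nu>" "cdf_left \<mu> x > cdf_left \<nu> x"
  obtains C where "C \<in> K_plus \<mu> \<nu>" "rend C = ereal x"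
proof -
  obtain z where z: "z < x" "\<And>t. z < t \<Longrightarrow> t < x \<Longrightarrow> cdf \<mu> t > cdf \<nu> t \<and> cdf_left \<mu> t > cdf_left \<nu> t"
    using cdf_gt_left_nbhd[OF fin_mu swap.fin_mu assms(2)] by metis
  then have "{z<..<x} \<subseteq> E_plus \<mu> \<nu>" by (auto simp: E_plus_def)
  from segment_in_component[OF open_E_plus z(1) this]
  obtain C where C: "C \<in> K_plus \<mu> \<nu>" "lend C \<le> ereal z" "ereal x \<le> rend C"
    by (metis K_plus_def)
  have "lend C < ereal x" using C(2) z(1) le_less_trans[of _ "ereal z" "ereal x"] by simp
  moreover have "x \<notin> C" using assms(1) K_plus_subset[OF C(1)] by (auto simp: E_eq_iff)
  ultimately have "rend C = ereal x" using C(3) mem_K_plus_iff[OF C(1), of x] by auto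
  with C(1) show thesis by (rule that)
qed

lemma K_plus_separated:
  assumes "C \<in> K_plus \<mu> \<nu>" "C' \<in> K_plus \<mu> \<nu>" "C \<noteq> C'"
  shows "rend C \<le> lend C' \<or> rend C' \<le> lend C"
  using assms disjoint_components_ends[OF open_E_plus _ open_E_plus] disjoint_K_plus
  unfolding K_plus_def disjoint_family_on_def by blast

end

context mass_pair
begin

lemma K_plus_minus_separated:
  assumes "C \<in> K_plus \<mu> \<nu>" "C' \<in> K_plus \<nu> \<mu>"
  shows "rend C \<le> lend C' \<or> rend C' \<le> lend C"
  using assms disjoint_components_ends[OF open_E_plus _ swap.open_E_plus, of C C'] E_plus_Int
    K_plus_subset[of C] swap.K_plus_subset[of C']
  unfolding K_plus_def by blast

lemma lend_inj: "C \<in> K_plus \<mu> \<nu> \<Longrightarrow> C' \<in> K_plus \<mu> \<nu> \<Longrightarrow> lend C = lend C' \<Longrightarrow> C = C'"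
  using K_plus_separated[of C C'] lend_less_rend_K[of C] lend_less_rend_K[of C'] by (metis leD)

lemma rend_inj: "C \<in> K_plus \<mu> \<nu> \<Longrightarrow> C' \<in> K_plus \<mu> \<nu> \<Longrightarrow> rend C = rend C' \<Longrightarrow> C = C'"
  using K_plus_separated[of C C'] lend_less_rend_K[of C] lend_less_rend_K[of C'] by (metis leD)

lemma Bset_iff:
  "x \<in> Bset \<mu> \<nu> \<longleftrightarrow> (\<exists>C\<in>K_plus \<mu> \<nu> \<union> K_plus \<nu> \<mu>. lend C = ereal x \<or> rend C = ereal x)"
  unfolding Bset_def K_minus_swap by (auto simp: eq_commute)

end

context mass_pair
begin

lemma Bset_subset: "Bset \<mu> \<nu> \<subseteq> E_eq \<mu> \<nu>"
  using K_plus_end_E_eq swap.K_plus_end_E_eq unfolding Bset_iff E_eq_swap[of \<mu> \<nu>] by (auto simp: Bset_iff)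

lemma countable_Bset: "countable (Bset \<mu> \<nu>)"
proof -
  let ?K = "K_plus \<mu> \<nu> \<union> K_plus \<nu> \<mu>"
  have "Bset \<mu> \<nu> \<subseteq> real_of_ereal ` (lend ` ?K \<union> rend ` ?K)"
    by (force simp: Bset_iff image_iff)
  moreover have "countable (real_of_ereal ` (lend ` ?K \<union> rend ` ?K))"
    using countable_K_plus swap.countable_K_plus by (intro countable_image countable_Un) auto
  ultimately show ?thesis by (rule countable_subset)
qed

text \<open>A strict inequality at \<open>x\<close> would make \<open>x\<close> an endpoint: of a
  positive component for one sign, of a negative component for the other.\<close>

lemma cdf_eq_off_Bset:
  assumes "x \<in> E_eq \<mu> \<nu>" "x \<notin> Bset \<mu> \<nu>"
  shows "cdf \<mu> x = cdf \<nu> x" "cdf_left \<mu> x = cdf_left \<nu> x"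
proof -
  have x': "x \<in> E_eq \<nu> \<mu>" using assms(1) E_eq_swap by simp
  show "cdf \<mu> x = cdf \<nu> x"
    by (rule antisym; rule ccontr; unfold not_le; erule lend_eq_if_cdf_gt[OF assms(1)] swap.lend_eq_if_cdf_gt[OF x'])
      (use assms(2) in \<open>auto simp: Bset_iff\<close>)
  show "cdf_left \<mu> x = cdf_left \<nu> x"
    by (rule antisym; rule ccontr; unfold not_le; erule rend_eq_if_cdf_left_gt[OF assms(1)] swap.rend_eq_if_cdf_left_gt[OF x'])
      (use assms(2) in \<open>auto simp: Bset_iff\<close>)
qed

lemma E_borel [measurable]:
  "E_plus \<mu> \<nu> \<in> sets borel" "E_plus \<nu> \<mu> \<in> sets borel" "Bset \<mu> \<nu> \<in> sets borel" "E_eq \<mu> \<nu> \<in> sets borel"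
  using open_E_plus swap.open_E_plus countable_Bset
  by (auto simp: E_eq_def E_minus_swap intro: sets.countable)

section \<open>Coincidence of the measures where the distribution functions agree\<close>

text \<open>The mass of an open interval involves only \<open>cdf_left\<close> at its right end and
  \<open>cdf\<close> at its left end. Finite ends lie outside \<open>U\<close>, where agreement is
  assumed; infinite ones are settled by equality of the total masses.\<close>

lemma measure_component_eq:
  assumes "open U" "C \<in> components U"
    and "\<And>x. x \<notin> U \<Longrightarrow> cdf \<mu> x = cdf \<nu> x \<and> cdf_left \<mu> x = cdf_left \<nu> x"
  shows "emeasure \<mu> C = emeasure \<nu> C"
proof -
  have "ecdf \<mu> (lend C) = ecdf \<nu> (lend C)"
    using assms(3) component_end_notin[OF assms(1,2)] by (cases "lend C") (auto simp: total_mass)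
  moreover have "ecdf_left \<mu> (rend C) = ecdf_left \<nu> (rend C)"
    using assms(3) component_end_notin[OF assms(1,2)] by (cases "rend C") (auto simp: total_mass)
  moreover have "measure \<gamma> C = ecdf_left \<gamma> (rend C) - ecdf \<gamma> (lend C)" if "\<gamma> \<in> fin_borel" for \<gamma>
    using measure_open_interval[OF that lend_less_rend[OF assms(1,2)]]
      component_eq_interval[OF assms(1,2)] by simp
  ultimately show ?thesis
    using fin_mu swap.fin_mu by (simp add: M.emeasure_eq_measure swap.M.emeasure_eq_measure)
qed

text \<open>\<open>K\<close> may be of Cantor type, without any interval on which the distribution
  functions could be used. Its complement, however, is a countable disjoint union of open intervals
  whose finite ends lie in \<open>K\<close>, and equal total masses carry the equality over to
  \<open>K\<close>.\<close>

lemma emeasure_compact_eq: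
  assumes "compact K" "\<And>x. x \<in> K \<Longrightarrow> cdf \<mu> x = cdf \<nu> x \<and> cdf_left \<mu> x = cdf_left \<nu> x"
  shows "emeasure \<mu> K = emeasure \<nu> K"
proof -
  let ?U = "- K"
  have "open ?U" using assms(1) compact_imp_closed by blast
  have disj: "disjoint_family_on (\<lambda>C. C) (components ?U)"
    by (auto simp: disjoint_family_on_def components_nonoverlap)
  have sets: "C \<in> sets borel" if "C \<in> components ?U" for C
    using that \<open>open ?U\<close> open_components borel_open by metis
  have "emeasure \<mu> ?U = (\<integral>\<^sup>+C. emeasure \<mu> C \<partial>count_space (components ?U))"
    using emeasure_UN_countable[OF _ countable_components_real[OF \<open>open ?U\<close>] disj, of \<mu>] sets by simp
  also have "\<dots> = (\<integral>\<^sup>+C. emeasure \<nu> C \<partial>count_space (components ?U))"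
    using assms(2) \<open>open ?U\<close> by (intro nn_integral_cong measure_component_eq) auto
  also have "\<dots> = emeasure \<nu> ?U"
    using emeasure_UN_countable[OF _ countable_components_real[OF \<open>open ?U\<close>] disj, of \<nu>] sets by simp
  finally have U: "measure \<mu> ?U = measure \<nu> ?U" by (simp add: measure_def)
  have "K \<in> sets borel" using assms(1) by (simp add: borel_compact)
  then have "measure \<mu> K = measure \<nu> K"
    using M.finite_measure_compl[of ?U] swap.M.finite_measure_compl[of ?U] U total_mass
    by (simp add: Compl_eq_Diff_UNIV[symmetric])
  then show ?thesis by (simp add: M.emeasure_eq_measure swap.M.emeasure_eq_measure)
qed

text \<open>The hypothesis passes to the compact subsets of \<open>X\<close>, and inner regularity
  recovers both measures of \<open>X\<close> from them.\<close>

lemma emeasure_eq_if_cdf_eq: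
  assumes "X \<in> sets borel" "\<And>x. x \<in> X \<Longrightarrow> cdf \<mu> x = cdf \<nu> x \<and> cdf_left \<mu> x = cdf_left \<nu> x"
  shows "emeasure \<mu> X = emeasure \<nu> X"
proof -
  have "emeasure \<mu> X = (SUP K\<in>{K. K \<subseteq> X \<and> compact K}. emeasure \<mu> K)"
    using assms(1) by (intro inner_regular) auto
  also have "\<dots> = (SUP K\<in>{K. K \<subseteq> X \<and> compact K}. emeasure \<nu> K)"
    using assms(2) by (intro SUP_cong emeasure_compact_eq) auto
  also have "\<dots> = emeasure \<nu> X"
    using assms(1) by (intro inner_regular[symmetric]) auto
  finally show ?thesis .
qed

end

section \<open>The components of the marginals\<close>

lemma emeasure_end_mass:
  "X \<in> sets borel \<Longrightarrow> emeasure (end_mass w e) X =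
    (if \<bar>e\<bar> = \<infinity> then 0 else ennreal (w (real_of_ereal e)) * indicator X (real_of_ereal e))"
  by (simp add: end_mass_def emeasure_point_mass)

context mass_pair
begin

text \<open>At an infinite endpoint \<open>real_of_ereal\<close> returns 0, a meaningless location
  for an atom. This is harmless, since the difference of the extended distribution functions
  vanishes there.\<close>

lemma emeasure_mu_plus_comp:
  assumes "C \<in> K_plus \<mu> \<nu>" "X \<in> sets borel"
  shows "emeasure (mu_plus_comp \<mu> \<nu> C) X =
    ennreal (ecdf \<mu> (lend C) - ecdf \<nu> (lend C)) * indicator X (real_of_ereal (lend C)) + emeasure \<mu> (C \<inter> X)"
proof -
  have "emeasure (mu_plus_comp \<mu> \<nu> C) X =
      emeasure (end_mass (\<lambda>a. cdf \<mu> a - cdf \<nu> a) (lend C)) X + emeasure \<mu> (C \<inter> X)"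
    unfolding mu_plus_comp_def using assms K_plus_borel[OF assms(1)]
    by (simp add: emeasure_madd emeasure_mrestr)
  then show ?thesis
    using assms(2) by (cases "lend C") (auto simp: emeasure_end_mass total_mass)
qed

lemma emeasure_nu_plus_comp:
  assumes "C \<in> K_plus \<mu> \<nu>" "X \<in> sets borel"
  shows "emeasure (nu_plus_comp \<mu> \<nu> C) X =
    emeasure \<nu> (C \<inter> X) + ennreal (ecdf_left \<mu> (rend C) - ecdf_left \<nu> (rend C)) * indicator X (real_of_ereal (rend C))"
proof -
  have "emeasure (nu_plus_comp \<mu> \<nu> C) X =
      emeasure \<nu> (C \<inter> X) + emeasure (end_mass (\<lambda>a. cdf_left \<mu> a - cdf_left \<nu> a) (rend C)) X"
    unfolding nu_plus_comp_def using assms K_plus_borel[OF assms(1)]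
    by (simp add: emeasure_madd emeasure_mrestr)
  then show ?thesis
    using assms(2) by (cases "rend C") (auto simp: emeasure_end_mass total_mass)
qed

text \<open>By \<open>cdf_lend_ge\<close> the weight is nonnegative, so \<open>ennreal\<close>
  truncates nothing and can be pulled out of the sum.\<close>

lemma emeasure_mu_plus_comp_eq_measure:
  assumes "C \<in> K_plus \<mu> \<nu>" "X \<in> sets borel"
  shows "emeasure (mu_plus_comp \<mu> \<nu> C) X = ennreal
    ((ecdf \<mu> (lend C) - ecdf \<nu> (lend C)) * indicator X (real_of_ereal (lend C)) + measure \<mu> (C \<inter> X))"
  using cdf_lend_ge[OF assms(1)] unfolding emeasure_mu_plus_comp[OF assms]
  by (auto simp: M.emeasure_eq_measure indicator_def)

lemma emeasure_nu_plus_comp_eq_measure: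
  assumes "C \<in> K_plus \<mu> \<nu>" "X \<in> sets borel"
  shows "emeasure (nu_plus_comp \<mu> \<nu> C) X = ennreal (measure \<nu> (C \<inter> X) +
    (ecdf_left \<mu> (rend C) - ecdf_left \<nu> (rend C)) * indicator X (real_of_ereal (rend C)))"
  using cdf_left_rend_ge[OF assms(1)] unfolding emeasure_nu_plus_comp[OF assms]
  by (auto simp: swap.M.emeasure_eq_measure indicator_def)

lemma measure_mu_plus_comp:
  assumes "C \<in> K_plus \<mu> \<nu>" "X \<in> sets borel"
  shows "measure (mu_plus_comp \<mu> \<nu> C) X =
    (ecdf \<mu> (lend C) - ecdf \<nu> (lend C)) * indicator X (real_of_ereal (lend C)) + measure \<mu> (C \<inter> X)"
  using cdf_lend_ge[OF assms(1)] emeasure_mu_plus_comp_eq_measure[OF assms]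
  by (intro measure_eq_emeasure_eq_ennreal) auto

lemma measure_nu_plus_comp:
  assumes "C \<in> K_plus \<mu> \<nu>" "X \<in> sets borel"
  shows "measure (nu_plus_comp \<mu> \<nu> C) X = measure \<nu> (C \<inter> X) +
    (ecdf_left \<mu> (rend C) - ecdf_left \<nu> (rend C)) * indicator X (real_of_ereal (rend C))"
  using cdf_left_rend_ge[OF assms(1)] emeasure_nu_plus_comp_eq_measure[OF assms]
  by (intro measure_eq_emeasure_eq_ennreal) auto

lemma K_plus_end_in_Bset:
  "C \<in> K_plus \<mu> \<nu> \<Longrightarrow> lend C = ereal x \<Longrightarrow> x \<in> Bset \<mu> \<nu>"
  "C \<in> K_plus \<mu> \<nu> \<Longrightarrow> rend C = ereal x \<Longrightarrow> x \<in> Bset \<mu> \<nu>"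
  by (auto simp: Bset_iff)

text \<open>The case boundaries are those of \<open>end_mass_initial\<close>, so that restriction
  and atom can be added branch by branch. At \<open>ereal t = lend C\<close> the second branch of
  the first formula correctly gives 0.\<close>

lemma measure_K_Int:
  assumes "C \<in> K_plus \<mu> \<nu>" "\<gamma> \<in> fin_borel"
  shows "measure \<gamma> (C \<inter> {..t}) = (if ereal t < lend C then 0 else
      if ereal t < rend C then cdf \<gamma> t - ecdf \<gamma> (lend C) else ecdf_left \<gamma> (rend C) - ecdf \<gamma> (lend C))"
    and "measure \<gamma> (C \<inter> {..<t}) = (if ereal t \<le> lend C then 0 else
      if ereal t \<le> rend C then cdf_left \<gamma> t - ecdf \<gamma> (lend C) else ecdf_left \<gamma> (rend C) - ecdf \<gamma> (lend C))"
    and "measure \<gamma> C = ecdf_left \<gamma> (rend C) - ecdf \<gamma> (lend C)"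
proof -
  have C: "C = {x. lend C < ereal x \<and> ereal x < rend C}"
    using mem_K_plus_iff[OF assms(1)] by blast
  show *: "measure \<gamma> C = ecdf_left \<gamma> (rend C) - ecdf \<gamma> (lend C)"
    by (subst C) (rule measure_open_interval[OF assms(2) lend_less_rend_K[OF assms(1)]])
  show "measure \<gamma> (C \<inter> {..t}) = (if ereal t < lend C then 0 else
      if ereal t < rend C then cdf \<gamma> t - ecdf \<gamma> (lend C) else ecdf_left \<gamma> (rend C) - ecdf \<gamma> (lend C))"
  proof -
    consider "ereal t < lend C" | "lend C \<le> ereal t" "ereal t < rend C" | "rend C \<le> ereal t" "lend C \<le> ereal t"
      using lend_less_rend_K[OF assms(1)] by (meson leI less_le_trans less_imp_le)
    then show ?thesis
    proof cases
      case 1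
      then have "C \<inter> {..t} = {}" by (auto simp: mem_K_plus_iff[OF assms(1)]) (metis ereal_less_eq(3) less_trans not_le)
      with 1 show ?thesis by simp
    next
      case 2
      then have "C \<inter> {..t} = {x. lend C < ereal x \<and> ereal x \<le> ereal t}"
        by (auto simp: mem_K_plus_iff[OF assms(1)]) (metis ereal_less_eq(3) le_less_trans)
      with 2 show ?thesis using measure_left_open_interval[OF assms(2) 2(1)] by (simp add: leD)
    next
      case 3
      then have "C \<inter> {..t} = C"
        by (auto simp: mem_K_plus_iff[OF assms(1)]) (metis ereal_less_eq(3) less_imp_le less_le_trans)
      with 3 * show ?thesis by (auto dest: leD)
    qed
  qed
  show "measure \<gamma> (C \<inter> {..<t}) = (if ereal t \<le> lend C then 0 else
      if ereal t \<le> rend C then cdf_left \<gamma> t - ecdf \<gamma> (lend C) else ecdf_left \<gamma> (rend C) - ecdf \<gamma> (lend C))"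
  proof -
    consider "ereal t \<le> lend C" | "lend C < ereal t" "ereal t \<le> rend C" | "rend C < ereal t" "lend C < ereal t"
      using lend_less_rend_K[OF assms(1)] by (meson leI less_trans)
    then show ?thesis
    proof cases
      case 1
      then have "C \<inter> {..<t} = {}" by (auto simp: mem_K_plus_iff[OF assms(1)]) (metis less_ereal.simps(1) less_le_trans less_asym)
      with 1 show ?thesis by simp
    next
      case 2
      then have "C \<inter> {..<t} = {x. lend C < ereal x \<and> ereal x < ereal t}"
        by (auto simp: mem_K_plus_iff[OF assms(1)]) (metis less_ereal.simps(1) less_le_trans)
      with 2 show ?thesis using measure_open_interval[OF assms(2) 2(1)] by (auto dest: leD)
    next
      case 3
      then have "C \<inter> {..<t} = C"
        by (auto simp: mem_K_plus_iff[OF assms(1)]) (metis less_ereal.simps(1) less_trans)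
      with 3 * show ?thesis by (auto dest: leD)
    qed
  qed
qed

lemma end_mass_initial:
  assumes "C \<in> K_plus \<mu> \<nu>"
  shows "(ecdf \<mu> (lend C) - ecdf \<nu> (lend C)) * indicator {..t} (real_of_ereal (lend C)) =
      (if ereal t < lend C then 0 else ecdf \<mu> (lend C) - ecdf \<nu> (lend C))"
    and "(ecdf \<mu> (lend C) - ecdf \<nu> (lend C)) * indicator {..<t} (real_of_ereal (lend C)) =
      (if ereal t \<le> lend C then 0 else ecdf \<mu> (lend C) - ecdf \<nu> (lend C))"
    and "(ecdf_left \<mu> (rend C) - ecdf_left \<nu> (rend C)) * indicator {..t} (real_of_ereal (rend C)) =
      (if ereal t < rend C then 0 else ecdf_left \<mu> (rend C) - ecdf_left \<nu> (rend C))"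
    and "(ecdf_left \<mu> (rend C) - ecdf_left \<nu> (rend C)) * indicator {..<t} (real_of_ereal (rend C)) =
      (if ereal t \<le> rend C then 0 else ecdf_left \<mu> (rend C) - ecdf_left \<nu> (rend C))"
proof -
  have ne: "lend C \<noteq> \<infinity>" "rend C \<noteq> -\<infinity>" using lend_less_rend_K[OF assms] by auto
  show "(ecdf \<mu> (lend C) - ecdf \<nu> (lend C)) * indicator {..t} (real_of_ereal (lend C)) =
      (if ereal t < lend C then 0 else ecdf \<mu> (lend C) - ecdf \<nu> (lend C))"
    and "(ecdf \<mu> (lend C) - ecdf \<nu> (lend C)) * indicator {..<t} (real_of_ereal (lend C)) =
      (if ereal t \<le> lend C then 0 else ecdf \<mu> (lend C) - ecdf \<nu> (lend C))"
    using ne(1) by (cases "lend C"; auto)+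
  show "(ecdf_left \<mu> (rend C) - ecdf_left \<nu> (rend C)) * indicator {..t} (real_of_ereal (rend C)) =
      (if ereal t < rend C then 0 else ecdf_left \<mu> (rend C) - ecdf_left \<nu> (rend C))"
    and "(ecdf_left \<mu> (rend C) - ecdf_left \<nu> (rend C)) * indicator {..<t} (real_of_ereal (rend C)) =
      (if ereal t \<le> rend C then 0 else ecdf_left \<mu> (rend C) - ecdf_left \<nu> (rend C))"
    using ne(2) by (cases "rend C"; auto simp: total_mass)+
qed

text \<open>This explains the weights. With a the left endpoint, (F_\<mu>(a) - F_\<nu>(a)) +
  (F_\<mu>(t) - F_\<mu>(a)) = F_\<mu>(t) - F_\<nu>(a), so on the component both marginals have the
  original distribution functions shifted by the same constant. The atom at the right endpoint lifts
  the second marginal to the final value of the first.\<close>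

lemma cdf_comp:
  assumes "C \<in> K_plus \<mu> \<nu>"
  shows "cdf (mu_plus_comp \<mu> \<nu> C) t = (if ereal t < lend C then 0 else
      if ereal t < rend C then cdf \<mu> t - ecdf \<nu> (lend C) else ecdf_left \<mu> (rend C) - ecdf \<nu> (lend C))"
    and "cdf_left (mu_plus_comp \<mu> \<nu> C) t = (if ereal t \<le> lend C then 0 else
      if ereal t \<le> rend C then cdf_left \<mu> t - ecdf \<nu> (lend C) else ecdf_left \<mu> (rend C) - ecdf \<nu> (lend C))"
    and "cdf (nu_plus_comp \<mu> \<nu> C) t = (if ereal t < lend C then 0 else
      if ereal t < rend C then cdf \<nu> t - ecdf \<nu> (lend C) else ecdf_left \<mu> (rend C) - ecdf \<nu> (lend C))"
    and "cdf_left (nu_plus_comp \<mu> \<nu> C) t = (if ereal t \<le> lend C then 0 else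
      if ereal t \<le> rend C then cdf_left \<nu> t - ecdf \<nu> (lend C) else ecdf_left \<mu> (rend C) - ecdf \<nu> (lend C))"
proof -
  have lt: "ereal t < lend C \<Longrightarrow> ereal t < rend C" "ereal t \<le> lend C \<Longrightarrow> ereal t \<le> rend C"
    using lend_less_rend_K[OF assms] by auto
  show "cdf (mu_plus_comp \<mu> \<nu> C) t = (if ereal t < lend C then 0 else
      if ereal t < rend C then cdf \<mu> t - ecdf \<nu> (lend C) else ecdf_left \<mu> (rend C) - ecdf \<nu> (lend C))"
    unfolding cdf_def2[of "mu_plus_comp \<mu> \<nu> C"] using measure_mu_plus_comp[OF assms, of "{..t}"]
    by (simp add: end_mass_initial[OF assms] measure_K_Int[OF assms fin_mu])
  show "cdf_left (mu_plus_comp \<mu> \<nu> C) t = (if ereal t \<le> lend C then 0 else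
      if ereal t \<le> rend C then cdf_left \<mu> t - ecdf \<nu> (lend C) else ecdf_left \<mu> (rend C) - ecdf \<nu> (lend C))"
    unfolding cdf_left_def[of "mu_plus_comp \<mu> \<nu> C"] using measure_mu_plus_comp[OF assms, of "{..<t}"]
    by (simp add: end_mass_initial[OF assms] measure_K_Int[OF assms fin_mu])
  show "cdf (nu_plus_comp \<mu> \<nu> C) t = (if ereal t < lend C then 0 else
      if ereal t < rend C then cdf \<nu> t - ecdf \<nu> (lend C) else ecdf_left \<mu> (rend C) - ecdf \<nu> (lend C))"
    unfolding cdf_def2[of "nu_plus_comp \<mu> \<nu> C"] using measure_nu_plus_comp[OF assms, of "{..t}"] lt
    by (simp add: end_mass_initial[OF assms] measure_K_Int[OF assms swap.fin_mu])
  show "cdf_left (nu_plus_comp \<mu> \<nu> C) t = (if ereal t \<le> lend C then 0 else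
      if ereal t \<le> rend C then cdf_left \<nu> t - ecdf \<nu> (lend C) else ecdf_left \<mu> (rend C) - ecdf \<nu> (lend C))"
    unfolding cdf_left_def[of "nu_plus_comp \<mu> \<nu> C"] using measure_nu_plus_comp[OF assms, of "{..<t}"] lt
    by (simp add: end_mass_initial[OF assms] measure_K_Int[OF assms swap.fin_mu])
qed

lemma comp_total_mass:
  assumes "C \<in> K_plus \<mu> \<nu>"
  shows "emeasure (mu_plus_comp \<mu> \<nu> C) UNIV = ennreal (ecdf_left \<mu> (rend C) - ecdf \<nu> (lend C))"
    and "emeasure (nu_plus_comp \<mu> \<nu> C) UNIV = ennreal (ecdf_left \<mu> (rend C) - ecdf \<nu> (lend C))"
    and "measure (nu_plus_comp \<mu> \<nu> C) UNIV = ecdf_left \<mu> (rend C) - ecdf \<nu> (lend C)"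
  using emeasure_mu_plus_comp_eq_measure[OF assms, of UNIV] emeasure_nu_plus_comp_eq_measure[OF assms, of UNIV]
    measure_K_Int(3)[OF assms fin_mu] measure_K_Int(3)[OF assms swap.fin_mu]
    measure_nu_plus_comp[OF assms, of UNIV] by simp_all

lemma comp_cdf_diff:
  assumes "C \<in> K_plus \<mu> \<nu>"
  shows "cdf (mu_plus_comp \<mu> \<nu> C) t - cdf (nu_plus_comp \<mu> \<nu> C) t =
      (if lend C \<le> ereal t \<and> ereal t < rend C then cdf \<mu> t - cdf \<nu> t else 0)"
  by (auto simp: cdf_comp[OF assms] not_less)

lemma cdf_le_on_comp:
  assumes "C \<in> K_plus \<mu> \<nu>" "lend C \<le> ereal t" "ereal t < rend C"
  shows "cdf \<nu> t \<le> cdf \<mu> t"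
proof (cases "lend C = ereal t")
  case True
  then show ?thesis using cdf_lend_ge[OF assms(1)] by simp
next
  case False
  then have "t \<in> C" using assms mem_K_plus_iff by auto
  then show ?thesis using K_plus_subset[OF assms(1)] by (auto simp: E_plus_def)
qed

lemma comp_cdf_le:
  assumes "C \<in> K_plus \<mu> \<nu>"
  shows "cdf (nu_plus_comp \<mu> \<nu> C) t \<le> cdf (mu_plus_comp \<mu> \<nu> C) t"
  using comp_cdf_diff[OF assms, of t] cdf_le_on_comp[OF assms, of t] by (auto split: if_splits)

text \<open>Inside \<open>C\<close> strictness is the definition of \<open>E_plus\<close>. At the
  endpoints it comes from the membership in \<open>T_plus\<close> or \<open>T_minus\<close>: at the
  left one the second \<open>cdf\<close> is 0 and the first is assumed positive; at the right one
  the first \<open>cdf_left\<close> is the total mass and the second is assumed smaller.\<close>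

lemma comp_F_le:
  assumes "C \<in> K_plus \<mu> \<nu>"
  shows "mu_plus_comp \<mu> \<nu> C \<le>\<^sub>F nu_plus_comp \<mu> \<nu> C"
  unfolding F_le_def st_le_def
proof (intro conjI allI subsetI)
  show "emeasure (mu_plus_comp \<mu> \<nu> C) UNIV = emeasure (nu_plus_comp \<mu> \<nu> C) UNIV"
    by (simp add: comp_total_mass[OF assms])
  show "cdf (nu_plus_comp \<mu> \<nu> C) t \<le> cdf (mu_plus_comp \<mu> \<nu> C) t" for t
    by (rule comp_cdf_le[OF assms])
  fix t
  have E: "t \<in> C \<Longrightarrow> cdf \<mu> t > cdf \<nu> t \<and> cdf_left \<mu> t > cdf_left \<nu> t"
    using K_plus_subset[OF assms] by (auto simp: E_plus_def)
  have E': "cdf \<mu> t > cdf \<nu> t \<and> cdf_left \<mu> t > cdf_left \<nu> t"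
    if "\<not> ereal t < lend C" "ereal t \<le> rend C" "lend C \<noteq> ereal t" "rend C \<noteq> ereal t"
    using that E by (auto simp: mem_K_plus_iff[OF assms] order_less_le)
  show "t \<in> {t. cdf (nu_plus_comp \<mu> \<nu> C) t < cdf (mu_plus_comp \<mu> \<nu> C) t}"
    if "t \<in> T_plus (mu_plus_comp \<mu> \<nu> C) (nu_plus_comp \<mu> \<nu> C)"
  proof (cases "lend C = ereal t")
    case True
    then show ?thesis using that lend_less_rend_K[OF assms]
      by (auto simp: T_plus_def cdf_comp[OF assms] comp_total_mass[OF assms])
  next
    case False
    then show ?thesis using that E'
      by (auto simp: T_plus_def cdf_comp[OF assms] comp_total_mass[OF assms] split: if_splits)
  qed
  show "t \<in> {t. cdf_left (nu_plus_comp \<mu> \<nu> C) t < cdf_left (mu_plus_comp \<mu> \<nu> C) t}"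
    if "t \<in> T_minus (mu_plus_comp \<mu> \<nu> C) (nu_plus_comp \<mu> \<nu> C)"
  proof (cases "rend C = ereal t")
    case True
    then show ?thesis using that lend_less_rend_K[OF assms]
      by (auto simp: T_minus_def cdf_comp[OF assms] comp_total_mass[OF assms])
  next
    case False
    then show ?thesis using that E'
      by (auto simp: T_minus_def cdf_comp[OF assms] comp_total_mass[OF assms] split: if_splits)
  qed
qed

section \<open>Recomposing the marginals\<close>

lemma emeasure_mu_plus:
  "X \<in> sets borel \<Longrightarrow> emeasure (mu_plus \<mu> \<nu>) X = (\<integral>\<^sup>+C. emeasure (mu_plus_comp \<mu> \<nu> C) X \<partial>count_space (K_plus \<mu> \<nu>))"
  unfolding mu_plus_def by (rule emeasure_msum) auto

lemma emeasure_nu_plus: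
  "X \<in> sets borel \<Longrightarrow> emeasure (nu_plus \<mu> \<nu>) X = (\<integral>\<^sup>+C. emeasure (nu_plus_comp \<mu> \<nu> C) X \<partial>count_space (K_plus \<mu> \<nu>))"
  unfolding nu_plus_def by (rule emeasure_msum) auto

lemma emeasure_Union_K_plus:
  assumes "X \<in> sets borel" "sets \<gamma> = sets borel"
  shows "(\<integral>\<^sup>+C. emeasure \<gamma> (C \<inter> X) \<partial>count_space (K_plus \<mu> \<nu>)) = emeasure \<gamma> (E_plus \<mu> \<nu> \<inter> X)"
proof -
  have "emeasure \<gamma> (\<Union>((\<lambda>C. C \<inter> X) ` K_plus \<mu> \<nu>)) = (\<integral>\<^sup>+C. emeasure \<gamma> (C \<inter> X) \<partial>count_space (K_plus \<mu> \<nu>))"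
    using assms K_plus_borel disjoint_K_plus countable_K_plus
    by (intro emeasure_UN_countable) (auto simp: disjoint_family_on_def)
  moreover have "\<Union>((\<lambda>C. C \<inter> X) ` K_plus \<mu> \<nu>) = E_plus \<mu> \<nu> \<inter> X" using Union_K_plus by auto
  ultimately show ?thesis by simp
qed

lemma lend_coeff_zero:
  assumes "C \<in> K_plus \<mu> \<nu>" "\<And>x. lend C = ereal x \<Longrightarrow> x \<notin> X"
  shows "ennreal (ecdf \<mu> (lend C) - ecdf \<nu> (lend C)) * indicator X (real_of_ereal (lend C)) = 0"
  using assms(2) by (cases "lend C") (auto simp: total_mass)

lemma rend_coeff_zero:
  assumes "C \<in> K_plus \<mu> \<nu>" "\<And>x. rend C = ereal x \<Longrightarrow> x \<notin> X"
  shows "ennreal (ecdf_left \<mu> (rend C) - ecdf_left \<nu> (rend C)) * indicator X (real_of_ereal (rend C)) = 0"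
  using assms(2) by (cases "rend C") (auto simp: total_mass)

text \<open>All endpoint atoms sit in \<open>Bset\<close>; the remaining restrictions to the
  components add up to the restriction to \<open>E_plus\<close>.\<close>

lemma plus_off_Bset:
  assumes "X \<in> sets borel" "X \<inter> Bset \<mu> \<nu> = {}"
  shows "emeasure (mu_plus \<mu> \<nu>) X = emeasure \<mu> (E_plus \<mu> \<nu> \<inter> X)"
    and "emeasure (nu_plus \<mu> \<nu>) X = emeasure \<nu> (E_plus \<mu> \<nu> \<inter> X)"
proof -
  have "emeasure (mu_plus_comp \<mu> \<nu> C) X = emeasure \<mu> (C \<inter> X)" if "C \<in> K_plus \<mu> \<nu>" for C
    unfolding emeasure_mu_plus_comp[OF that assms(1)]
    using assms(2) that by (subst lend_coeff_zero) (auto dest: K_plus_end_in_Bset)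
  then show "emeasure (mu_plus \<mu> \<nu>) X = emeasure \<mu> (E_plus \<mu> \<nu> \<inter> X)"
    unfolding emeasure_mu_plus[OF assms(1)] emeasure_Union_K_plus[OF assms(1) sets_mu, symmetric]
    by (intro nn_integral_cong) auto
  have "emeasure (nu_plus_comp \<mu> \<nu> C) X = emeasure \<nu> (C \<inter> X)" if "C \<in> K_plus \<mu> \<nu>" for C
    unfolding emeasure_nu_plus_comp[OF that assms(1)]
    using assms(2) that by (subst rend_coeff_zero) (auto dest: K_plus_end_in_Bset)
  then show "emeasure (nu_plus \<mu> \<nu>) X = emeasure \<nu> (E_plus \<mu> \<nu> \<inter> X)"
    unfolding emeasure_nu_plus[OF assms(1)] emeasure_Union_K_plus[OF assms(1) swap.sets_mu, symmetric]
    by (intro nn_integral_cong) auto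
qed

text \<open>No component contains \<open>x\<close>, and at most one starts there. If none does, then
  \<open>cdf \<mu> x \<le> cdf \<nu> x\<close>, and the truncation by \<open>ennreal\<close> yields
  the correct value 0.\<close>

lemma mu_plus_singleton:
  assumes "x \<in> E_eq \<mu> \<nu>"
  shows "emeasure (mu_plus \<mu> \<nu>) {x} = ennreal (cdf \<mu> x - cdf \<nu> x)"
proof -
  have C0: "C \<inter> {x} = {}" if "C \<in> K_plus \<mu> \<nu>" for C
    using K_plus_subset[OF that] assms by (auto simp: E_eq_iff)
  have zero: "emeasure (mu_plus_comp \<mu> \<nu> C) {x} = 0" if "C \<in> K_plus \<mu> \<nu>" "lend C \<noteq> ereal x" for C
    unfolding emeasure_mu_plus_comp[OF that(1) borel_singleton[OF sets.empty_sets]] C0[OF that(1)]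
    using that(2) by (subst lend_coeff_zero[OF that(1)]) auto
  show ?thesis
  proof (cases "\<exists>C\<in>K_plus \<mu> \<nu>. lend C = ereal x")
    case True
    then obtain C where C: "C \<in> K_plus \<mu> \<nu>" "lend C = ereal x" by blast
    have "emeasure (mu_plus \<mu> \<nu>) {x} = (\<Sum>C\<in>{C}. emeasure (mu_plus_comp \<mu> \<nu> C) {x})"
      unfolding emeasure_mu_plus[OF borel_singleton[OF sets.empty_sets]]
    proof (rule nn_integral_count_space')
      fix C' assume "C' \<in> K_plus \<mu> \<nu>" "C' \<notin> {C}"
      then show "emeasure (mu_plus_comp \<mu> \<nu> C') {x} = 0"
        using C lend_inj[of C' C] zero[of C'] by auto
    qed (use C in auto)
    also have "\<dots> = ennreal (cdf \<mu> x - cdf \<nu> x)"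
      using C C0[OF C(1)] by (simp add: emeasure_mu_plus_comp)
    finally show ?thesis .
  next
    case False
    then have "cdf \<mu> x \<le> cdf \<nu> x"
      by (intro leI notI) (erule lend_eq_if_cdf_gt[OF assms], blast)
    moreover have "emeasure (mu_plus \<mu> \<nu>) {x} = (\<integral>\<^sup>+C. 0 \<partial>count_space (K_plus \<mu> \<nu>))"
      using False by (subst emeasure_mu_plus, simp, intro nn_integral_cong zero) auto
    ultimately show ?thesis by (simp add: ennreal_neg)
  qed
qed

lemma nu_plus_singleton:
  assumes "x \<in> E_eq \<mu> \<nu>"
  shows "emeasure (nu_plus \<mu> \<nu>) {x} = ennreal (cdf_left \<mu> x - cdf_left \<nu> x)"
proof -
  have C0: "C \<inter> {x} = {}" if "C \<in> K_plus \<mu> \<nu>" for C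
    using K_plus_subset[OF that] assms by (auto simp: E_eq_iff)
  have zero: "emeasure (nu_plus_comp \<mu> \<nu> C) {x} = 0" if "C \<in> K_plus \<mu> \<nu>" "rend C \<noteq> ereal x" for C
    unfolding emeasure_nu_plus_comp[OF that(1) borel_singleton[OF sets.empty_sets]] C0[OF that(1)]
    using that(2) by (subst rend_coeff_zero[OF that(1)]) auto
  show ?thesis
  proof (cases "\<exists>C\<in>K_plus \<mu> \<nu>. rend C = ereal x")
    case True
    then obtain C where C: "C \<in> K_plus \<mu> \<nu>" "rend C = ereal x" by blast
    have "emeasure (nu_plus \<mu> \<nu>) {x} = (\<Sum>C\<in>{C}. emeasure (nu_plus_comp \<mu> \<nu> C) {x})"
      unfolding emeasure_nu_plus[OF borel_singleton[OF sets.empty_sets]]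
    proof (rule nn_integral_count_space')
      fix C' assume "C' \<in> K_plus \<mu> \<nu>" "C' \<notin> {C}"
      then show "emeasure (nu_plus_comp \<mu> \<nu> C') {x} = 0"
        using C rend_inj[of C' C] zero[of C'] by auto
    qed (use C in auto)
    also have "\<dots> = ennreal (cdf_left \<mu> x - cdf_left \<nu> x)"
      using C C0[OF C(1)] by (simp add: emeasure_nu_plus_comp)
    finally show ?thesis .
  next
    case False
    then have "cdf_left \<mu> x \<le> cdf_left \<nu> x"
      by (intro leI notI) (erule rend_eq_if_cdf_left_gt[OF assms], blast)
    moreover have "emeasure (nu_plus \<mu> \<nu>) {x} = (\<integral>\<^sup>+C. 0 \<partial>count_space (K_plus \<mu> \<nu>))"
      using False by (subst emeasure_nu_plus, simp, intro nn_integral_cong zero) auto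
    ultimately show ?thesis by (simp add: ennreal_neg)
  qed
qed

end

section \<open>Sums of measures and their images\<close>

lemma msum_cong:
  assumes "\<And>i. i \<in> I \<Longrightarrow> f i = g i"
  shows "msum I f = msum I g"
proof -
  have "(\<lambda>A. \<integral>\<^sup>+ i. emeasure (f i) A \<partial>count_space I) = (\<lambda>A. \<integral>\<^sup>+ i. emeasure (g i) A \<partial>count_space I)"
    using assms by (intro ext nn_integral_cong) simp
  then show ?thesis by (simp add: msum_def)
qed

lemma distr_msum:
  fixes f :: "'i \<Rightarrow> 'a::topological_space measure" and g :: "'a \<Rightarrow> 'b::topological_space"
  assumes "\<And>i. i \<in> I \<Longrightarrow> sets (f i) = sets borel" and g: "g \<in> borel_measurable borel"
  shows "distr (msum I f) borel g = msum I (\<lambda>i. distr (f i) borel g)"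
proof (rule measure_eqI)
  fix X assume "X \<in> sets (distr (msum I f) borel g)"
  then have X: "X \<in> sets borel" by simp
  have vX: "g -` X \<in> sets borel" using measurable_sets_borel[OF g X] by simp
  have "space (msum I f) = UNIV" "\<And>i. i \<in> I \<Longrightarrow> space (f i) = UNIV"
    using sets_eq_imp_space_eq[OF assms(1)] sets_eq_imp_space_eq[OF sets_msum, of I f] by auto
  moreover have "g \<in> borel_measurable (msum I f)" "\<And>i. i \<in> I \<Longrightarrow> g \<in> borel_measurable (f i)"
    using g assms(1) by (auto cong: measurable_cong_sets)
  ultimately show "emeasure (distr (msum I f) borel g) X = emeasure (msum I (\<lambda>i. distr (f i) borel g)) X"
    using X vX assms(1) by (simp add: emeasure_distr emeasure_msum cong: nn_integral_cong_simp)
qed simp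

lemma distr_madd:
  fixes M N :: "'a::topological_space measure" and g :: "'a \<Rightarrow> 'b::topological_space"
  assumes "sets M = sets borel" "sets N = sets borel" and g: "g \<in> borel_measurable borel"
  shows "distr (M \<oplus>\<^sub>m N) borel g = distr M borel g \<oplus>\<^sub>m distr N borel g"
proof (rule measure_eqI)
  fix X assume "X \<in> sets (distr (M \<oplus>\<^sub>m N) borel g)"
  then have X: "X \<in> sets borel" by simp
  have vX: "g -` X \<in> sets borel" using measurable_sets_borel[OF g X] by simp
  have "space (M \<oplus>\<^sub>m N) = UNIV" "space M = UNIV" "space N = UNIV"
    using sets_eq_imp_space_eq[OF assms(1)] sets_eq_imp_space_eq[OF assms(2)]
      sets_eq_imp_space_eq[OF sets_madd, of M N] by auto
  moreover have "g \<in> borel_measurable (M \<oplus>\<^sub>m N)" "g \<in> borel_measurable M" "g \<in> borel_measurable N"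
    using g assms(1,2) by (auto cong: measurable_cong_sets)
  ultimately show "emeasure (distr (M \<oplus>\<^sub>m N) borel g) X = emeasure (distr M borel g \<oplus>\<^sub>m distr N borel g) X"
    using X vX assms(1,2) by (simp add: emeasure_distr emeasure_madd)
qed simp

section \<open>Atoms at the endpoints and recomposition of the marginals\<close>

context mass_pair
begin

lemma measure_plus_singleton:
  assumes "x \<in> E_eq \<mu> \<nu>"
  shows "measure (mu_plus \<mu> \<nu>) {x} = max 0 (cdf \<mu> x - cdf \<nu> x)"
    and "measure (nu_plus \<mu> \<nu>) {x} = max 0 (cdf_left \<mu> x - cdf_left \<nu> x)"
  using mu_plus_singleton[OF assms] nu_plus_singleton[OF assms]
  by (auto intro!: measure_eq_emeasure_eq_ennreal simp: max_def ennreal_neg)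

end

context mass_pair
begin

text \<open>Let d and e be the differences of \<open>cdf\<close> and of \<open>cdf_left\<close> at
  \<open>x\<close>. The mass d^+ + e^- is removed from the atom of \<open>\<mu>\<close> and e^+ +
  d^- from that of \<open>\<nu>\<close>. These amounts differ by d - e, which is also the difference
  of the atoms.\<close>

lemma atom_weight_eq:
  assumes "x \<in> Bset \<mu> \<nu>"
  shows "measure \<mu> {x} - measure (mu_plus \<mu> \<nu>) {x} - measure (mu_minus \<mu> \<nu>) {x} =
    measure \<nu> {x} - measure (nu_plus \<mu> \<nu>) {x} - measure (nu_minus \<mu> \<nu>) {x}"
proof -
  have x: "x \<in> E_eq \<mu> \<nu>" "x \<in> E_eq \<nu> \<mu>" using assms Bset_subset E_eq_swap by auto
  show ?thesis
    unfolding mu_minus_swap nu_minus_swap measure_plus_singleton[OF x(1)] swap.measure_plus_singleton[OF x(2)]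
      measure_singleton_eq[OF fin_mu] measure_singleton_eq[OF swap.fin_mu]
    by (auto simp: max_def)
qed

text \<open>Off \<open>Bset\<close> the distribution functions agree on \<open>E_eq\<close>, so the
  restrictions coincide; on \<open>Bset\<close> the weights match atom by atom.\<close>

lemma mu_eq_eq_nu_eq: "mu_eq \<mu> \<nu> = nu_eq \<mu> \<nu>"
proof -
  let ?G = "- Bset \<mu> \<nu> \<inter> E_eq \<mu> \<nu>"
  have "mrestr \<mu> ?G = mrestr \<nu> ?G"
  proof (rule measure_eqI)
    fix X assume "X \<in> sets (mrestr \<mu> ?G)"
    then have X: "X \<in> sets borel" by simp
    then have "emeasure \<mu> (?G \<inter> X) = emeasure \<nu> (?G \<inter> X)"
      using cdf_eq_off_Bset by (intro emeasure_eq_if_cdf_eq) auto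
    then show "emeasure (mrestr \<mu> ?G) X = emeasure (mrestr \<nu> ?G) X"
      using X by (simp add: emeasure_mrestr)
  qed simp
  then show ?thesis
    unfolding mu_eq_def nu_eq_def
    by (intro arg_cong2[where f = madd] msum_cong) (auto simp: atom_weight_eq)
qed

lemma emeasure_mu_eq:
  assumes "X \<in> sets borel"
  shows "emeasure (mu_eq \<mu> \<nu>) X = emeasure \<mu> (- Bset \<mu> \<nu> \<inter> E_eq \<mu> \<nu> \<inter> X) +
    (\<integral>\<^sup>+x. ennreal (measure \<mu> {x} - measure (mu_plus \<mu> \<nu>) {x} - measure (mu_minus \<mu> \<nu>) {x}) *
      indicator X x \<partial>count_space (Bset \<mu> \<nu>))"
  unfolding mu_eq_def using assms
  by (simp add: emeasure_madd emeasure_msum emeasure_mrestr emeasure_point_mass)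

lemma mu_eq_singleton:
  assumes "x \<in> Bset \<mu> \<nu>"
  shows "emeasure (mu_eq \<mu> \<nu>) {x} =
    ennreal (measure \<mu> {x} - measure (mu_plus \<mu> \<nu>) {x} - measure (mu_minus \<mu> \<nu>) {x})"
proof -
  let ?w = "\<lambda>x. ennreal (measure \<mu> {x} - measure (mu_plus \<mu> \<nu>) {x} - measure (mu_minus \<mu> \<nu>) {x})"
  have "(\<integral>\<^sup>+y. ?w y * indicator {x} y \<partial>count_space (Bset \<mu> \<nu>)) = (\<Sum>y\<in>{x}. ?w y * indicator {x} y)"
    using assms by (intro nn_integral_count_space') auto
  moreover have "- Bset \<mu> \<nu> \<inter> E_eq \<mu> \<nu> \<inter> {x} = {}" using assms by auto
  ultimately show ?thesis by (simp add: emeasure_mu_eq)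
qed

lemma mu_eq_off_Bset:
  assumes "X \<in> sets borel" "X \<inter> Bset \<mu> \<nu> = {}"
  shows "emeasure (mu_eq \<mu> \<nu>) X = emeasure \<mu> (E_eq \<mu> \<nu> \<inter> X)"
proof -
  have "(\<integral>\<^sup>+x. ennreal (measure \<mu> {x} - measure (mu_plus \<mu> \<nu>) {x} - measure (mu_minus \<mu> \<nu>) {x}) *
      indicator X x \<partial>count_space (Bset \<mu> \<nu>)) = (\<integral>\<^sup>+x. 0 \<partial>count_space (Bset \<mu> \<nu>))"
    using assms(2) by (intro nn_integral_cong) (auto simp: indicator_def)
  moreover have "- Bset \<mu> \<nu> \<inter> E_eq \<mu> \<nu> \<inter> X = E_eq \<mu> \<nu> \<inter> X" using assms(2) by auto
  ultimately show ?thesis using assms(1) by (simp add: emeasure_mu_eq)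
qed

lemma recompose_singleton:
  assumes "x \<in> Bset \<mu> \<nu>"
  shows "emeasure (mu_plus \<mu> \<nu>) {x} + emeasure (mu_minus \<mu> \<nu>) {x} + emeasure (mu_eq \<mu> \<nu>) {x} = emeasure \<mu> {x}"
proof -
  have x: "x \<in> E_eq \<mu> \<nu>" "x \<in> E_eq \<nu> \<mu>" using assms Bset_subset E_eq_swap by auto
  define p where "p = max 0 (cdf \<mu> x - cdf \<nu> x)"
  define m where "m = max 0 (cdf_left \<nu> x - cdf_left \<mu> x)"
  have "\<not> (cdf \<mu> x > cdf \<nu> x \<and> cdf_left \<mu> x > cdf_left \<nu> x)" "\<not> (cdf \<mu> x < cdf \<nu> x \<and> cdf_left \<mu> x < cdf_left \<nu> x)"
    using x(1) by (auto simp: E_eq_iff E_plus_def)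
  \<comment> \<open>This makes the weight of \<open>mu_eq\<close> at \<open>x\<close> nonnegative.
    With d and e the differences of \<open>cdf\<close> and \<open>cdf_left\<close> at
    \<open>x\<close>, the numbers d and e never have the same strict sign; hence
    \<open>p + m\<close> is either 0 or d - e, and the latter is the atom of \<open>\<mu>\<close>
    minus that of \<open>\<nu>\<close>.\<close>
  then have w: "p + m \<le> cdf \<mu> x - cdf_left \<mu> x"
    using cdf_left_le_cdf[OF fin_mu, of x x] cdf_left_le_cdf[OF swap.fin_mu, of x x]
    by (auto simp: p_def m_def max_def)
  have "emeasure (mu_plus \<mu> \<nu>) {x} = ennreal p" "emeasure (mu_minus \<mu> \<nu>) {x} = ennreal m"
    using mu_plus_singleton[OF x(1)] swap.nu_plus_singleton[OF x(2)]
    by (auto simp: mu_minus_swap p_def m_def max_def ennreal_neg)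
  moreover have "emeasure (mu_eq \<mu> \<nu>) {x} = ennreal (cdf \<mu> x - cdf_left \<mu> x - p - m)"
    unfolding mu_eq_singleton[OF assms] mu_minus_swap measure_plus_singleton[OF x(1)]
      swap.measure_plus_singleton[OF x(2)] measure_singleton_eq[OF fin_mu] p_def m_def by simp
  moreover have "emeasure \<mu> {x} = ennreal (cdf \<mu> x - cdf_left \<mu> x)"
    by (simp add: M.emeasure_eq_measure measure_singleton_eq[OF fin_mu])
  moreover have "0 \<le> p" "0 \<le> m" by (auto simp: p_def m_def)
  ultimately show ?thesis using w by (simp add: ennreal_plus[symmetric] del: ennreal_plus)
qed

text \<open>\<open>Bset\<close> is countable, so the equality on it follows from that of the atoms.
  Off \<open>Bset\<close> the three summands are the restrictions of \<open>\<mu>\<close> to E^+,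
  E^- and E^=.\<close>

lemma recompose_mu: "mu_plus \<mu> \<nu> \<oplus>\<^sub>m mu_minus \<mu> \<nu> \<oplus>\<^sub>m mu_eq \<mu> \<nu> = \<mu>" (is "?\<rho> = \<mu>")
proof (rule measure_eqI)
  have eq: "emeasure ?\<rho> X = emeasure (mu_plus \<mu> \<nu>) X + emeasure (mu_minus \<mu> \<nu>) X + emeasure (mu_eq \<mu> \<nu>) X"
    if "X \<in> sets borel" for X
    using that by (simp add: emeasure_madd)
  fix X assume "X \<in> sets ?\<rho>"
  then have X: "X \<in> sets borel" by simp
  let ?B = "Bset \<mu> \<nu>"
  have B: "X \<inter> ?B \<in> sets borel" "X - ?B \<in> sets borel" "countable (X \<inter> ?B)"
    using X countable_Bset by auto
  have split: "emeasure \<gamma> X = emeasure \<gamma> (X \<inter> ?B) + emeasure \<gamma> (X - ?B)" if "sets \<gamma> = sets borel" for \<gamma>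
    using B that plus_emeasure[of "X \<inter> ?B" \<gamma> "X - ?B"] by (simp add: Int_Diff_Un Int_Diff_disjoint)
  have "emeasure ?\<rho> (X \<inter> ?B) = (\<integral>\<^sup>+x. emeasure ?\<rho> {x} \<partial>count_space (X \<inter> ?B))"
    using B by (intro emeasure_countable_singleton) auto
  also have "\<dots> = (\<integral>\<^sup>+x. emeasure \<mu> {x} \<partial>count_space (X \<inter> ?B))"
    by (intro nn_integral_cong) (simp add: eq recompose_singleton)
  also have "\<dots> = emeasure \<mu> (X \<inter> ?B)"
    using B by (intro emeasure_countable_singleton[symmetric]) auto
  finally have 1: "emeasure ?\<rho> (X \<inter> ?B) = emeasure \<mu> (X \<inter> ?B)" .
  let ?Y = "X - ?B"
  have Y: "?Y \<inter> Bset \<mu> \<nu> = {}" "?Y \<inter> Bset \<nu> \<mu> = {}" using Bset_swap[of \<mu> \<nu>] by auto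
  have "emeasure ?\<rho> ?Y = emeasure (mu_plus \<mu> \<nu>) ?Y + emeasure (mu_minus \<mu> \<nu>) ?Y + emeasure (mu_eq \<mu> \<nu>) ?Y"
    by (rule eq[OF B(2)])
  also have "\<dots> = emeasure \<mu> (E_plus \<mu> \<nu> \<inter> ?Y) + emeasure \<mu> (E_plus \<nu> \<mu> \<inter> ?Y) + emeasure \<mu> (E_eq \<mu> \<nu> \<inter> ?Y)"
    unfolding mu_minus_swap plus_off_Bset(1)[OF B(2) Y(1)] swap.plus_off_Bset(2)[OF B(2) Y(2)]
      mu_eq_off_Bset[OF B(2) Y(1)] by (rule refl)
  also have "\<dots> = emeasure \<mu> ((E_plus \<mu> \<nu> \<inter> ?Y) \<union> (E_plus \<nu> \<mu> \<inter> ?Y)) + emeasure \<mu> (E_eq \<mu> \<nu> \<inter> ?Y)"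
    using B(2) E_plus_Int by (subst plus_emeasure) auto
  also have "\<dots> = emeasure \<mu> ((E_plus \<mu> \<nu> \<inter> ?Y) \<union> (E_plus \<nu> \<mu> \<inter> ?Y) \<union> (E_eq \<mu> \<nu> \<inter> ?Y))"
    using B(2) by (subst plus_emeasure) (auto simp: E_eq_iff)
  also have "(E_plus \<mu> \<nu> \<inter> ?Y) \<union> (E_plus \<nu> \<mu> \<inter> ?Y) \<union> (E_eq \<mu> \<nu> \<inter> ?Y) = ?Y"
    by (auto simp: E_eq_iff)
  finally show "emeasure ?\<rho> X = emeasure \<mu> X"
    using 1 by (subst (1 2) split) auto
qed simp

end

text \<open>In \<open>ennreal\<close> only finite terms can be cancelled; the finiteness of the sum
  bounds \<open>L\<close>.\<close>

lemma madd_left_cancel: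
  assumes "L \<oplus>\<^sub>m M = L \<oplus>\<^sub>m N" "L \<oplus>\<^sub>m N \<in> fin_borel"
    and "sets L = sets borel" "sets M = sets borel" "sets N = sets borel"
  shows "M = N"
proof (rule measure_eqI)
  fix X assume "X \<in> sets M"
  then have X: "X \<in> sets borel" using assms by simp
  have "emeasure (L \<oplus>\<^sub>m N) X \<noteq> \<infinity>"
    using finite_measure.emeasure_finite[OF fin_borelD(3)[OF assms(2)]] by simp
  then have "emeasure L X \<noteq> \<infinity>" using X assms(3-5) by (auto simp: emeasure_madd)
  moreover have "emeasure L X + emeasure M X = emeasure L X + emeasure N X"
    using assms X by (metis emeasure_madd)
  ultimately show "emeasure M X = emeasure N X" by (simp add: ennreal_add_left_cancel)
qed (use assms in simp)

lemma madd_commute: "M \<oplus>\<^sub>m N = N \<oplus>\<^sub>m M"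
  by (simp add: madd_def add.commute)

context mass_pair
begin

lemma recompose_nu: "nu_plus \<mu> \<nu> \<oplus>\<^sub>m nu_minus \<mu> \<nu> \<oplus>\<^sub>m nu_eq \<mu> \<nu> = \<nu>"
  unfolding nu_eq_swap nu_minus_swap
  using swap.recompose_mu madd_commute[of "nu_plus \<mu> \<nu>" "mu_plus \<nu> \<mu>"]
  by (simp add: mu_minus_swap)

end

section \<open>Gluing plans\<close>

lemma sets_A_plus [measurable]: "A_plus C \<in> sets borel"
  unfolding A_plus_def borel_prod[symmetric]
  by (intro pair_measureI; measurable)

lemma A_minus_eq_swap: "A_minus C = prod.swap -` A_plus C"
  by (auto simp: A_minus_def A_plus_def)

lemma sets_A_minus [measurable]: "A_minus C \<in> sets borel"
  using measurable_sets_borel[OF swap_borel sets_A_plus] unfolding A_minus_eq_swap .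

lemma emeasure_mrestr_mono:
  assumes "sets \<pi> = sets borel" "A \<in> sets borel" "X \<in> sets borel"
  shows "emeasure (mrestr \<pi> A) X \<le> emeasure \<pi> X"
  using assms by (subst emeasure_mrestr) (auto intro: emeasure_mono)

lemma mrestr_fin_borel:
  assumes "\<pi> \<in> fin_borel" "A \<in> sets borel"
  shows "mrestr \<pi> A \<in> fin_borel"
proof -
  interpret finite_measure \<pi> using fin_borelD[OF assms(1)] by simp
  have s: "sets \<pi> = sets borel" "space \<pi> = UNIV" using fin_borelD[OF assms(1)] by auto
  then have "emeasure (mrestr \<pi> A) UNIV \<le> emeasure \<pi> UNIV"
    using assms by (intro emeasure_mrestr_mono) auto
  then have "emeasure (mrestr \<pi> A) UNIV \<noteq> \<infinity>"
    using emeasure_finite[of UNIV] by (auto simp: top_unique)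
  moreover have "space (mrestr \<pi> A) = UNIV"
    using sets_eq_imp_space_eq[of "mrestr \<pi> A" borel] s by simp
  ultimately show ?thesis using s by (auto simp: fin_borel_def intro!: finite_measureI)
qed

lemma mrestr_cyclically_monotone:
  assumes "\<pi> \<in> fin_borel" "cyclically_monotone_measure \<pi>" "A \<in> sets borel"
  shows "cyclically_monotone_measure (mrestr \<pi> A)"
proof (rule cyclically_monotone_measureI)
  note s = fin_borelD(1)[OF assms(1)]
  show "sets (mrestr \<pi> A) = sets borel" using s by simp
  fix t
  show "emeasure (mrestr \<pi> A) (upcross t) = 0 \<or> emeasure (mrestr \<pi> A) (downcross t) = 0"
    using cyclically_monotone_measureD(1)[OF assms(1,2), of t]
      emeasure_mrestr_mono[OF s assms(3) cross_borel(1), of t]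
      emeasure_mrestr_mono[OF s assms(3) cross_borel(2), of t] by auto
qed

text \<open>A point outside the rectangle has a coordinate outside \<open>I\<close> or
  \<open>J\<close>, which is a null event for the corresponding marginal.\<close>

lemma plan_outside_product_null:
  assumes "\<pi> \<in> Marg \<gamma>\<^sub>1 \<gamma>\<^sub>2" "I \<in> sets borel" "J \<in> sets borel"
    and "emeasure \<gamma>\<^sub>1 (- I) = 0" "emeasure \<gamma>\<^sub>2 (- J) = 0"
  shows "emeasure \<pi> (- (I \<times> J)) = 0"
proof -
  have "emeasure \<pi> (fst -` (- I)) = 0" "emeasure \<pi> (snd -` (- J)) = 0"
    using assms MargD(4,5)[OF assms(1)] by auto
  moreover have "- (I \<times> J) = fst -` (- I) \<union> snd -` (- J)" by auto
  moreover have "fst -` (- I) \<in> sets \<pi>" "snd -` (- J) \<in> sets \<pi>"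
    using assms measurable_sets_borel[OF measurable_fst_snd_borel(1)]
      measurable_sets_borel[OF measurable_fst_snd_borel(2)] fin_borelD(1)[OF MargD(1)[OF assms(1)]] by auto
  ultimately show ?thesis
    using emeasure_subadditive[of "fst -` (- I)" \<pi> "snd -` (- J)"] by simp
qed

lemma null_subset:
  assumes "sets \<pi> = sets borel" "emeasure \<pi> (- A) = 0" "A \<in> sets borel" "X \<in> sets borel" "X \<inter> A = {}"
  shows "emeasure \<pi> X = 0"
  using emeasure_mono[of X "- A" \<pi>] assms by auto

lemma msum_concentrated:
  fixes f :: "'i \<Rightarrow> (real \<times> real) measure"
  assumes sets: "\<And>i. i \<in> I \<Longrightarrow> sets (f i) = sets borel"
    and null: "\<And>i. i \<in> I \<Longrightarrow> emeasure (f i) (- A i) = 0"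
    and A: "\<And>i. i \<in> I \<Longrightarrow> A i \<in> sets borel" and X: "X \<in> sets borel"
  shows "\<And>j. j \<in> I \<Longrightarrow> (\<And>i. i \<in> I \<Longrightarrow> i \<noteq> j \<Longrightarrow> X \<inter> A i = {}) \<Longrightarrow> emeasure (msum I f) X = emeasure (f j) X"
    and "(\<And>i. i \<in> I \<Longrightarrow> X \<inter> A i = {}) \<Longrightarrow> emeasure (msum I f) X = 0"
proof -
  have eq: "emeasure (msum I f) X = (\<integral>\<^sup>+i. emeasure (f i) X \<partial>count_space I)"
    using sets X by (rule emeasure_msum)
  have zero: "emeasure (f i) X = 0" if "i \<in> I" "X \<inter> A i = {}" for i
    using sets[OF that(1)] null[OF that(1)] A[OF that(1)] X that(2) by (rule null_subset)
  show "emeasure (msum I f) X = emeasure (f j) X"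
    if j: "j \<in> I" and d: "\<And>i. i \<in> I \<Longrightarrow> i \<noteq> j \<Longrightarrow> X \<inter> A i = {}" for j
  proof -
    have "(\<integral>\<^sup>+i. emeasure (f i) X \<partial>count_space I) = (\<Sum>i\<in>{j}. emeasure (f i) X)"
    proof (rule nn_integral_count_space')
      fix i assume "i \<in> I" "i \<notin> {j}"
      then show "emeasure (f i) X = 0" using zero d by simp
    qed (use j in auto)
    then show ?thesis using eq by simp
  qed
  show "emeasure (msum I f) X = 0" if d: "\<And>i. i \<in> I \<Longrightarrow> X \<inter> A i = {}"
  proof -
    have "(\<integral>\<^sup>+i. emeasure (f i) X \<partial>count_space I) = (\<integral>\<^sup>+i. 0 \<partial>count_space I)"
      using zero d by (intro nn_integral_cong) simp
    then show ?thesis using eq by simp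
  qed
qed

text \<open>With equal marginals every crossing mass is the positive part of 0, and an off-diagonal
  pair crosses some rational threshold.\<close>

lemma CMarg_diagonal:
  assumes "\<pi> \<in> CMarg \<gamma> \<gamma>"
  shows "AE p in \<pi>. fst p = snd p"
proof -
  have s: "sets \<pi> = sets borel" using assms fin_borelD(1)[OF MargD(1)] by (auto simp: CMarg_def)
  have "AE p in \<pi>. \<forall>t\<in>\<rat>. p \<notin> upcross t \<and> p \<notin> downcross t"
    by (intro AE_ball_countable' AE_conjI)
      (auto simp: AE_notin_iff_null[OF s] CMarg_crossings[OF assms] countable_rat)
  then show ?thesis
  proof eventually_elim
    case (elim p)
    show ?case
    proof (rule ccontr)
      assume "fst p \<noteq> snd p"
      then have "min (fst p) (snd p) < max (fst p) (snd p)" by (auto simp: min_def max_def)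
      then obtain t where "t \<in> \<rat>" "min (fst p) (snd p) < t" "t < max (fst p) (snd p)"
        using Rats_dense_in_real by blast
      then show False using elim by (auto simp: upcross_def downcross_def min_def max_def split: if_splits)
    qed
  qed
qed

context mass_pair
begin

lemma sets_A_eq [measurable]: "A_eq \<mu> \<nu> \<in> sets borel"
proof -
  have "A_eq \<mu> \<nu> = fst -` (- Bset \<mu> \<nu> \<inter> E_eq \<mu> \<nu>) \<union> ({p. fst p = snd p} \<inter> fst -` Bset \<mu> \<nu>)"
    by (auto simp: A_eq_def)
  moreover have "closed {p :: real \<times> real. fst p = snd p}"
    by (intro closed_Collect_eq continuous_intros)
  ultimately show ?thesis
    using measurable_sets_borel[OF measurable_fst_snd_borel(1)] by auto
qed

lemma comp_support:
  assumes "C \<in> K_plus \<mu> \<nu>"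
  shows "emeasure (mu_plus_comp \<mu> \<nu> C) (- {x. lend C \<le> ereal x \<and> ereal x < rend C}) = 0"
    and "emeasure (nu_plus_comp \<mu> \<nu> C) (- {x. lend C < ereal x \<and> ereal x \<le> rend C}) = 0"
proof -
  have "C \<inter> - {x. lend C \<le> ereal x \<and> ereal x < rend C} = {}"
    "C \<inter> - {x. lend C < ereal x \<and> ereal x \<le> rend C} = {}"
    using mem_K_plus_iff[OF assms] by auto
  moreover have "- {x. lend C \<le> ereal x \<and> ereal x < rend C} \<in> sets borel"
    "- {x. lend C < ereal x \<and> ereal x \<le> rend C} \<in> sets borel"
    by measurable
  ultimately show "emeasure (mu_plus_comp \<mu> \<nu> C) (- {x. lend C \<le> ereal x \<and> ereal x < rend C}) = 0"
    and "emeasure (nu_plus_comp \<mu> \<nu> C) (- {x. lend C < ereal x \<and> ereal x \<le> rend C}) = 0"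
    using lend_coeff_zero[OF assms, of "- {x. lend C \<le> ereal x \<and> ereal x < rend C}"]
      rend_coeff_zero[OF assms, of "- {x. lend C < ereal x \<and> ereal x \<le> rend C}"] lend_less_rend_K[OF assms]
    by (simp_all add: emeasure_mu_plus_comp[OF assms] emeasure_nu_plus_comp[OF assms])
qed

section \<open>Disjointness of the sets and supports of the plans\<close>

lemma A_plus_disjoint:
  assumes "C \<in> K_plus \<mu> \<nu>" "C' \<in> K_plus \<mu> \<nu>" "C \<noteq> C'"
  shows "A_plus C \<inter> A_plus C' = {}"
  using K_plus_separated[OF assms] by (auto simp: A_plus_def dest: less_le_trans)

text \<open>The half-open factors matter when the two components touch. If \<open>C'\<close> ends
  where \<open>C\<close> begins, the first factors share that point and the second factors are
  disjoint; if \<open>C\<close> ends where \<open>C'\<close> begins, it is the other way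
  round.\<close>

lemma A_plus_A_minus_disjoint:
  assumes "C \<in> K_plus \<mu> \<nu>" "C' \<in> K_plus \<nu> \<mu>"
  shows "A_plus C \<inter> A_minus C' = {}"
  using K_plus_minus_separated[OF assms] by (force simp: A_plus_def A_minus_def)

text \<open>A first coordinate in \<open>A_plus C\<close> lies in \<open>E_plus\<close> or is the
  left endpoint. Over that endpoint \<open>A_eq\<close> contains only the diagonal point, which the
  open lower bound in the second factor excludes.\<close>

lemma A_plus_A_eq_disjoint:
  assumes "C \<in> K_plus \<mu> \<nu>"
  shows "A_plus C \<inter> A_eq \<mu> \<nu> = {}"
proof -
  have "x \<in> E_plus \<mu> \<nu> \<or> lend C = ereal x" if "lend C \<le> ereal x" "ereal x < rend C" for x
    using that mem_K_plus_iff[OF assms, of x] K_plus_subset[OF assms] by (auto simp: order_less_le)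
  then show ?thesis
    using K_plus_end_in_Bset[OF assms] Bset_subset
    by (fastforce simp: A_plus_def A_eq_def E_eq_iff)
qed

lemma A_minus_A_eq_disjoint:
  assumes "C \<in> K_plus \<nu> \<mu>"
  shows "A_minus C \<inter> A_eq \<mu> \<nu> = {}"
proof -
  have "x \<in> E_plus \<nu> \<mu> \<or> rend C = ereal x" if "lend C < ereal x" "ereal x \<le> rend C" for x
    using that swap.mem_K_plus_iff[OF assms, of x] swap.K_plus_subset[OF assms] by (auto simp: order_less_le)
  then show ?thesis
    using swap.K_plus_end_in_Bset[OF assms] Bset_subset Bset_swap[of \<mu> \<nu>]
    by (fastforce simp: A_minus_def A_eq_def E_eq_iff)
qed

text \<open>The difference of the \<open>cdf\<close>s of the two marginals is 0 outside the
  component and that of \<open>\<mu>\<close> and \<open>\<nu>\<close> on it, and it is never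
  negative.\<close>

lemma comp_plan_crossings:
  assumes "C \<in> K_plus \<mu> \<nu>" "\<pi> \<in> CMarg (mu_plus_comp \<mu> \<nu> C) (nu_plus_comp \<mu> \<nu> C)"
  shows "emeasure \<pi> (downcross t) = 0"
    and "cdf \<mu> t \<le> cdf \<nu> t \<Longrightarrow> emeasure \<pi> (upcross t) = 0"
  using comp_cdf_le[OF assms(1), of t] comp_cdf_diff[OF assms(1), of t]
  unfolding CMarg_crossings[OF assms(2)] by (auto simp: ennreal_neg split: if_splits)

lemma comp_plan_support:
  assumes "C \<in> K_plus \<mu> \<nu>" "\<pi> \<in> CMarg (mu_plus_comp \<mu> \<nu> C) (nu_plus_comp \<mu> \<nu> C)"
  shows "emeasure \<pi> (- A_plus C) = 0"
  unfolding A_plus_def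
proof (rule plan_outside_product_null)
  show "\<pi> \<in> Marg (mu_plus_comp \<mu> \<nu> C) (nu_plus_comp \<mu> \<nu> C)" using assms(2) by (simp add: CMarg_def)
qed (use comp_support[OF assms(1)] in auto)

text \<open>Since the marginals coincide, the plan sits on the diagonal; above \<open>E_eq\<close>
  the diagonal lies in \<open>A_eq\<close>, whether or not the point is in
  \<open>Bset\<close>.\<close>

lemma eq_plan_support:
  assumes "\<pi> \<in> CMarg (mu_eq \<mu> \<nu>) (nu_eq \<mu> \<nu>)"
  shows "emeasure \<pi> (- A_eq \<mu> \<nu>) = 0" "emeasure \<pi> (upcross t) = 0" "emeasure \<pi> (downcross t) = 0"
proof -
  note p = assms[unfolded mu_eq_eq_nu_eq[symmetric]]
  show "emeasure \<pi> (upcross t) = 0" "emeasure \<pi> (downcross t) = 0"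
    by (simp_all add: CMarg_crossings[OF p])
  have m: "\<pi> \<in> Marg (mu_eq \<mu> \<nu>) (mu_eq \<mu> \<nu>)" using p by (simp add: CMarg_def)
  have s: "sets \<pi> = sets borel" using MargD(1)[OF m] fin_borelD(1) by blast
  have "emeasure (mu_eq \<mu> \<nu>) (- E_eq \<mu> \<nu>) = 0"
    using Bset_subset by (subst mu_eq_off_Bset) auto
  then have "emeasure \<pi> (fst -` (- E_eq \<mu> \<nu>)) = 0" using MargD(4)[OF m] by simp
  moreover have "fst -` (- E_eq \<mu> \<nu>) \<in> sets (borel :: (real \<times> real) measure)"
    using measurable_sets_borel[OF measurable_fst_snd_borel(1), of "- E_eq \<mu> \<nu>"] by simp
  ultimately have "AE p in \<pi>. p \<notin> fst -` (- E_eq \<mu> \<nu>)"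
    using AE_notin_iff_null[OF s, of "fst -` (- E_eq \<mu> \<nu>)"] by blast
  with CMarg_diagonal[OF p] have "AE p in \<pi>. p \<notin> - A_eq \<mu> \<nu>"
    by eventually_elim (auto simp: A_eq_def)
  then show "emeasure \<pi> (- A_eq \<mu> \<nu>) = 0"
    using AE_notin_iff_null[OF s, of "- A_eq \<mu> \<nu>"] sets_A_eq by (meson sets.compl_sets borel_comp)
qed

end

section \<open>The glued plan and its restrictions\<close>

lemma emeasure_glue:
  assumes "\<And>C. C \<in> K_plus \<mu> \<nu> \<Longrightarrow> sets (\<pi>\<^sub>p C) = sets borel" "\<And>C. C \<in> K_minus \<mu> \<nu> \<Longrightarrow> sets (\<pi>\<^sub>m C) = sets borel"
    and "sets \<pi>\<^sub>e = sets borel" "X \<in> sets borel"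
  shows "emeasure (glue \<mu> \<nu> (\<pi>\<^sub>p, \<pi>\<^sub>m, \<pi>\<^sub>e)) X =
    emeasure (msum (K_plus \<mu> \<nu>) \<pi>\<^sub>p) X + emeasure (msum (K_minus \<mu> \<nu>) \<pi>\<^sub>m) X + emeasure \<pi>\<^sub>e X"
  using assms by (simp add: glue_def emeasure_madd)

lemma sets_glue [simp]: "sets (glue \<mu> \<nu> p) = sets borel"
  by (cases p) (simp add: glue_def)

text \<open>The last summand is left arbitrary so that the formulas also apply to
  \<open>mrestr \<pi> (A_eq \<mu> \<nu>)\<close> before its marginals are known.\<close>

lemma distr_glue:
  assumes "\<And>C. C \<in> K_plus \<mu> \<nu> \<Longrightarrow> \<pi>\<^sub>p C \<in> CMarg (mu_plus_comp \<mu> \<nu> C) (nu_plus_comp \<mu> \<nu> C)"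
    and "\<And>C. C \<in> K_minus \<mu> \<nu> \<Longrightarrow> \<pi>\<^sub>m C \<in> CMarg (mu_minus_comp \<mu> \<nu> C) (nu_minus_comp \<mu> \<nu> C)"
    and "sets \<pi>\<^sub>e = sets borel"
  shows "distr (glue \<mu> \<nu> (\<pi>\<^sub>p, \<pi>\<^sub>m, \<pi>\<^sub>e)) borel fst = mu_plus \<mu> \<nu> \<oplus>\<^sub>m mu_minus \<mu> \<nu> \<oplus>\<^sub>m distr \<pi>\<^sub>e borel fst"
    and "distr (glue \<mu> \<nu> (\<pi>\<^sub>p, \<pi>\<^sub>m, \<pi>\<^sub>e)) borel snd = nu_plus \<mu> \<nu> \<oplus>\<^sub>m nu_minus \<mu> \<nu> \<oplus>\<^sub>m distr \<pi>\<^sub>e borel snd"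
proof -
  have m: "C \<in> K_plus \<mu> \<nu> \<Longrightarrow> \<pi>\<^sub>p C \<in> Marg (mu_plus_comp \<mu> \<nu> C) (nu_plus_comp \<mu> \<nu> C)"
    "C \<in> K_minus \<mu> \<nu> \<Longrightarrow> \<pi>\<^sub>m C \<in> Marg (mu_minus_comp \<mu> \<nu> C) (nu_minus_comp \<mu> \<nu> C)" for C
    using assms(1,2) by (auto simp: CMarg_def)
  have s: "C \<in> K_plus \<mu> \<nu> \<Longrightarrow> sets (\<pi>\<^sub>p C) = sets borel" "C \<in> K_minus \<mu> \<nu> \<Longrightarrow> sets (\<pi>\<^sub>m C) = sets borel" for C
    using m MargD(1) fin_borelD(1) by blast+
  have d: "C \<in> K_plus \<mu> \<nu> \<Longrightarrow> distr (\<pi>\<^sub>p C) borel fst = mu_plus_comp \<mu> \<nu> C"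
    "C \<in> K_plus \<mu> \<nu> \<Longrightarrow> distr (\<pi>\<^sub>p C) borel snd = nu_plus_comp \<mu> \<nu> C"
    "C \<in> K_minus \<mu> \<nu> \<Longrightarrow> distr (\<pi>\<^sub>m C) borel fst = mu_minus_comp \<mu> \<nu> C"
    "C \<in> K_minus \<mu> \<nu> \<Longrightarrow> distr (\<pi>\<^sub>m C) borel snd = nu_minus_comp \<mu> \<nu> C" for C
    using m by (auto simp: Marg_def)
  show "distr (glue \<mu> \<nu> (\<pi>\<^sub>p, \<pi>\<^sub>m, \<pi>\<^sub>e)) borel fst = mu_plus \<mu> \<nu> \<oplus>\<^sub>m mu_minus \<mu> \<nu> \<oplus>\<^sub>m distr \<pi>\<^sub>e borel fst"
    unfolding glue_def mu_plus_def mu_minus_def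
    by (simp add: distr_madd distr_msum s d assms(3) cong: msum_cong)
  show "distr (glue \<mu> \<nu> (\<pi>\<^sub>p, \<pi>\<^sub>m, \<pi>\<^sub>e)) borel snd = nu_plus \<mu> \<nu> \<oplus>\<^sub>m nu_minus \<mu> \<nu> \<oplus>\<^sub>m distr \<pi>\<^sub>e borel snd"
    unfolding glue_def nu_plus_def nu_minus_def
    by (simp add: distr_madd distr_msum s d assms(3) cong: msum_cong)
qed

context mass_pair
begin

text \<open>The plan is not transposed here: its first marginal is
  \<open>nu_plus_comp \<nu> \<mu> C\<close>, so the exchanged facts about the marginals apply, while
  upward and downward trade places.\<close>

lemma minus_comp_plan_crossings:
  assumes "C \<in> K_minus \<mu> \<nu>" "\<pi> \<in> CMarg (mu_minus_comp \<mu> \<nu> C) (nu_minus_comp \<mu> \<nu> C)"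
  shows "emeasure \<pi> (upcross t) = 0"
    and "cdf \<nu> t \<le> cdf \<mu> t \<Longrightarrow> emeasure \<pi> (downcross t) = 0"
    and "emeasure \<pi> (- A_minus C) = 0"
proof -
  have C: "C \<in> K_plus \<nu> \<mu>" using assms(1) by (simp add: K_minus_swap)
  have p: "\<pi> \<in> CMarg (nu_plus_comp \<nu> \<mu> C) (mu_plus_comp \<nu> \<mu> C)"
    using assms(2) by (simp add: mu_minus_comp_swap nu_minus_comp_swap)
  show "emeasure \<pi> (upcross t) = 0" "cdf \<nu> t \<le> cdf \<mu> t \<Longrightarrow> emeasure \<pi> (downcross t) = 0"
    using swap.comp_cdf_le[OF C, of t] swap.comp_cdf_diff[OF C, of t]
    unfolding CMarg_crossings[OF p] by (auto simp: ennreal_neg split: if_splits)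
  show "emeasure \<pi> (- A_minus C) = 0"
    unfolding A_minus_def
  proof (rule plan_outside_product_null)
    show "\<pi> \<in> Marg (nu_plus_comp \<nu> \<mu> C) (mu_plus_comp \<nu> \<mu> C)" using p by (simp add: CMarg_def)
  qed (use swap.comp_support[OF C] in auto)
qed

lemma A_minus_disjoint:
  assumes "C \<in> K_minus \<mu> \<nu>" "C' \<in> K_minus \<mu> \<nu>" "C \<noteq> C'"
  shows "A_minus C \<inter> A_minus C' = {}"
  using swap.A_plus_disjoint[of C C'] assms unfolding K_minus_swap A_minus_eq_swap by blast

text \<open>The candidate for the inverse. The restricted abstractions make the families
  extensional, as membership in \<open>plan_families\<close> requires.\<close>

definition restrictions :: "plan \<Rightarrow> (real set \<Rightarrow> plan) \<times> (real set \<Rightarrow> plan) \<times> plan"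
  where "restrictions \<pi> =
      ((\<lambda>C\<in>K_plus \<mu> \<nu>. mrestr \<pi> (A_plus C)),
       (\<lambda>C\<in>K_minus \<mu> \<nu>. mrestr \<pi> (A_minus C)),
       mrestr \<pi> (A_eq \<mu> \<nu>))"

lemma plan_familiesE:
  assumes "p \<in> plan_families \<mu> \<nu>"
  obtains \<pi>\<^sub>p \<pi>\<^sub>m \<pi>\<^sub>e where "p = (\<pi>\<^sub>p, \<pi>\<^sub>m, \<pi>\<^sub>e)"
    and "\<pi>\<^sub>p \<in> extensional (K_plus \<mu> \<nu>)" "\<pi>\<^sub>m \<in> extensional (K_minus \<mu> \<nu>)"
    and "\<And>C. C \<in> K_plus \<mu> \<nu> \<Longrightarrow> \<pi>\<^sub>p C \<in> CMarg (mu_plus_comp \<mu> \<nu> C) (nu_plus_comp \<mu> \<nu> C)"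
    and "\<And>C. C \<in> K_minus \<mu> \<nu> \<Longrightarrow> \<pi>\<^sub>m C \<in> CMarg (mu_minus_comp \<mu> \<nu> C) (nu_minus_comp \<mu> \<nu> C)"
    and "\<pi>\<^sub>e \<in> CMarg (mu_eq \<mu> \<nu>) (nu_eq \<mu> \<nu>)"
    and "\<And>C. C \<in> K_plus \<mu> \<nu> \<Longrightarrow> sets (\<pi>\<^sub>p C) = sets borel"
    and "\<And>C. C \<in> K_minus \<mu> \<nu> \<Longrightarrow> sets (\<pi>\<^sub>m C) = sets borel"
    and "sets \<pi>\<^sub>e = sets borel"
proof -
  obtain \<pi>\<^sub>p \<pi>\<^sub>m \<pi>\<^sub>e where p: "p = (\<pi>\<^sub>p, \<pi>\<^sub>m, \<pi>\<^sub>e)" by (cases p)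
  have s: "sets \<pi> = sets borel" if "\<pi> \<in> CMarg \<gamma>\<^sub>1 \<gamma>\<^sub>2" for \<pi> \<gamma>\<^sub>1 \<gamma>\<^sub>2
    using that fin_borelD(1)[OF MargD(1)] by (auto simp: CMarg_def)
  show thesis
    using assms unfolding plan_families_def p by (intro that[OF p]) (auto simp: PiE_iff intro!: s)
qed

text \<open>Each summand is monotone, but two of them might cross the same \<open>t\<close> in
  opposite directions. The sign of \<open>cdf \<mu> t - cdf \<nu> t\<close> prevents this: it forces
  the same direction on all summands at once.\<close>

lemma glue_in_CMarg:
  assumes "p \<in> plan_families \<mu> \<nu>"
  shows "glue \<mu> \<nu> p \<in> CMarg \<mu> \<nu>"
  using assms
proof (rule plan_familiesE)
  fix \<pi>\<^sub>p \<pi>\<^sub>m \<pi>\<^sub>e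
  assume p: "p = (\<pi>\<^sub>p, \<pi>\<^sub>m, \<pi>\<^sub>e)"
    and P: "\<And>C. C \<in> K_plus \<mu> \<nu> \<Longrightarrow> \<pi>\<^sub>p C \<in> CMarg (mu_plus_comp \<mu> \<nu> C) (nu_plus_comp \<mu> \<nu> C)"
    and M: "\<And>C. C \<in> K_minus \<mu> \<nu> \<Longrightarrow> \<pi>\<^sub>m C \<in> CMarg (mu_minus_comp \<mu> \<nu> C) (nu_minus_comp \<mu> \<nu> C)"
    and Q: "\<pi>\<^sub>e \<in> CMarg (mu_eq \<mu> \<nu>) (nu_eq \<mu> \<nu>)"
    and sets: "\<And>C. C \<in> K_plus \<mu> \<nu> \<Longrightarrow> sets (\<pi>\<^sub>p C) = sets borel"
      "\<And>C. C \<in> K_minus \<mu> \<nu> \<Longrightarrow> sets (\<pi>\<^sub>m C) = sets borel" "sets \<pi>\<^sub>e = sets borel"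
  let ?\<pi> = "glue \<mu> \<nu> p"
  have fst: "distr ?\<pi> borel fst = \<mu>"
    using distr_glue(1)[OF P M sets(3)] recompose_mu Q by (simp add: p CMarg_def Marg_def)
  have snd: "distr ?\<pi> borel snd = \<nu>"
    using distr_glue(2)[OF P M sets(3)] recompose_nu Q by (simp add: p CMarg_def Marg_def)
  have sp: "space ?\<pi> = UNIV" using sets_eq_imp_space_eq[of ?\<pi> borel] by simp
  have "fst \<in> measurable ?\<pi> borel"
    using measurable_fst_snd_borel(1) by (simp cong: measurable_cong_sets)
  \<comment> \<open>There may be infinitely many summands; finiteness of the sum is read off its
    first marginal.\<close>
  then have "emeasure ?\<pi> UNIV = emeasure \<mu> UNIV"
    using emeasure_distr[of fst ?\<pi> borel UNIV] by (simp add: fst sp)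
  then have "?\<pi> \<in> fin_borel"
    using M.emeasure_finite[of UNIV] sp by (auto simp: fin_borel_def intro!: finite_measureI)
  moreover have "cyclically_monotone_measure ?\<pi>"
  proof (rule cyclically_monotone_measureI)
    fix t
    have eq: "emeasure ?\<pi> X = (\<integral>\<^sup>+C. emeasure (\<pi>\<^sub>p C) X \<partial>count_space (K_plus \<mu> \<nu>)) +
      (\<integral>\<^sup>+C. emeasure (\<pi>\<^sub>m C) X \<partial>count_space (K_minus \<mu> \<nu>)) + emeasure \<pi>\<^sub>e X" if "X \<in> sets borel" for X
      unfolding p using sets that by (simp add: emeasure_glue emeasure_msum)
    have zero: "(\<integral>\<^sup>+i. f i \<partial>count_space I) = 0" if "\<And>i. i \<in> I \<Longrightarrow> f i = 0" for I :: "real set set" and f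
    proof -
      have "(\<integral>\<^sup>+i. f i \<partial>count_space I) = (\<integral>\<^sup>+i. 0 \<partial>count_space I)"
        using that by (intro nn_integral_cong) simp
      then show ?thesis by simp
    qed
    show "emeasure ?\<pi> (upcross t) = 0 \<or> emeasure ?\<pi> (downcross t) = 0"
    proof (cases "cdf \<mu> t \<le> cdf \<nu> t")
      case True
      then have "emeasure ?\<pi> (upcross t) = 0"
        using comp_plan_crossings(2)[OF _ P True] minus_comp_plan_crossings(1)[OF _ M] eq_plan_support(2)[OF Q]
        by (simp add: eq zero)
      then show ?thesis ..
    next
      case False
      then have "emeasure ?\<pi> (downcross t) = 0"
        using comp_plan_crossings(1)[OF _ P] minus_comp_plan_crossings(2)[OF _ M, of _ t] eq_plan_support(3)[OF Q]
        by (simp add: eq zero)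
      then show ?thesis ..
    qed
  qed simp
  ultimately show ?thesis using fst snd by (simp add: CMarg_def Marg_def)
qed

text \<open>Every summand is concentrated on its own set and the sets are disjoint, so restricting
  to one of them isolates one summand. Outside the index sets both families are
  \<open>undefined\<close>.\<close>

lemma restrictions_glue:
  assumes "p \<in> plan_families \<mu> \<nu>"
  shows "restrictions (glue \<mu> \<nu> p) = p"
  using assms
proof (rule plan_familiesE)
  fix \<pi>\<^sub>p \<pi>\<^sub>m \<pi>\<^sub>e
  assume p: "p = (\<pi>\<^sub>p, \<pi>\<^sub>m, \<pi>\<^sub>e)"
    and ext: "\<pi>\<^sub>p \<in> extensional (K_plus \<mu> \<nu>)" "\<pi>\<^sub>m \<in> extensional (K_minus \<mu> \<nu>)"
    and P: "\<And>C. C \<in> K_plus \<mu> \<nu> \<Longrightarrow> \<pi>\<^sub>p C \<in> CMarg (mu_plus_comp \<mu> \<nu> C) (nu_plus_comp \<mu> \<nu> C)"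
    and M: "\<And>C. C \<in> K_minus \<mu> \<nu> \<Longrightarrow> \<pi>\<^sub>m C \<in> CMarg (mu_minus_comp \<mu> \<nu> C) (nu_minus_comp \<mu> \<nu> C)"
    and Q: "\<pi>\<^sub>e \<in> CMarg (mu_eq \<mu> \<nu>) (nu_eq \<mu> \<nu>)"
    and sets: "\<And>C. C \<in> K_plus \<mu> \<nu> \<Longrightarrow> sets (\<pi>\<^sub>p C) = sets borel"
      "\<And>C. C \<in> K_minus \<mu> \<nu> \<Longrightarrow> sets (\<pi>\<^sub>m C) = sets borel" "sets \<pi>\<^sub>e = sets borel"
  let ?\<pi> = "glue \<mu> \<nu> p"
  note eq = emeasure_glue[of \<mu> \<nu> \<pi>\<^sub>p \<pi>\<^sub>m \<pi>\<^sub>e, folded p, OF sets]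
  note nP = comp_plan_support[OF _ P] and nM = minus_comp_plan_crossings(3)[OF _ M]
    and nQ = eq_plan_support(1)[OF Q]
  note cP = msum_concentrated[of "K_plus \<mu> \<nu>" \<pi>\<^sub>p A_plus, OF sets(1) nP sets_A_plus]
  note cM = msum_concentrated[of "K_minus \<mu> \<nu>" \<pi>\<^sub>m A_minus, OF sets(2) nM sets_A_minus]
  note cQ = null_subset[OF sets(3) nQ sets_A_eq]
  have dPM: "A_plus C \<inter> A_minus C' = {}" if "C \<in> K_plus \<mu> \<nu>" "C' \<in> K_minus \<mu> \<nu>" for C C'
    using A_plus_A_minus_disjoint that by (simp add: K_minus_swap)
  have dMQ: "A_minus C \<inter> A_eq \<mu> \<nu> = {}" if "C \<in> K_minus \<mu> \<nu>" for C
    using A_minus_A_eq_disjoint that by (simp add: K_minus_swap)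
  have split: "emeasure \<pi> X = emeasure \<pi> (A \<inter> X)"
    if "sets \<pi> = sets borel" "emeasure \<pi> (- A) = 0" "A \<in> sets borel" "X \<in> sets borel"
    for \<pi> :: plan and A X
  proof -
    have "AE p in \<pi>. p \<notin> - A" using AE_notin_iff_null[OF that(1), of "- A"] that by (meson borel_comp)
    then have "AE p in \<pi>. p \<in> X \<longleftrightarrow> p \<in> A \<inter> X" by eventually_elim auto
    then show ?thesis using that by (intro emeasure_eq_AE) auto
  qed
  have "mrestr ?\<pi> (A_plus C) = \<pi>\<^sub>p C" if C: "C \<in> K_plus \<mu> \<nu>" for C
  proof (rule measure_eqI)
    fix X assume "X \<in> sets (mrestr ?\<pi> (A_plus C))"
    then have X: "X \<in> sets borel" "A_plus C \<inter> X \<in> sets borel" by auto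
    have "emeasure (msum (K_plus \<mu> \<nu>) \<pi>\<^sub>p) (A_plus C \<inter> X) = emeasure (\<pi>\<^sub>p C) (A_plus C \<inter> X)"
      using A_plus_disjoint C by (intro cP(1) X C) blast+
    moreover have "emeasure (msum (K_minus \<mu> \<nu>) \<pi>\<^sub>m) (A_plus C \<inter> X) = 0"
      using dPM[OF C] by (intro cM(2) X) blast+
    moreover have "emeasure \<pi>\<^sub>e (A_plus C \<inter> X) = 0"
      using A_plus_A_eq_disjoint[OF C] by (intro cQ X) blast
    ultimately show "emeasure (mrestr ?\<pi> (A_plus C)) X = emeasure (\<pi>\<^sub>p C) X"
      using C X split[OF sets(1)[OF C] nP[OF C] sets_A_plus X(1)] by (simp add: emeasure_mrestr eq)
  qed (simp add: sets C)
  moreover have "mrestr ?\<pi> (A_minus C) = \<pi>\<^sub>m C" if C: "C \<in> K_minus \<mu> \<nu>" for C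
  proof (rule measure_eqI)
    fix X assume "X \<in> sets (mrestr ?\<pi> (A_minus C))"
    then have X: "X \<in> sets borel" "A_minus C \<inter> X \<in> sets borel" by auto
    have "emeasure (msum (K_minus \<mu> \<nu>) \<pi>\<^sub>m) (A_minus C \<inter> X) = emeasure (\<pi>\<^sub>m C) (A_minus C \<inter> X)"
      using A_minus_disjoint C by (intro cM(1) X C) blast+
    moreover have "emeasure (msum (K_plus \<mu> \<nu>) \<pi>\<^sub>p) (A_minus C \<inter> X) = 0"
      using dPM[OF _ C] by (intro cP(2) X) blast+
    moreover have "emeasure \<pi>\<^sub>e (A_minus C \<inter> X) = 0"
      using dMQ[OF C] by (intro cQ X) blast
    ultimately show "emeasure (mrestr ?\<pi> (A_minus C)) X = emeasure (\<pi>\<^sub>m C) X"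
      using C X split[OF sets(2)[OF C] nM[OF C] sets_A_minus X(1)] by (simp add: emeasure_mrestr eq)
  qed (simp add: sets C)
  moreover have "mrestr ?\<pi> (A_eq \<mu> \<nu>) = \<pi>\<^sub>e"
  proof (rule measure_eqI)
    fix X assume "X \<in> sets (mrestr ?\<pi> (A_eq \<mu> \<nu>))"
    then have X: "X \<in> sets borel" "A_eq \<mu> \<nu> \<inter> X \<in> sets borel" by auto
    have "emeasure (msum (K_plus \<mu> \<nu>) \<pi>\<^sub>p) (A_eq \<mu> \<nu> \<inter> X) = 0"
      using A_plus_A_eq_disjoint by (intro cP(2) X) blast+
    moreover have "emeasure (msum (K_minus \<mu> \<nu>) \<pi>\<^sub>m) (A_eq \<mu> \<nu> \<inter> X) = 0"
      using dMQ by (intro cM(2) X) blast+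
    ultimately show "emeasure (mrestr ?\<pi> (A_eq \<mu> \<nu>)) X = emeasure \<pi>\<^sub>e X"
      using X split[OF sets(3) nQ sets_A_eq X(1)] by (simp add: emeasure_mrestr eq)
  qed (simp add: sets)
  ultimately show ?thesis
    using ext by (auto simp: restrictions_def p fun_eq_iff extensional_def)
qed

end

section \<open>Decomposing a plan\<close>

context mass_pair
begin

text \<open>At a point \<open>t\<close> outside \<open>E_plus\<close> one of the two strict
  inequalities fails, so \<open>upcross t\<close> or \<open>upcross_left t\<close> is null. An
  upward segment with \<open>t\<close> in its open interior belongs to both.\<close>

lemma plan_segment_AE:
  assumes "\<pi> \<in> CMarg \<mu> \<nu>"
  shows "AE p in \<pi>. {fst p<..<snd p} \<subseteq> E_plus \<mu> \<nu>"
proof -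
  have s: "sets \<pi> = sets borel" using assms fin_borelD(1)[OF MargD(1)] by (auto simp: CMarg_def)
  \<comment> \<open>The exceptional null sets can be united over countably many \<open>t\<close>
    only. A dense \<open>T\<close> is enough, because an open segment that misses \<open>T\<close>
    also misses its closure.\<close>
  obtain T where T: "countable T" "T \<subseteq> - E_plus \<mu> \<nu>" "- E_plus \<mu> \<nu> \<subseteq> closure T"
    using separable by blast
  have "AE p in \<pi>. t \<notin> {fst p<..<snd p}" if "t \<in> T" for t
  proof -
    have "cdf \<mu> t \<le> cdf \<nu> t \<or> cdf_left \<mu> t \<le> cdf_left \<nu> t"
      using that T(2) by (auto simp: E_plus_def)
    then have "(AE p in \<pi>. p \<notin> upcross t) \<or> (AE p in \<pi>. p \<notin> upcross_left t)"
      by (auto simp: AE_notin_iff_null[OF s] CMarg_crossings[OF assms] ennreal_neg)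
    then show ?thesis
    proof
      assume "AE p in \<pi>. p \<notin> upcross t"
      then show ?thesis by eventually_elim (auto simp: upcross_def)
    next
      assume "AE p in \<pi>. p \<notin> upcross_left t"
      then show ?thesis by eventually_elim (auto simp: upcross_left_def)
    qed
  qed
  then have "AE p in \<pi>. \<forall>t\<in>T. t \<notin> {fst p<..<snd p}"
    using T(1) by (intro AE_ball_countable') auto
  then show ?thesis
  proof eventually_elim
    case (elim p)
    then have "{fst p<..<snd p} \<inter> T = {}" by blast
    then have "{fst p<..<snd p} \<inter> closure T = {}"
      using open_Int_closure_eq_empty[OF open_greaterThanLessThan] by blast
    then show ?case using T(3) by blast
  qed
qed

end

context mass_pair
begin

lemma plan_segment_down_AE:
  assumes "\<pi> \<in> CMarg \<mu> \<nu>"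
  shows "AE p in \<pi>. {snd p<..<fst p} \<subseteq> E_plus \<nu> \<mu>"
proof -
  have "sets \<pi> = sets borel" using assms fin_borelD(1)[OF MargD(1)] by (auto simp: CMarg_def)
  then have "prod.swap \<in> measurable \<pi> borel" using swap_borel by (simp cong: measurable_cong_sets)
  from AE_distrD[OF this swap.plan_segment_AE[OF CMarg_swap[OF assms]]] show ?thesis by simp
qed

lemma plan_support_AE:
  assumes "\<pi> \<in> CMarg \<mu> \<nu>"
  shows "AE p in \<pi>. p \<in> (\<Union>C\<in>K_plus \<mu> \<nu>. A_plus C) \<union> (\<Union>C\<in>K_minus \<mu> \<nu>. A_minus C) \<union> A_eq \<mu> \<nu>"
  using plan_segment_AE[OF assms] plan_segment_down_AE[OF assms]
proof eventually_elim
  case (elim p)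
  consider "fst p < snd p" | "snd p < fst p" | "fst p = snd p" by linarith
  then show ?case
  proof cases
    case 1
    from segment_in_component[OF open_E_plus 1 elim(1)] obtain C
      where C: "C \<in> K_plus \<mu> \<nu>" "lend C \<le> ereal (fst p)" "ereal (snd p) \<le> rend C"
      by (metis K_plus_def)
    then have "p \<in> A_plus C"
      using 1 le_less_trans[OF C(2), of "ereal (snd p)"] less_le_trans[OF _ C(3), of "ereal (fst p)"]
      by (cases p) (auto simp: A_plus_def)
    with C(1) show ?thesis by blast
  next
    case 2
    from segment_in_component[OF swap.open_E_plus 2 elim(2)] obtain C
      where C: "C \<in> K_plus \<nu> \<mu>" "lend C \<le> ereal (snd p)" "ereal (fst p) \<le> rend C"
      by (metis K_plus_def)
    then have "p \<in> A_minus C"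
      using 2 le_less_trans[OF C(2), of "ereal (fst p)"] less_le_trans[OF _ C(3), of "ereal (snd p)"]
      by (cases p) (auto simp: A_minus_def)
    with C(1) show ?thesis by (auto simp: K_minus_swap)
  next
    case 3
    then obtain x where p: "p = (x, x)" by (cases p) auto
    \<comment> \<open>Mass at rest is not reserved for \<open>A_eq\<close>: over E^+ and E^- it goes
      to the set of the surrounding component.\<close>
    consider "x \<in> E_plus \<mu> \<nu>" | "x \<in> E_plus \<nu> \<mu>" | "x \<in> E_eq \<mu> \<nu>"
      by (auto simp: E_eq_iff)
    then show ?thesis
    proof cases
      case 1
      then obtain C where C: "C \<in> K_plus \<mu> \<nu>" "x \<in> C" using Union_K_plus by blast
      then have "p \<in> A_plus C" by (auto simp: mem_K_plus_iff p A_plus_def)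
      with C(1) show ?thesis by blast
    next
      case 2
      then obtain C where C: "C \<in> K_plus \<nu> \<mu>" "x \<in> C" using swap.Union_K_plus by blast
      then have "p \<in> A_minus C" by (auto simp: swap.mem_K_plus_iff p A_minus_def)
      with C(1) show ?thesis by (auto simp: K_minus_swap)
    next
      case 3
      then show ?thesis by (auto simp: p A_eq_def)
    qed
  qed
qed

text \<open>Off \<open>Bset\<close> the definition of \<open>A_eq\<close> leaves the second
  coordinate free. But mass that moves starts in a component or at one of its endpoints, and this
  puts its first coordinate into E^+, E^- or \<open>Bset\<close>.\<close>

lemma plan_A_eq_diagonal_AE:
  assumes "\<pi> \<in> CMarg \<mu> \<nu>"
  shows "AE p in \<pi>. p \<in> A_eq \<mu> \<nu> \<longrightarrow> fst p = snd p"
  using plan_segment_AE[OF assms] plan_segment_down_AE[OF assms]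
proof eventually_elim
  case (elim p)
  show ?case
  proof (rule impI, rule ccontr)
    assume p: "p \<in> A_eq \<mu> \<nu>" "fst p \<noteq> snd p"
    then have x: "fst p \<in> E_eq \<mu> \<nu>" "fst p \<notin> Bset \<mu> \<nu>" by (auto simp: A_eq_def)
    consider "fst p < snd p" | "snd p < fst p" using p(2) by linarith
    then show False
    proof cases
      case 1
      from segment_in_component[OF open_E_plus 1 elim(1)] obtain C
        where C: "C \<in> K_plus \<mu> \<nu>" "lend C \<le> ereal (fst p)" "ereal (snd p) \<le> rend C"
        by (metis K_plus_def)
      have "fst p \<in> C \<or> lend C = ereal (fst p)"
        using C 1 less_le_trans[OF _ C(3), of "ereal (fst p)"] by (auto simp: mem_K_plus_iff order_less_le)
      then show False using x C(1) K_plus_subset K_plus_end_in_Bset by (auto simp: E_eq_iff)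
    next
      case 2
      from segment_in_component[OF swap.open_E_plus 2 elim(2)] obtain C
        where C: "C \<in> K_plus \<nu> \<mu>" "lend C \<le> ereal (snd p)" "ereal (fst p) \<le> rend C"
        by (metis K_plus_def)
      have "fst p \<in> C \<or> rend C = ereal (fst p)"
        using C 2 le_less_trans[OF C(2), of "ereal (fst p)"] by (auto simp: swap.mem_K_plus_iff order_less_le)
      then show False using x C(1) swap.K_plus_subset swap.K_plus_end_in_Bset Bset_swap[of \<mu> \<nu>]
        by (auto simp: E_eq_iff)
    qed
  qed
qed

text \<open>Only the sets matter here: they are countably many, disjoint, and carry almost all of
  \<open>\<pi>\<close>. The marginals of the restrictions do not enter, so the identity is available
  for computing the last of them.\<close>

lemma glue_restrictions:
  assumes "\<pi> \<in> CMarg \<mu> \<nu>"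
  shows "glue \<mu> \<nu> (restrictions \<pi>) = \<pi>"
proof (rule measure_eqI)
  have s: "sets \<pi> = sets borel" using assms fin_borelD(1)[OF MargD(1)] by (auto simp: CMarg_def)
  then show "sets (glue \<mu> \<nu> (restrictions \<pi>)) = sets \<pi>" by simp
  fix X assume "X \<in> sets (glue \<mu> \<nu> (restrictions \<pi>))"
  then have X: "X \<in> sets borel" by simp
  let ?P = "\<Union>C\<in>K_plus \<mu> \<nu>. A_plus C \<inter> X" and ?M = "\<Union>C\<in>K_minus \<mu> \<nu>. A_minus C \<inter> X" and ?Q = "A_eq \<mu> \<nu> \<inter> X"
  have cK: "countable (K_plus \<mu> \<nu>)" "countable (K_minus \<mu> \<nu>)"
    using countable_K_plus swap.countable_K_plus by (auto simp: K_minus_swap)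
  have m: "?P \<in> sets \<pi>" "?M \<in> sets \<pi>" "?Q \<in> sets \<pi>"
    unfolding s
    by (rule sets.countable_UN''[OF cK(1)] sets.countable_UN''[OF cK(2)] sets.Int sets_A_plus sets_A_minus sets_A_eq X)+
  have d1: "disjoint_family_on (\<lambda>C. A_plus C \<inter> X) (K_plus \<mu> \<nu>)"
    unfolding disjoint_family_on_def using A_plus_disjoint by blast
  have d2: "disjoint_family_on (\<lambda>C. A_minus C \<inter> X) (K_minus \<mu> \<nu>)"
    unfolding disjoint_family_on_def using A_minus_disjoint by blast
  have d3: "?P \<inter> ?M = {}" using A_plus_A_minus_disjoint unfolding K_minus_swap by blast
  have "?P \<inter> ?Q = {}" using A_plus_A_eq_disjoint by blast
  moreover have "?M \<inter> ?Q = {}" using A_minus_A_eq_disjoint unfolding K_minus_swap by blast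
  ultimately have d4: "(?P \<union> ?M) \<inter> ?Q = {}" by blast
  have "emeasure (glue \<mu> \<nu> (restrictions \<pi>)) X =
      (\<integral>\<^sup>+C. emeasure (mrestr \<pi> (A_plus C)) X \<partial>count_space (K_plus \<mu> \<nu>)) +
      (\<integral>\<^sup>+C. emeasure (mrestr \<pi> (A_minus C)) X \<partial>count_space (K_minus \<mu> \<nu>)) + emeasure (mrestr \<pi> (A_eq \<mu> \<nu>)) X"
    unfolding restrictions_def using s X
    by (subst emeasure_glue) (auto simp: emeasure_msum intro!: arg_cong2[where f="(+)"] nn_integral_cong)
  also have "\<dots> = (\<integral>\<^sup>+C. emeasure \<pi> (A_plus C \<inter> X) \<partial>count_space (K_plus \<mu> \<nu>)) +
      (\<integral>\<^sup>+C. emeasure \<pi> (A_minus C \<inter> X) \<partial>count_space (K_minus \<mu> \<nu>)) + emeasure \<pi> ?Q"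
    using s X by (simp add: emeasure_mrestr)
  also have "(\<integral>\<^sup>+C. emeasure \<pi> (A_plus C \<inter> X) \<partial>count_space (K_plus \<mu> \<nu>)) = emeasure \<pi> ?P"
    using s X cK d1 by (intro emeasure_UN_countable[symmetric]) auto
  also have "(\<integral>\<^sup>+C. emeasure \<pi> (A_minus C \<inter> X) \<partial>count_space (K_minus \<mu> \<nu>)) = emeasure \<pi> ?M"
    using s X cK d2 by (intro emeasure_UN_countable[symmetric]) auto
  also have "emeasure \<pi> ?P + emeasure \<pi> ?M = emeasure \<pi> (?P \<union> ?M)"
    using m(1,2) d3 by (rule plus_emeasure)
  also have "emeasure \<pi> (?P \<union> ?M) + emeasure \<pi> ?Q = emeasure \<pi> (?P \<union> ?M \<union> ?Q)"
    using sets.Un[OF m(1,2)] m(3) d4 by (rule plus_emeasure)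
  also have "\<dots> = emeasure \<pi> X"
  proof (rule emeasure_eq_AE)
    show "AE p in \<pi>. p \<in> ?P \<union> ?M \<union> ?Q \<longleftrightarrow> p \<in> X"
      using plan_support_AE[OF assms] by eventually_elim blast
  qed (use m s X in auto)
  finally show "emeasure (glue \<mu> \<nu> (restrictions \<pi>)) X = emeasure \<pi> X" .
qed

text \<open>Restricting to \<open>A_plus C\<close> loses no mass above \<open>C\<close> in either
  marginal: the other sets meet neither the vertical nor the horizontal strip over \<open>C\<close>,
  except for \<open>A_eq\<close> off the diagonal, which is null.\<close>

lemma plan_over_component_AE:
  assumes "\<pi> \<in> CMarg \<mu> \<nu>" "C \<in> K_plus \<mu> \<nu>"
  shows "AE p in \<pi>. fst p \<in> C \<or> snd p \<in> C \<longrightarrow> p \<in> A_plus C"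
  using plan_support_AE[OF assms(1)] plan_A_eq_diagonal_AE[OF assms(1)]
proof eventually_elim
  case (elim p)
  obtain x y where p: "p = (x, y)" by (cases p)
  show ?case
  proof
    assume "fst p \<in> C \<or> snd p \<in> C"
    then have xy: "(lend C < ereal x \<and> ereal x < rend C) \<or> (lend C < ereal y \<and> ereal y < rend C)"
      by (simp add: p mem_K_plus_iff[OF assms(2)])
    from elim(1) show "p \<in> A_plus C"
    proof (elim UnE UN_E)
      fix C' assume C': "C' \<in> K_plus \<mu> \<nu>" "p \<in> A_plus C'"
      show ?thesis
      proof (cases "C' = C")
        case False
        then show ?thesis
          using K_plus_separated[OF C'(1) assms(2)] C'(2) xy by (force simp: p A_plus_def)
      qed (use C' in simp)
    next
      fix C' assume C': "C' \<in> K_minus \<mu> \<nu>" "p \<in> A_minus C'"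
      then show ?thesis
        using K_plus_minus_separated[OF assms(2), of C'] xy by (force simp: p A_minus_def K_minus_swap)
    next
      assume q: "p \<in> A_eq \<mu> \<nu>"
      then have "x = y" "x \<in> E_eq \<mu> \<nu>" using elim(2) Bset_subset by (auto simp: p A_eq_def)
      then show ?thesis
        using xy mem_K_plus_iff[OF assms(2), of x] K_plus_subset[OF assms(2)] by (auto simp: E_eq_iff)
    qed
  qed
qed

text \<open>This is where the weight at the left endpoint arises. Mass crossing \<open>a\<close>
  upwards cannot start before \<open>a\<close> and cannot go beyond the right endpoint, since
  neither endpoint lies in \<open>E_plus\<close>.\<close>

lemma plan_lend_AE:
  assumes "\<pi> \<in> CMarg \<mu> \<nu>" "C \<in> K_plus \<mu> \<nu>" "lend C = ereal a"
  shows "AE p in \<pi>. p \<in> A_plus C \<and> fst p = a \<longleftrightarrow> p \<in> upcross a"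
  using plan_segment_AE[OF assms(1)]
proof eventually_elim
  case (elim p)
  obtain x y where p: "p = (x, y)" by (cases p)
  have a: "a \<notin> E_plus \<mu> \<nu>" using K_plus_end_E_eq[OF assms(2), of a] assms(3) by (simp add: E_eq_iff)
  show ?case
  proof
    assume "p \<in> A_plus C \<and> fst p = a"
    then show "p \<in> upcross a" using assms(3) by (auto simp: p A_plus_def upcross_def)
  next
    assume up: "p \<in> upcross a"
    then have "x \<le> a" "a < y" by (auto simp: p upcross_def)
    moreover have "x \<ge> a" using elim a \<open>a < y\<close> by (force simp: p)
    ultimately have x: "x = a" by simp
    have "ereal y \<le> rend C"
    proof (rule ccontr)
      assume "\<not> ?thesis"
      then obtain b where b: "rend C = ereal b" "b < y"
        using lend_less_rend_K[OF assms(2)] by (cases "rend C") auto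
      \<comment> \<open>Now \<open>b\<close> would lie in the open segment from \<open>a\<close> to
        \<open>y\<close>, hence in \<open>E_plus\<close>.\<close>
      have "a < b" using lend_less_rend_K[OF assms(2)] assms(3) b(1) by simp
      then have "b \<in> E_plus \<mu> \<nu>" using elim b(2) x by (auto simp: p)
      then show False using K_plus_end_E_eq[OF assms(2), of b] b(1) by (simp add: E_eq_iff)
    qed
    then show "p \<in> A_plus C \<and> fst p = a"
      using x \<open>a < y\<close> assms(3) lend_less_rend_K[OF assms(2)] by (auto simp: p A_plus_def)
  qed
qed

text \<open>Mass arriving at \<open>b\<close> crosses it only when \<open>b\<close> counts as the
  upper side, hence \<open>upcross_left\<close> and the weight in terms of
  \<open>cdf_left\<close>.\<close>

lemma plan_rend_AE:
  assumes "\<pi> \<in> CMarg \<mu> \<nu>" "C \<in> K_plus \<mu> \<nu>" "rend C = ereal b"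
  shows "AE p in \<pi>. p \<in> A_plus C \<and> snd p = b \<longleftrightarrow> p \<in> upcross_left b"
  using plan_segment_AE[OF assms(1)]
proof eventually_elim
  case (elim p)
  obtain x y where p: "p = (x, y)" by (cases p)
  have b: "b \<notin> E_plus \<mu> \<nu>" using K_plus_end_E_eq[OF assms(2), of b] assms(3) by (simp add: E_eq_iff)
  show ?case
  proof
    assume "p \<in> A_plus C \<and> snd p = b"
    then show "p \<in> upcross_left b" using assms(3) by (auto simp: p A_plus_def upcross_left_def)
  next
    assume up: "p \<in> upcross_left b"
    then have "x < b" "b \<le> y" by (auto simp: p upcross_left_def)
    moreover have "y \<le> b" using elim b \<open>x < b\<close> by (force simp: p)
    ultimately have y: "y = b" by simp
    have "lend C \<le> ereal x"
    proof (rule ccontr)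
      assume "\<not> ?thesis"
      then obtain a where a: "lend C = ereal a" "x < a"
        using lend_less_rend_K[OF assms(2)] by (cases "lend C") auto
      have "a < b" using lend_less_rend_K[OF assms(2)] assms(3) a(1) by simp
      then have "a \<in> E_plus \<mu> \<nu>" using elim a(2) y by (auto simp: p)
      then show False using K_plus_end_E_eq[OF assms(2), of a] a(1) by (simp add: E_eq_iff)
    qed
    then show "p \<in> A_plus C \<and> snd p = b"
      using y \<open>x < b\<close> assms(3) lend_less_rend_K[OF assms(2)] by (auto simp: p A_plus_def)
  qed
qed

end

section \<open>Restrictions as plans between the components\<close>

context mass_pair
begin

text \<open>\<open>X\<close> is split along \<open>C\<close>. Above \<open>C\<close> the restriction
  keeps the whole marginal of \<open>\<pi>\<close>; above the rest of \<open>X\<close> the set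
  \<open>A_plus C\<close> leaves only one endpoint, whose mass is a crossing mass.\<close>

lemma restricted_plan_marginals:
  assumes "\<pi> \<in> CMarg \<mu> \<nu>" "C \<in> K_plus \<mu> \<nu>" "X \<in> sets borel"
  shows "emeasure \<pi> (A_plus C \<inter> fst -` X) = emeasure (mu_plus_comp \<mu> \<nu> C) X"
    and "emeasure \<pi> (A_plus C \<inter> snd -` X) = emeasure (nu_plus_comp \<mu> \<nu> C) X"
proof -
  have pi: "\<pi> \<in> Marg \<mu> \<nu>" using assms(1) by (simp add: CMarg_def)
  note s = fin_borelD(1)[OF MargD(1)[OF pi]]
  have XC: "C \<inter> X \<in> sets borel" "X - C \<in> sets borel" using assms(3) K_plus_borel[OF assms(2)] by auto
  note vf = measurable_sets_borel[OF measurable_fst_snd_borel(1)]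
    and vs = measurable_sets_borel[OF measurable_fst_snd_borel(2)]
  note ae = plan_over_component_AE[OF assms(1,2)]
  have inA: "lend C < ereal x \<Longrightarrow> x \<notin> C \<Longrightarrow> ereal x \<le> rend C \<Longrightarrow> rend C = ereal x"
    "ereal x < rend C \<Longrightarrow> x \<notin> C \<Longrightarrow> lend C \<le> ereal x \<Longrightarrow> lend C = ereal x" for x
    using mem_K_plus_iff[OF assms(2), of x] by (auto simp: order_less_le)
  have endC: "lend C = ereal x \<Longrightarrow> x \<notin> C" "rend C = ereal x \<Longrightarrow> x \<notin> C" for x
    using mem_K_plus_iff[OF assms(2), of x] by auto
  show "emeasure \<pi> (A_plus C \<inter> fst -` X) = emeasure (mu_plus_comp \<mu> \<nu> C) X"
  proof -
    have "emeasure \<pi> (A_plus C \<inter> fst -` (C \<inter> X)) = emeasure \<pi> (fst -` (C \<inter> X))"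
    proof (rule emeasure_eq_AE)
      show "AE p in \<pi>. p \<in> A_plus C \<inter> fst -` (C \<inter> X) \<longleftrightarrow> p \<in> fst -` (C \<inter> X)"
        using ae by eventually_elim blast
    qed (use s vf[OF XC(1)] in auto)
    also have "\<dots> = emeasure \<mu> (C \<inter> X)" using MargD(4)[OF pi XC(1)] by simp
    finally have 1: "emeasure \<pi> (A_plus C \<inter> fst -` (C \<inter> X)) = emeasure \<mu> (C \<inter> X)" .
    have 2: "emeasure \<pi> (A_plus C \<inter> fst -` (X - C)) =
      ennreal (ecdf \<mu> (lend C) - ecdf \<nu> (lend C)) * indicator X (real_of_ereal (lend C))"
    proof (cases "\<exists>a\<in>X. lend C = ereal a")
      case True
      then obtain a where a: "a \<in> X" "lend C = ereal a" by blast
      have "emeasure \<pi> (A_plus C \<inter> fst -` (X - C)) = emeasure \<pi> (upcross a)"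
      proof (rule emeasure_eq_AE)
        have "p \<in> A_plus C \<inter> fst -` (X - C) \<longleftrightarrow> p \<in> A_plus C \<and> fst p = a" for p
          using a endC(1)[OF a(2)] inA(2)[of "fst p"] by (auto simp: A_plus_def)
        then show "AE p in \<pi>. p \<in> A_plus C \<inter> fst -` (X - C) \<longleftrightarrow> p \<in> upcross a"
          using plan_lend_AE[OF assms(1,2) a(2)] by simp
      qed (use s vf[OF XC(2)] in auto)
      then show ?thesis using a by (simp add: CMarg_crossings[OF assms(1)])
    next
      case False
      then have e: "A_plus C \<inter> fst -` (X - C) = {}"
        using inA(2) by (fastforce simp: A_plus_def)
      show ?thesis unfolding e using False by (subst lend_coeff_zero[OF assms(2)]) auto
    qed
    have "A_plus C \<inter> fst -` X = (A_plus C \<inter> fst -` (C \<inter> X)) \<union> (A_plus C \<inter> fst -` (X - C))" by auto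
    moreover have "emeasure \<pi> (A_plus C \<inter> fst -` (C \<inter> X)) + emeasure \<pi> (A_plus C \<inter> fst -` (X - C)) =
        emeasure \<pi> ((A_plus C \<inter> fst -` (C \<inter> X)) \<union> (A_plus C \<inter> fst -` (X - C)))"
      using s vf[OF XC(1)] vf[OF XC(2)] by (intro plus_emeasure) auto
    ultimately show ?thesis
      unfolding emeasure_mu_plus_comp[OF assms(2,3)] using 1 2 by (metis add.commute)
  qed
  show "emeasure \<pi> (A_plus C \<inter> snd -` X) = emeasure (nu_plus_comp \<mu> \<nu> C) X"
  proof -
    have "emeasure \<pi> (A_plus C \<inter> snd -` (C \<inter> X)) = emeasure \<pi> (snd -` (C \<inter> X))"
    proof (rule emeasure_eq_AE)
      show "AE p in \<pi>. p \<in> A_plus C \<inter> snd -` (C \<inter> X) \<longleftrightarrow> p \<in> snd -` (C \<inter> X)"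
        using ae by eventually_elim blast
    qed (use s vs[OF XC(1)] in auto)
    also have "\<dots> = emeasure \<nu> (C \<inter> X)" using MargD(5)[OF pi XC(1)] by simp
    finally have 1: "emeasure \<pi> (A_plus C \<inter> snd -` (C \<inter> X)) = emeasure \<nu> (C \<inter> X)" .
    have 2: "emeasure \<pi> (A_plus C \<inter> snd -` (X - C)) =
      ennreal (ecdf_left \<mu> (rend C) - ecdf_left \<nu> (rend C)) * indicator X (real_of_ereal (rend C))"
    proof (cases "\<exists>b\<in>X. rend C = ereal b")
      case True
      then obtain b where b: "b \<in> X" "rend C = ereal b" by blast
      have "emeasure \<pi> (A_plus C \<inter> snd -` (X - C)) = emeasure \<pi> (upcross_left b)"
      proof (rule emeasure_eq_AE)
        have "p \<in> A_plus C \<inter> snd -` (X - C) \<longleftrightarrow> p \<in> A_plus C \<and> snd p = b" for p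
          using b endC(2)[OF b(2)] inA(1)[of "snd p"] by (auto simp: A_plus_def)
        then show "AE p in \<pi>. p \<in> A_plus C \<inter> snd -` (X - C) \<longleftrightarrow> p \<in> upcross_left b"
          using plan_rend_AE[OF assms(1,2) b(2)] by simp
      qed (use s vs[OF XC(2)] in auto)
      then show ?thesis using b by (simp add: CMarg_crossings[OF assms(1)])
    next
      case False
      then have e: "A_plus C \<inter> snd -` (X - C) = {}"
        using inA(1) by (fastforce simp: A_plus_def)
      show ?thesis unfolding e using False by (subst rend_coeff_zero[OF assms(2)]) auto
    qed
    have "A_plus C \<inter> snd -` X = (A_plus C \<inter> snd -` (C \<inter> X)) \<union> (A_plus C \<inter> snd -` (X - C))" by auto
    moreover have "emeasure \<pi> (A_plus C \<inter> snd -` (C \<inter> X)) + emeasure \<pi> (A_plus C \<inter> snd -` (X - C)) =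
        emeasure \<pi> ((A_plus C \<inter> snd -` (C \<inter> X)) \<union> (A_plus C \<inter> snd -` (X - C)))"
      using s vs[OF XC(1)] vs[OF XC(2)] by (intro plus_emeasure) auto
    ultimately show ?thesis
      unfolding emeasure_nu_plus_comp[OF assms(2,3)] using 1 2 by metis
  qed
qed

lemma mrestr_A_plus_CMarg:
  assumes "\<pi> \<in> CMarg \<mu> \<nu>" "C \<in> K_plus \<mu> \<nu>"
  shows "mrestr \<pi> (A_plus C) \<in> CMarg (mu_plus_comp \<mu> \<nu> C) (nu_plus_comp \<mu> \<nu> C)"
proof -
  have pi: "\<pi> \<in> Marg \<mu> \<nu>" "cyclically_monotone_measure \<pi>" using assms(1) by (simp_all add: CMarg_def)
  note f = MargD(1)[OF pi(1)]
  note s = fin_borelD(1)[OF f]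
  let ?\<rho> = "mrestr \<pi> (A_plus C)"
  have f': "?\<rho> \<in> fin_borel" by (rule mrestr_fin_borel[OF f sets_A_plus])
  have meas: "fst \<in> measurable ?\<rho> borel" "snd \<in> measurable ?\<rho> borel"
    using measurable_fst_snd_borel s by (auto cong: measurable_cong_sets)
  note v = measurable_sets_borel[OF measurable_fst_snd_borel(1)] measurable_sets_borel[OF measurable_fst_snd_borel(2)]
  have "distr ?\<rho> borel fst = mu_plus_comp \<mu> \<nu> C"
  proof (rule measure_eqI)
    fix X assume "X \<in> sets (distr ?\<rho> borel fst)"
    then have X: "X \<in> sets borel" by simp
    then show "emeasure (distr ?\<rho> borel fst) X = emeasure (mu_plus_comp \<mu> \<nu> C) X"
      using v(1)[OF X] restricted_plan_marginals(1)[OF assms X] s fin_borelD(2)[OF f']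
      by (simp add: emeasure_distr[OF meas(1)] emeasure_mrestr)
  qed simp
  moreover have "distr ?\<rho> borel snd = nu_plus_comp \<mu> \<nu> C"
  proof (rule measure_eqI)
    fix X assume "X \<in> sets (distr ?\<rho> borel snd)"
    then have X: "X \<in> sets borel" by simp
    then show "emeasure (distr ?\<rho> borel snd) X = emeasure (nu_plus_comp \<mu> \<nu> C) X"
      using v(2)[OF X] restricted_plan_marginals(2)[OF assms X] s fin_borelD(2)[OF f']
      by (simp add: emeasure_distr[OF meas(2)] emeasure_mrestr)
  qed simp
  ultimately show ?thesis
    using f' mrestr_cyclically_monotone[OF f pi(2) sets_A_plus] by (simp add: CMarg_def Marg_def)
qed

end

text \<open>Transposing, restricting and transposing back transfers the result on
  \<open>A_plus\<close> to the negative components.\<close>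

lemma mrestr_A_minus_swap:
  assumes "sets \<pi> = sets borel"
  shows "mrestr \<pi> (A_minus C) = distr (mrestr (distr \<pi> borel prod.swap) (A_plus C)) borel prod.swap"
proof (rule measure_eqI)
  let ?\<rho> = "mrestr (distr \<pi> borel prod.swap) (A_plus C)"
  fix X assume "X \<in> sets (mrestr \<pi> (A_minus C))"
  then have X: "X \<in> sets borel" using assms by simp
  have vX: "prod.swap -` X \<in> sets borel" using measurable_sets_borel[OF swap_borel X] by simp
  have m: "prod.swap \<in> measurable \<pi> borel" "prod.swap \<in> measurable ?\<rho> borel"
    using swap_borel assms by (auto cong: measurable_cong_sets)
  have sp: "space \<pi> = UNIV" "space ?\<rho> = UNIV"
    using sets_eq_imp_space_eq[OF assms] sets_eq_imp_space_eq[of ?\<rho> borel] by auto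
  have "prod.swap -` (A_plus C \<inter> prod.swap -` X) = A_minus C \<inter> X" by (auto simp: A_minus_eq_swap)
  then show "emeasure (mrestr \<pi> (A_minus C)) X = emeasure (distr ?\<rho> borel prod.swap) X"
    using X vX sp assms by (simp add: emeasure_distr[OF m(1)] emeasure_distr[OF m(2)] emeasure_mrestr)
qed (simp add: assms)

context mass_pair
begin

lemma mrestr_A_minus_CMarg:
  assumes "\<pi> \<in> CMarg \<mu> \<nu>" "C \<in> K_minus \<mu> \<nu>"
  shows "mrestr \<pi> (A_minus C) \<in> CMarg (mu_minus_comp \<mu> \<nu> C) (nu_minus_comp \<mu> \<nu> C)"
proof -
  have "sets \<pi> = sets borel" using assms(1) fin_borelD(1)[OF MargD(1)] by (auto simp: CMarg_def)
  moreover have "mrestr (distr \<pi> borel prod.swap) (A_plus C) \<in> CMarg (mu_plus_comp \<nu> \<mu> C) (nu_plus_comp \<nu> \<mu> C)"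
    using assms(2) by (intro swap.mrestr_A_plus_CMarg CMarg_swap[OF assms(1)]) (simp add: K_minus_swap)
  ultimately show ?thesis
    unfolding mu_minus_comp_swap nu_minus_comp_swap by (simp add: mrestr_A_minus_swap CMarg_swap)
qed

text \<open>The marginals are found by subtraction: those of \<open>\<pi>\<close> decompose once
  along the restrictions and once along the components of \<open>\<mu>\<close> and
  \<open>\<nu>\<close>, and all parts but the last are already known to agree.\<close>

lemma mrestr_A_eq_CMarg:
  assumes "\<pi> \<in> CMarg \<mu> \<nu>"
  shows "mrestr \<pi> (A_eq \<mu> \<nu>) \<in> CMarg (mu_eq \<mu> \<nu>) (nu_eq \<mu> \<nu>)"
proof -
  have pi: "\<pi> \<in> Marg \<mu> \<nu>" "cyclically_monotone_measure \<pi>" using assms(1) by (simp_all add: CMarg_def)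
  note f = MargD(1)[OF pi(1)]
  let ?\<rho> = "mrestr \<pi> (A_eq \<mu> \<nu>)"
  have s: "sets ?\<rho> = sets borel" using fin_borelD(1)[OF f] by simp
  let ?p = "\<lambda>C\<in>K_plus \<mu> \<nu>. mrestr \<pi> (A_plus C)" and ?m = "\<lambda>C\<in>K_minus \<mu> \<nu>. mrestr \<pi> (A_minus C)"
  have P: "?p C \<in> CMarg (mu_plus_comp \<mu> \<nu> C) (nu_plus_comp \<mu> \<nu> C)" if "C \<in> K_plus \<mu> \<nu>" for C
    using mrestr_A_plus_CMarg[OF assms that] that by simp
  have M: "?m C \<in> CMarg (mu_minus_comp \<mu> \<nu> C) (nu_minus_comp \<mu> \<nu> C)" if "C \<in> K_minus \<mu> \<nu>" for C
    using mrestr_A_minus_CMarg[OF assms that] that by simp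
  have "distr (glue \<mu> \<nu> (?p, ?m, ?\<rho>)) borel fst = mu_plus \<mu> \<nu> \<oplus>\<^sub>m mu_minus \<mu> \<nu> \<oplus>\<^sub>m distr ?\<rho> borel fst"
    using P M s by (rule distr_glue(1))
  moreover have "distr (glue \<mu> \<nu> (?p, ?m, ?\<rho>)) borel snd = nu_plus \<mu> \<nu> \<oplus>\<^sub>m nu_minus \<mu> \<nu> \<oplus>\<^sub>m distr ?\<rho> borel snd"
    using P M s by (rule distr_glue(2))
  moreover have "glue \<mu> \<nu> (?p, ?m, ?\<rho>) = \<pi>"
    using glue_restrictions[OF assms] by (simp add: restrictions_def)
  moreover have "distr \<pi> borel fst = \<mu>" "distr \<pi> borel snd = \<nu>" using pi(1) by (auto simp: Marg_def)
  ultimately have "distr ?\<rho> borel fst = mu_eq \<mu> \<nu>" "distr ?\<rho> borel snd = nu_eq \<mu> \<nu>"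
    using madd_left_cancel[of "mu_plus \<mu> \<nu> \<oplus>\<^sub>m mu_minus \<mu> \<nu>" "distr ?\<rho> borel fst" "mu_eq \<mu> \<nu>"]
      madd_left_cancel[of "nu_plus \<mu> \<nu> \<oplus>\<^sub>m nu_minus \<mu> \<nu>" "distr ?\<rho> borel snd" "nu_eq \<mu> \<nu>"]
      recompose_mu recompose_nu fin_mu swap.fin_mu by (simp_all add: nu_eq_swap)
  then show ?thesis
    using mrestr_fin_borel[OF f sets_A_eq] mrestr_cyclically_monotone[OF f pi(2) sets_A_eq]
    by (simp add: CMarg_def Marg_def)
qed

section \<open>The bijection and its inverse\<close>

lemma restrictions_in_plan_families:
  assumes "\<pi> \<in> CMarg \<mu> \<nu>"
  shows "restrictions \<pi> \<in> plan_families \<mu> \<nu>"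
  using mrestr_A_plus_CMarg[OF assms] mrestr_A_minus_CMarg[OF assms] mrestr_A_eq_CMarg[OF assms]
  by (auto simp: restrictions_def plan_families_def)

lemma bij_betw_glue: "bij_betw (glue \<mu> \<nu>) (plan_families \<mu> \<nu>) (CMarg \<mu> \<nu>)"
  by (rule bij_betwI[of _ _ _ restrictions])
    (auto intro: glue_in_CMarg restrictions_in_plan_families simp: restrictions_glue glue_restrictions)

lemma inv_into_glue:
  assumes "\<pi> \<in> CMarg \<mu> \<nu>"
  shows "inv_into (plan_families \<mu> \<nu>) (glue \<mu> \<nu>) \<pi> = restrictions \<pi>"
  using bij_betw_glue restrictions_in_plan_families[OF assms] glue_restrictions[OF assms]
  by (intro inv_into_f_eq) (auto simp: bij_betw_def)

end

theorem theorem2p37: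
  fixes \<mu> \<nu> :: "real measure"
  assumes "(\<mu>, \<nu>) \<in> same_mass_pairs"
  shows "(\<forall>C\<in>K_plus \<mu> \<nu>. mu_plus_comp \<mu> \<nu> C \<le>\<^sub>F nu_plus_comp \<mu> \<nu> C) \<and>
    (\<forall>C\<in>K_minus \<mu> \<nu>. nu_minus_comp \<mu> \<nu> C \<le>\<^sub>F mu_minus_comp \<mu> \<nu> C) \<and>
    mu_eq \<mu> \<nu> = nu_eq \<mu> \<nu> \<and>
    bij_betw (glue \<mu> \<nu>) (plan_families \<mu> \<nu>) (CMarg \<mu> \<nu>) \<and>
    (\<forall>\<pi>\<in>CMarg \<mu> \<nu>. inv_into (plan_families \<mu> \<nu>) (glue \<mu> \<nu>) \<pi> =
      ((\<lambda>C\<in>K_plus \<mu> \<nu>. mrestr \<pi> (A_plus C)),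
       (\<lambda>C\<in>K_minus \<mu> \<nu>. mrestr \<pi> (A_minus C)),
       mrestr \<pi> (A_eq \<mu> \<nu>)))"
proof -
  interpret mass_pair \<mu> \<nu> by unfold_locales (rule assms)
  show ?thesis
    using comp_F_le swap.comp_F_le mu_eq_eq_nu_eq bij_betw_glue inv_into_glue
    unfolding restrictions_def K_minus_swap[of \<mu> \<nu>] mu_minus_comp_swap nu_minus_comp_swap by blast
qed

end
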